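(* Consider the interference channel model with common receiver side information $W_1=W_2=W$ such that $S_1-W-S_2$ is a Markov chain, and suppose the channel is a strong interference channel. Then source-channel rate $b$ is achievable if there exist $Q$ with $|\mathcal{Q}|\le4$ and a distribution $p(q)p(x_1|q)p(x_2|q)$ such that for $k=1,2$: $$H(S_1|W)<b\,I(X_1;Y_k|X_2,Q),\quad H(S_2|W)<b\,I(X_2;Y_k|X_1,Q),\quad H(S_1|W)+H(S_2|W)<b\,I(X_1,X_2;Y_k|Q);$$ conversely, if $b$ is achievable these hold with $<$ replaced by $\le$ for some distribution of the same form.
   Context: Interference channel model: $\{(S_{1,k},S_{2,k},W_{k})\}_{k\ge1}$ i.i.d. $\sim p(s_1,s_2,w)$ on finite alphabets. Transmitter $i$ observes $S_i^m$ and sends $X_i^n=f_i^{(m,n)}(S_i^m)$ over a discrete memoryless channel $p(y_1,y_2|x_1,x_2)$ with finite alphabets. Receiver $k$ observes $(Y_k^n,W^m)$ and outputs an estimate $\hat S_{k,k}^m$ of its own transmitter's source only. Error probability $P_e^{(m,n)}=\Pr\{\bigcup_{k=1,2}\{S_k^m\neq\hat S_{k,k}^m\}\}$. Rate $b$ is achievable if for every $\epsilon>0$ there exist positive integers $m,n$ with $n/m=b$ and encoders/decoders with $P_e^{(m,n)}<\epsilon$. Strong interference channel: $I(X_1;Y_1|X_2)\le I(X_1;Y_2|X_2)$ and $I(X_2;Y_2|X_1)\le I(X_2;Y_1|X_1)$ for all product input distributions $p(x_1)p(x_2)$.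
   Formalization: The rate b is additionally assumed rational: since achievability demands n/m = b exactly with integers m, n, no irrational b is achievable, so the direct part fails for irrational b, while the converse is vacuous there. *)

theory Defs
  imports Complex_Main
begin

definition is_pmf :: "('a::finite \<Rightarrow> real) \<Rightarrow> bool" where
  "is_pmf p \<longleftrightarrow> (\<forall>x. 0 \<le> p x) \<and> (\<Sum>x\<in>UNIV. p x) = 1"

definition mprob :: "'o set \<Rightarrow> ('o \<Rightarrow> real) \<Rightarrow> ('o \<Rightarrow> 'a) \<Rightarrow> 'a \<Rightarrow> real" where
  "mprob \<Omega> J A a = (\<Sum>v\<in>{v\<in>\<Omega>. A v = a}. J v)"

definition cond_ent :: "'o set \<Rightarrow> ('o \<Rightarrow> real) \<Rightarrow> ('o \<Rightarrow> 'a) \<Rightarrow> ('o \<Rightarrow> 'c) \<Rightarrow> real" where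
  "cond_ent \<Omega> J A C =
     - (\<Sum>v\<in>\<Omega>. J v * log 2 (mprob \<Omega> J (\<lambda>v. (A v, C v)) (A v, C v) / mprob \<Omega> J C (C v)))"

definition cond_mi :: "'o set \<Rightarrow> ('o \<Rightarrow> real) \<Rightarrow> ('o \<Rightarrow> 'a) \<Rightarrow> ('o \<Rightarrow> 'b) \<Rightarrow> ('o \<Rightarrow> 'c) \<Rightarrow> real" where
  "cond_mi \<Omega> J A B C =
     (\<Sum>v\<in>\<Omega>. J v * log 2
        ((mprob \<Omega> J (\<lambda>v. (A v, B v, C v)) (A v, B v, C v) * mprob \<Omega> J C (C v)) /
         (mprob \<Omega> J (\<lambda>v. (A v, C v)) (A v, C v) * mprob \<Omega> J (\<lambda>v. (B v, C v)) (B v, C v))))"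

definition valid_source :: "('s1::finite \<Rightarrow> 's2::finite \<Rightarrow> 'w::finite \<Rightarrow> real) \<Rightarrow> bool" where
  "valid_source P \<longleftrightarrow> (\<forall>s1 s2 w. 0 \<le> P s1 s2 w) \<and> (\<Sum>s1\<in>UNIV. \<Sum>s2\<in>UNIV. \<Sum>w\<in>UNIV. P s1 s2 w) = 1"

definition valid_channel :: "('x1::finite \<Rightarrow> 'x2::finite \<Rightarrow> 'y1::finite \<Rightarrow> 'y2::finite \<Rightarrow> real) \<Rightarrow> bool" where
  "valid_channel Ch \<longleftrightarrow> (\<forall>x1 x2 y1 y2. 0 \<le> Ch x1 x2 y1 y2) \<and>
     (\<forall>x1 x2. (\<Sum>y1\<in>UNIV. \<Sum>y2\<in>UNIV. Ch x1 x2 y1 y2) = 1)"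

definition markov_S1_W_S2 :: "('s1::finite \<Rightarrow> 's2::finite \<Rightarrow> 'w::finite \<Rightarrow> real) \<Rightarrow> bool" where
  "markov_S1_W_S2 P \<longleftrightarrow> (\<forall>s1 s2 w.
     P s1 s2 w * (\<Sum>a\<in>UNIV. \<Sum>c\<in>UNIV. P a c w) =
     (\<Sum>c\<in>UNIV. P s1 c w) * (\<Sum>a\<in>UNIV. P a s2 w))"

definition src_joint :: "('s1 \<Rightarrow> 's2 \<Rightarrow> 'w \<Rightarrow> real) \<Rightarrow> 's1 \<times> 's2 \<times> 'w \<Rightarrow> real" where
  "src_joint P = (\<lambda>(s1, s2, w). P s1 s2 w)"

definition H_S1_W :: "('s1::finite \<Rightarrow> 's2::finite \<Rightarrow> 'w::finite \<Rightarrow> real) \<Rightarrow> real" where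
  "H_S1_W P = cond_ent UNIV (src_joint P) (\<lambda>(s1, s2, w). s1) (\<lambda>(s1, s2, w). w)"

definition H_S2_W :: "('s1::finite \<Rightarrow> 's2::finite \<Rightarrow> 'w::finite \<Rightarrow> real) \<Rightarrow> real" where
  "H_S2_W P = cond_ent UNIV (src_joint P) (\<lambda>(s1, s2, w). s2) (\<lambda>(s1, s2, w). w)"

definition prod_joint :: "('x1 \<Rightarrow> real) \<Rightarrow> ('x2 \<Rightarrow> real) \<Rightarrow> ('x1 \<Rightarrow> 'x2 \<Rightarrow> 'y1 \<Rightarrow> 'y2 \<Rightarrow> real)
    \<Rightarrow> 'x1 \<times> 'x2 \<times> 'y1 \<times> 'y2 \<Rightarrow> real" where
  "prod_joint p1 p2 Ch = (\<lambda>(x1, x2, y1, y2). p1 x1 * p2 x2 * Ch x1 x2 y1 y2)"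

definition strong_interference ::
    "('x1::finite \<Rightarrow> 'x2::finite \<Rightarrow> 'y1::finite \<Rightarrow> 'y2::finite \<Rightarrow> real) \<Rightarrow> bool" where
  "strong_interference Ch \<longleftrightarrow> (\<forall>p1 p2. is_pmf p1 \<and> is_pmf p2 \<longrightarrow>
     cond_mi UNIV (prod_joint p1 p2 Ch) (\<lambda>(x1,x2,y1,y2). x1) (\<lambda>(x1,x2,y1,y2). y1) (\<lambda>(x1,x2,y1,y2). x2)
       \<le> cond_mi UNIV (prod_joint p1 p2 Ch) (\<lambda>(x1,x2,y1,y2). x1) (\<lambda>(x1,x2,y1,y2). y2) (\<lambda>(x1,x2,y1,y2). x2) \<and>
     cond_mi UNIV (prod_joint p1 p2 Ch) (\<lambda>(x1,x2,y1,y2). x2) (\<lambda>(x1,x2,y1,y2). y2) (\<lambda>(x1,x2,y1,y2). x1)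
       \<le> cond_mi UNIV (prod_joint p1 p2 Ch) (\<lambda>(x1,x2,y1,y2). x2) (\<lambda>(x1,x2,y1,y2). y1) (\<lambda>(x1,x2,y1,y2). x1))"

definition seqs :: "nat \<Rightarrow> 'a list set" where
  "seqs m = {xs. length xs = m}"

definition src_prob :: "('s1 \<Rightarrow> 's2 \<Rightarrow> 'w \<Rightarrow> real) \<Rightarrow> nat \<Rightarrow> 's1 list \<Rightarrow> 's2 list \<Rightarrow> 'w list \<Rightarrow> real" where
  "src_prob P m s1 s2 w = (\<Prod>i<m. P (s1 ! i) (s2 ! i) (w ! i))"

definition ch_prob :: "('x1 \<Rightarrow> 'x2 \<Rightarrow> 'y1 \<Rightarrow> 'y2 \<Rightarrow> real) \<Rightarrow> nat \<Rightarrow> 'x1 list \<Rightarrow> 'x2 list \<Rightarrow> 'y1 list \<Rightarrow> 'y2 list \<Rightarrow> real" where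
  "ch_prob Ch n x1 x2 y1 y2 = (\<Prod>j<n. Ch (x1 ! j) (x2 ! j) (y1 ! j) (y2 ! j))"

definition err_prob ::
  "('s1::finite \<Rightarrow> 's2::finite \<Rightarrow> 'w::finite \<Rightarrow> real) \<Rightarrow> ('x1 \<Rightarrow> 'x2 \<Rightarrow> 'y1::finite \<Rightarrow> 'y2::finite \<Rightarrow> real)
   \<Rightarrow> nat \<Rightarrow> nat \<Rightarrow> ('s1 list \<Rightarrow> 'x1 list) \<Rightarrow> ('s2 list \<Rightarrow> 'x2 list)
   \<Rightarrow> ('y1 list \<Rightarrow> 'w list \<Rightarrow> 's1 list) \<Rightarrow> ('y2 list \<Rightarrow> 'w list \<Rightarrow> 's2 list) \<Rightarrow> real" where
  "err_prob P Ch m n f1 f2 g1 g2 =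
     (\<Sum>s1\<in>seqs m. \<Sum>s2\<in>seqs m. \<Sum>w\<in>seqs m. \<Sum>y1\<in>seqs n. \<Sum>y2\<in>seqs n.
        src_prob P m s1 s2 w * ch_prob Ch n (f1 s1) (f2 s2) y1 y2 *
        (if g1 y1 w \<noteq> s1 \<or> g2 y2 w \<noteq> s2 then 1 else 0))"

definition achievable ::
  "('s1::finite \<Rightarrow> 's2::finite \<Rightarrow> 'w::finite \<Rightarrow> real) \<Rightarrow> ('x1::finite \<Rightarrow> 'x2::finite \<Rightarrow> 'y1::finite \<Rightarrow> 'y2::finite \<Rightarrow> real)
   \<Rightarrow> real \<Rightarrow> bool" where
  "achievable P Ch b \<longleftrightarrow> (\<forall>\<epsilon>>0. \<exists>m n. 0 < m \<and> 0 < n \<and> real n / real m = b \<and>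
     (\<exists>(f1 :: 's1 list \<Rightarrow> 'x1 list) (f2 :: 's2 list \<Rightarrow> 'x2 list)
        (g1 :: 'y1 list \<Rightarrow> 'w list \<Rightarrow> 's1 list) (g2 :: 'y2 list \<Rightarrow> 'w list \<Rightarrow> 's2 list).
        (\<forall>s\<in>seqs m. length (f1 s) = n) \<and> (\<forall>s\<in>seqs m. length (f2 s) = n) \<and>
        err_prob P Ch m n f1 f2 g1 g2 < \<epsilon>))"

text \<open>Q takes values in {0,1,2,3} (i.e. |Q| \<le> 4); joint p(q)p(x1|q)p(x2|q)p(y1,y2|x1,x2).\<close>
definition Q_dist :: "(nat \<Rightarrow> real) \<Rightarrow> (nat \<Rightarrow> 'x1::finite \<Rightarrow> real) \<Rightarrow> (nat \<Rightarrow> 'x2::finite \<Rightarrow> real) \<Rightarrow> bool" where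
  "Q_dist pq p1 p2 \<longleftrightarrow> (\<forall>q. 0 \<le> pq q) \<and> (\<Sum>q<4. pq q) = 1 \<and>
     (\<forall>q<4. is_pmf (p1 q) \<and> is_pmf (p2 q))"

definition Q_omega :: "(nat \<times> 'x1 \<times> 'x2 \<times> 'y1 \<times> 'y2) set" where
  "Q_omega = {..<4} \<times> UNIV"

definition Q_joint :: "(nat \<Rightarrow> real) \<Rightarrow> (nat \<Rightarrow> 'x1 \<Rightarrow> real) \<Rightarrow> (nat \<Rightarrow> 'x2 \<Rightarrow> real)
    \<Rightarrow> ('x1 \<Rightarrow> 'x2 \<Rightarrow> 'y1 \<Rightarrow> 'y2 \<Rightarrow> real) \<Rightarrow> nat \<times> 'x1 \<times> 'x2 \<times> 'y1 \<times> 'y2 \<Rightarrow> real" where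
  "Q_joint pq p1 p2 Ch = (\<lambda>(q, x1, x2, y1, y2). pq q * p1 q x1 * p2 q x2 * Ch x1 x2 y1 y2)"

definition out_Y :: "nat \<Rightarrow> nat \<times> 'x1 \<times> 'x2 \<times> 'y1 \<times> 'y2 \<Rightarrow> 'y1 + 'y2" where
  "out_Y k = (\<lambda>(q, x1, x2, y1, y2). if k = 1 then Inl y1 else Inr y2)"

text \<open>The three inequalities for both k = 1,2, with relation R (strict \<open><\<close> or \<open>\<le>\<close>).\<close>
definition region_conds ::
  "(real \<Rightarrow> real \<Rightarrow> bool) \<Rightarrow> ('s1::finite \<Rightarrow> 's2::finite \<Rightarrow> 'w::finite \<Rightarrow> real)
   \<Rightarrow> ('x1::finite \<Rightarrow> 'x2::finite \<Rightarrow> 'y1::finite \<Rightarrow> 'y2::finite \<Rightarrow> real) \<Rightarrow> real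
   \<Rightarrow> (nat \<Rightarrow> real) \<Rightarrow> (nat \<Rightarrow> 'x1 \<Rightarrow> real) \<Rightarrow> (nat \<Rightarrow> 'x2 \<Rightarrow> real) \<Rightarrow> bool" where
  "region_conds R P Ch b pq p1 p2 \<longleftrightarrow> (\<forall>k\<in>{1::nat, 2}.
     R (H_S1_W P) (b * cond_mi Q_omega (Q_joint pq p1 p2 Ch)
          (\<lambda>(q,x1,x2,y1,y2). x1) (out_Y k) (\<lambda>(q,x1,x2,y1,y2). (x2, q))) \<and>
     R (H_S2_W P) (b * cond_mi Q_omega (Q_joint pq p1 p2 Ch)
          (\<lambda>(q,x1,x2,y1,y2). x2) (out_Y k) (\<lambda>(q,x1,x2,y1,y2). (x1, q))) \<and>
     R (H_S1_W P + H_S2_W P) (b * cond_mi Q_omega (Q_joint pq p1 p2 Ch)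
          (\<lambda>(q,x1,x2,y1,y2). (x1, x2)) (out_Y k) (\<lambda>(q,x1,x2,y1,y2). q)))"

end

theory Submission
  imports Defs "HOL-Analysis.Analysis"
begin

text \<open>
  Achievability. Draw a time-sharing sequence and two random codebooks with one codeword per source
  sequence. Each receiver looks for a pair \<open>(s\<^sub>1, s\<^sub>2)\<close> whose channel likelihood ratios, multiplied
  by the conditional source probabilities given \<open>w\<close>, exceed a threshold \<open>\<tau> = 2\<^bsup>\<gamma>n\<^esup>\<close>. Since these
  conditional probabilities sum to one, the expected number of wrong pairs above the threshold is at
  most \<open>3/\<tau>\<close>, and the true pair falls below it with exponentially small probability by Chernoff's
  bound, whose exponent is positive because of the strict inequalities. Neither the Markov chain nor
  strong interference plays a role here.

  Converse. Given \<open>W\<^sup>m\<close> the sources are independent, so for each \<open>w\<close> the two channel inputs are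
  independent. Fano's inequality bounds the source entropies by \<open>n\<close>-letter informations. Strong
  interference, applied with \<open>X\<^sub>1\<close> deterministic, says that for every \<open>x\<^sub>1\<close> the channel
  \<open>x\<^sub>2 \<mapsto> Y\<^sub>1\<close> is more capable than \<open>x\<^sub>2 \<mapsto> Y\<^sub>2\<close>; this tensorizes, which lets receiver 1 take over the
  information of receiver 2 in the sum bound. After single-letterization the rates are dominated by a point of the
  convex hull of a compact subset of \<open>\<real>\<^sup>4\<close>: the two single-user informations of the own
  receivers and the two sum informations. Four coordinates suffice since strong interference takes
  care of the other two bounds, and four points suffice since the point can be moved to the boundary
  of the hull.
\<close>

section \<open>Sums over sequences\<close>

text \<open>Strong interference is a statement about single letters with independent inputs, while
  the blocks of a code have letters that depend on each other. Fixing the whole block of user 1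
  closes this gap: the outputs then come from the channels \<open>V (x ! j)\<close>, one for each
  position, and a comparison that holds for every law of the second input can be exchanged position
  by position, whatever the law of the second block is.

  The time-sharing variable of the converse is the pair of \<open>w\<close> and a position
  \<open>j\<close>. Averaging over \<open>w\<close> first would couple the two inputs, so
  \<open>w\<close> has to stay in it. Its range grows with the block length, and only the reduction
  to four points gives it a fixed size.

  The converse must end in a limit: each error level brings its own code and its own block lengths,
  and the inequalities hold only up to a loss. Compactness of the set of information points makes
  them exact. In the direct part the inequalities are strict, so one positive threshold exponent
  \<gamma> fits into all six gaps at once.\<close>

lemma finite_seqs [simp]: "finite (seqs n :: 'a::finite list set)"
proof -
  have "finite {xs::'a list. set xs \<subseteq> UNIV \<and> length xs = n}"
    by (rule finite_lists_length_eq) simp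
  then show ?thesis by (simp add: seqs_def)
qed

lemma card_seqs: "card (seqs n :: 'a::finite list set) = CARD('a) ^ n"
proof -
  have "card {xs::'a list. set xs \<subseteq> UNIV \<and> length xs = n} = CARD('a) ^ n"
    by (rule card_lists_length_eq) simp
  then show ?thesis by (simp add: seqs_def)
qed

lemma length_seqs: "xs \<in> seqs n \<Longrightarrow> length xs = n"
  by (simp add: seqs_def)

lemma seqs_nonempty: "seqs n \<noteq> {}"
proof -
  have "replicate n undefined \<in> seqs n" by (simp add: seqs_def)
  then show ?thesis by blast
qed

text \<open>Splitting off the last letter instead of the head keeps the indices of the other
  letters, so that factors depending on the position need no shift.\<close>

lemma sum_seqs_Suc:
  "(\<Sum>xs\<in>seqs (Suc n). f xs) = (\<Sum>xs\<in>seqs n. \<Sum>x\<in>(UNIV::'a::finite set). f (xs @ [x]))"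
proof -
  have eq: "seqs (Suc n) = (\<lambda>(xs, x). xs @ [x]) ` (seqs n \<times> (UNIV::'a set))" (is "?A = ?B")
  proof
    show "?A \<subseteq> ?B"
    proof
      fix xs :: "'a list" assume "xs \<in> ?A"
      then have "length xs = Suc n" by (simp add: seqs_def)
      then have "xs = (\<lambda>(xs, x). xs @ [x]) (butlast xs, last xs)" "butlast xs \<in> seqs n"
        by (auto simp: seqs_def intro!: append_butlast_last_id[symmetric])
      then show "xs \<in> ?B" by blast
    qed
  qed (auto simp: seqs_def)
  have "inj_on (\<lambda>(xs, x). xs @ [x]) (seqs n \<times> (UNIV::'a set))"
    by (auto simp: inj_on_def)
  then show ?thesis
    unfolding eq by (subst sum.reindex) (auto simp: sum.cartesian_product case_prod_unfold)
qed

lemma prod_append_nth: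
  assumes "xs \<in> seqs n"
  shows "(\<Prod>j<Suc n. g j ((xs @ [x]) ! j)) = (\<Prod>j<n. g j (xs ! j)) * g n x"
  using assms by (simp add: seqs_def nth_append)

lemma sum_seqs_prod:
  fixes g :: "nat \<Rightarrow> 'a::finite \<Rightarrow> real"
  shows "(\<Sum>xs\<in>seqs n. \<Prod>j<n. g j (xs ! j)) = (\<Prod>j<n. \<Sum>x\<in>UNIV. g j x)"
proof (induction n)
  case 0
  then show ?case by (simp add: seqs_def)
next
  case (Suc n)
  have "(\<Sum>xs\<in>seqs (Suc n). \<Prod>j<Suc n. g j (xs ! j))
      = (\<Sum>xs\<in>seqs n. \<Sum>x\<in>UNIV. (\<Prod>j<n. g j (xs ! j)) * g n x)"
    unfolding sum_seqs_Suc by (intro sum.cong refl prod_append_nth)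
  also have "\<dots> = (\<Sum>xs\<in>seqs n. \<Prod>j<n. g j (xs ! j)) * (\<Sum>x\<in>UNIV. g n x)"
    by (simp add: sum_product)
  finally show ?case using Suc by simp
qed

text \<open>Absorbing \<open>\<phi>\<close> into the factor at \<open>i\<close> keeps the product
  form, and all other factors sum to one.\<close>

lemma sum_seqs_prod_coord:
  fixes g :: "nat \<Rightarrow> 'a::finite \<Rightarrow> real"
  assumes "i < n" and "\<And>j. j < n \<Longrightarrow> (\<Sum>x\<in>UNIV. g j x) = 1"
  shows "(\<Sum>xs\<in>seqs n. (\<Prod>j<n. g j (xs ! j)) * \<phi> (xs ! i)) = (\<Sum>x\<in>UNIV. g i x * \<phi> x)"
proof -
  let ?g = "\<lambda>j x. g j x * (if j = i then \<phi> x else 1)"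
  have "(\<Sum>xs\<in>seqs n. (\<Prod>j<n. g j (xs ! j)) * \<phi> (xs ! i))
      = (\<Sum>xs\<in>seqs n. \<Prod>j<n. ?g j (xs ! j))"
    using assms(1) by (simp add: prod.distrib prod.delta)
  also have "\<dots> = (\<Prod>j<n. \<Sum>x\<in>UNIV. ?g j x)" by (rule sum_seqs_prod)
  also have "\<dots> = (\<Prod>j<n. if j = i then (\<Sum>x\<in>UNIV. g i x * \<phi> x) else 1)"
    by (rule prod.cong) (use assms(2) in auto)
  also have "\<dots> = (\<Sum>x\<in>UNIV. g i x * \<phi> x)" using assms(1) by simp
  finally show ?thesis .
qed

lemma sum_seqs_prod3:
  fixes g :: "'a::finite \<Rightarrow> 'b::finite \<Rightarrow> 'c::finite \<Rightarrow> real"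
  shows "(\<Sum>a\<in>seqs n. \<Sum>b\<in>seqs n. \<Sum>c\<in>seqs n. \<Prod>j<n. g (a ! j) (b ! j) (c ! j))
    = (\<Sum>a\<in>UNIV. \<Sum>b\<in>UNIV. \<Sum>c\<in>UNIV. g a b c) ^ n"
proof -
  have "(\<Sum>a\<in>seqs n. \<Sum>b\<in>seqs n. \<Sum>c\<in>seqs n. \<Prod>j<n. g (a ! j) (b ! j) (c ! j))
     = (\<Sum>a\<in>seqs n. \<Sum>b\<in>seqs n. \<Prod>j<n. \<Sum>c\<in>UNIV. g (a ! j) (b ! j) c)"
    by (intro sum.cong refl) (rule sum_seqs_prod[of "\<lambda>j c. g (_ ! j) (_ ! j) c"])
  also have "\<dots> = (\<Sum>a\<in>seqs n. \<Prod>j<n. \<Sum>b\<in>UNIV. \<Sum>c\<in>UNIV. g (a ! j) b c)"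
    by (intro sum.cong refl) (rule sum_seqs_prod[of "\<lambda>j b. \<Sum>c\<in>UNIV. g (_ ! j) b c"])
  also have "\<dots> = (\<Sum>a\<in>UNIV. \<Sum>b\<in>UNIV. \<Sum>c\<in>UNIV. g a b c) ^ n"
    by (simp add: sum_seqs_prod[of "\<lambda>j a. \<Sum>b\<in>UNIV. \<Sum>c\<in>UNIV. g a b c"])
  finally show ?thesis .
qed

lemma sum_seqs_prod4:
  fixes g :: "'a::finite \<Rightarrow> 'b::finite \<Rightarrow> 'c::finite \<Rightarrow> 'd::finite \<Rightarrow> real"
  shows "(\<Sum>a\<in>seqs n. \<Sum>b\<in>seqs n. \<Sum>c\<in>seqs n. \<Sum>d\<in>seqs n. \<Prod>j<n. g (a ! j) (b ! j) (c ! j) (d ! j))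
    = (\<Sum>a\<in>UNIV. \<Sum>b\<in>UNIV. \<Sum>c\<in>UNIV. \<Sum>d\<in>UNIV. g a b c d) ^ n"
proof -
  have "(\<Sum>a\<in>seqs n. \<Sum>b\<in>seqs n. \<Sum>c\<in>seqs n. \<Sum>d\<in>seqs n. \<Prod>j<n. g (a ! j) (b ! j) (c ! j) (d ! j))
     = (\<Sum>a\<in>seqs n. \<Sum>b\<in>seqs n. \<Sum>c\<in>seqs n. \<Prod>j<n. \<Sum>d\<in>UNIV. g (a ! j) (b ! j) (c ! j) d)"
    by (intro sum.cong refl) (rule sum_seqs_prod[of "\<lambda>j d. g (_ ! j) (_ ! j) (_ ! j) d"])
  also have "\<dots> = (\<Sum>a\<in>UNIV. \<Sum>b\<in>UNIV. \<Sum>c\<in>UNIV. \<Sum>d\<in>UNIV. g a b c d) ^ n"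
    by (rule sum_seqs_prod3)
  finally show ?thesis .
qed

section \<open>Gibbs' and Fano's inequalities\<close>

text \<open>Integrates the tangent bound \<open>ln x \<le> x - 1\<close>. Only the total masses are
  compared, so \<open>q\<close> may be subnormalized, as the kernel in \<open>fano\<close>
  is.\<close>

lemma gibbs:
  fixes p q :: "'i \<Rightarrow> real"
  assumes "finite I" and "\<And>i. i \<in> I \<Longrightarrow> 0 \<le> p i" and "\<And>i. i \<in> I \<Longrightarrow> 0 \<le> q i"
    and "\<And>i. i \<in> I \<Longrightarrow> 0 < p i \<Longrightarrow> 0 < q i" and "sum q I \<le> sum p I"
  shows "0 \<le> (\<Sum>i\<in>I. p i * log 2 (p i / q i))"
proof -
  have "(p i - q i) / ln 2 \<le> p i * log 2 (p i / q i)" if "i \<in> I" for i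
  proof (cases "p i = 0")
    case True
    then show ?thesis using assms(3)[OF that] by (simp add: divide_nonpos_pos)
  next
    case False
    then have pos: "0 < p i" "0 < q i" using assms(2,4)[OF that] by auto
    have "ln (q i / p i) \<le> q i / p i - 1" using pos by (intro ln_le_minus_one) simp
    then have "p i * ln (q i / p i) \<le> p i * (q i / p i - 1)" using pos by (intro mult_left_mono) auto
    also have "\<dots> = q i - p i" using pos by (simp add: field_simps)
    finally have "p i - q i \<le> p i * ln (p i / q i)" using pos by (simp add: ln_div algebra_simps)
    then show ?thesis by (simp add: log_def divide_right_mono)
  qed
  then have "(\<Sum>i\<in>I. (p i - q i) / ln 2) \<le> (\<Sum>i\<in>I. p i * log 2 (p i / q i))"
    by (rule sum_mono)
  moreover have "(\<Sum>i\<in>I. (p i - q i) / ln 2) = (sum p I - sum q I) / ln 2"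
    by (simp add: sum_subtractf flip: sum_divide_distrib)
  moreover have "0 \<le> (sum p I - sum q I) / ln 2" using assms(5) by simp
  ultimately show ?thesis by linarith
qed

lemma gibbs2:
  fixes p q :: "'a \<Rightarrow> 'b \<Rightarrow> real"
  assumes "finite A" "finite B" and "\<And>a b. 0 \<le> p a b" and "\<And>a b. 0 \<le> q a b"
    and "\<And>a b. a \<in> A \<Longrightarrow> b \<in> B \<Longrightarrow> 0 < p a b \<Longrightarrow> 0 < q a b"
    and "(\<Sum>a\<in>A. \<Sum>b\<in>B. q a b) \<le> (\<Sum>a\<in>A. \<Sum>b\<in>B. p a b)"
  shows "0 \<le> (\<Sum>a\<in>A. \<Sum>b\<in>B. p a b * log 2 (p a b / q a b))"
proof -
  have "0 \<le> (\<Sum>i\<in>A\<times>B. case_prod p i * log 2 (case_prod p i / case_prod q i))"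
    by (rule gibbs) (use assms in \<open>auto simp: sum.cartesian_product\<close>)
  then show ?thesis by (simp add: sum.cartesian_product case_prod_unfold)
qed

lemma gibbs3:
  fixes p q :: "'a \<Rightarrow> 'b \<Rightarrow> 'c \<Rightarrow> real"
  assumes "finite A" "finite B" "finite C" and "\<And>a b c. 0 \<le> p a b c" and "\<And>a b c. 0 \<le> q a b c"
    and "\<And>a b c. a \<in> A \<Longrightarrow> b \<in> B \<Longrightarrow> c \<in> C \<Longrightarrow> 0 < p a b c \<Longrightarrow> 0 < q a b c"
    and "(\<Sum>a\<in>A. \<Sum>b\<in>B. \<Sum>c\<in>C. q a b c) \<le> (\<Sum>a\<in>A. \<Sum>b\<in>B. \<Sum>c\<in>C. p a b c)"
  shows "0 \<le> (\<Sum>a\<in>A. \<Sum>b\<in>B. \<Sum>c\<in>C. p a b c * log 2 (p a b c / q a b c))"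
proof -
  have "0 \<le> (\<Sum>a\<in>A. \<Sum>i\<in>B\<times>C. case_prod (p a) i * log 2 (case_prod (p a) i / case_prod (q a) i))"
    by (rule gibbs2) (use assms in \<open>auto simp: sum.cartesian_product\<close>)
  then show ?thesis by (simp add: sum.cartesian_product case_prod_unfold)
qed

text \<open>The comparison kernel gives mass \<open>1 - \<delta>\<close> to the decoded message. The textbook bound, with its
  additive constant 1, would be too weak: achievability with a rate \<open>b\<close> does not force the block
  length to grow, so that constant need not vanish after division by \<open>m\<close>.\<close>

lemma fano:
  fixes \<mu> :: "'c \<Rightarrow> real" and k :: "'c \<Rightarrow> 's \<Rightarrow> real" and N :: "'c \<Rightarrow> 's \<Rightarrow> 'y \<Rightarrow> real"
    and g :: "'c \<Rightarrow> 'y \<Rightarrow> 's"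
  assumes fin: "finite C" "finite S" "finite Y" and "S \<noteq> {}"
    and \<mu>0: "\<And>c. 0 \<le> \<mu> c" and k0: "\<And>c s. 0 \<le> k c s" and N0: "\<And>c s y. 0 \<le> N c s y"
    and \<mu>1: "(\<Sum>c\<in>C. \<mu> c) = 1" and k1: "\<And>c. c \<in> C \<Longrightarrow> (\<Sum>s\<in>S. k c s) = 1"
    and N1: "\<And>c s. c \<in> C \<Longrightarrow> s \<in> S \<Longrightarrow> (\<Sum>y\<in>Y. N c s y) = 1"
    and \<delta>: "0 < \<delta>" "\<delta> < 1"
    and err: "(\<Sum>c\<in>C. \<Sum>s\<in>S. \<Sum>y\<in>Y. \<mu> c * k c s * N c s y * of_bool (g c y \<noteq> s)) \<le> \<epsilon>"
  shows "- (\<Sum>c\<in>C. \<Sum>s\<in>S. \<mu> c * k c s * log 2 (k c s))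
    \<le> (\<Sum>c\<in>C. \<Sum>s\<in>S. \<Sum>y\<in>Y. \<mu> c * k c s * N c s y * log 2 (N c s y / (\<Sum>s'\<in>S. k c s' * N c s' y)))
      - log 2 (1 - \<delta>) + \<epsilon> * (log 2 (card S) - log 2 \<delta>)"
proof -
  define R where "R c y = (\<Sum>s'\<in>S. k c s' * N c s' y)" for c y
  \<comment> \<open>Dividing by \<open>card S\<close> instead of \<open>card S - 1\<close> leaves a
    total mass below one, which is enough for \<open>gibbs3\<close>, and avoids a singular case when
    \<open>S\<close> has one element. It also covers a decision \<open>g c y\<close> outside of
    \<open>S\<close>.\<close>
  define Q where "Q c s y = (if g c y = s then 1 - \<delta> else \<delta> / card S)" for c s y
  define p where "p c s y = \<mu> c * k c s * N c s y" for c s y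
  have cS: "0 < real (card S)" using \<open>S \<noteq> {}\<close> fin by (simp add: card_gt_0_iff)
  have R0: "0 \<le> R c y" for c y unfolding R_def by (intro sum_nonneg mult_nonneg_nonneg k0 N0)
  have p0: "0 \<le> p c s y" for c s y unfolding p_def by (intro mult_nonneg_nonneg \<mu>0 k0 N0)
  have Q0: "0 < Q c s y" for c s y using \<delta> cS by (simp add: Q_def)
  have Q1: "(\<Sum>s\<in>S. Q c s y) \<le> 1" for c y
  proof -
    have "(\<Sum>s\<in>S. Q c s y) \<le> (\<Sum>s\<in>S. (if s = g c y then 1 - \<delta> else 0) + \<delta> / card S)"
      by (rule sum_mono) (use \<delta> cS in \<open>auto simp: Q_def\<close>)
    also have "\<dots> = (if g c y \<in> S then 1 - \<delta> else 0) + \<delta>"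
      using fin \<open>S \<noteq> {}\<close> by (simp add: sum.distrib)
    also have "\<dots> \<le> 1" using \<delta> by simp
    finally show ?thesis .
  qed
  have Rpos: "0 < R c y" if "s \<in> S" "0 < p c s y" for c s y
  proof -
    have "0 < k c s * N c s y" using that \<mu>0[of c] k0[of c s] N0[of c s y]
      by (auto simp: p_def zero_less_mult_iff)
    also have "\<dots> \<le> R c y" unfolding R_def
      by (rule member_le_sum[of s S "\<lambda>s. k c s * N c s y"]) (use that fin k0 N0 in auto)
    finally show ?thesis .
  qed
  have psum: "(\<Sum>c\<in>C. \<Sum>s\<in>S. \<Sum>y\<in>Y. p c s y * f c s) = (\<Sum>c\<in>C. \<Sum>s\<in>S. \<mu> c * k c s * f c s)" for f
  proof (intro sum.cong refl)
    fix c s assume *: "c \<in> C" "s \<in> S"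
    have "(\<Sum>y\<in>Y. p c s y * f c s) = (\<mu> c * k c s * f c s) * (\<Sum>y\<in>Y. N c s y)"
      unfolding p_def sum_distrib_left by (intro sum.cong) auto
    then show "(\<Sum>y\<in>Y. p c s y * f c s) = \<mu> c * k c s * f c s" using N1[OF *] by simp
  qed
  have ptot: "(\<Sum>c\<in>C. \<Sum>s\<in>S. \<Sum>y\<in>Y. p c s y) = 1"
  proof -
    have "(\<Sum>c\<in>C. \<Sum>s\<in>S. \<Sum>y\<in>Y. p c s y) = (\<Sum>c\<in>C. \<mu> c * (\<Sum>s\<in>S. k c s))"
      using psum[of "\<lambda>_ _. 1"] by (simp add: sum_distrib_left)
    also have "\<dots> = 1" using k1 \<mu>1 by simp
    finally show ?thesis .
  qed
  \<comment> \<open>The comparison law draws \<open>y\<close> from the output law \<open>R c\<close>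
    and then guesses \<open>s\<close> with the kernel \<open>Q\<close>. That its divergence is
    nonnegative is the content of Fano's inequality.\<close>
  have "(\<Sum>c\<in>C. \<Sum>s\<in>S. \<Sum>y\<in>Y. \<mu> c * R c y * Q c s y) \<le> (\<Sum>c\<in>C. \<Sum>s\<in>S. \<Sum>y\<in>Y. p c s y)"
  proof (rule sum_mono)
    fix c assume "c \<in> C"
    have "(\<Sum>s\<in>S. \<Sum>y\<in>Y. \<mu> c * R c y * Q c s y) = (\<Sum>y\<in>Y. \<mu> c * R c y * (\<Sum>s\<in>S. Q c s y))"
      by (subst sum.swap) (simp add: sum_distrib_left)
    also have "\<dots> \<le> (\<Sum>y\<in>Y. \<mu> c * R c y * 1)"
      by (intro sum_mono mult_left_mono Q1 mult_nonneg_nonneg \<mu>0 R0)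
    also have "\<dots> = (\<Sum>s\<in>S. \<Sum>y\<in>Y. p c s y)"
      by (subst sum.swap) (simp add: R_def p_def sum_distrib_left mult.assoc)
    finally show "(\<Sum>s\<in>S. \<Sum>y\<in>Y. \<mu> c * R c y * Q c s y) \<le> (\<Sum>s\<in>S. \<Sum>y\<in>Y. p c s y)" .
  qed
  then have "0 \<le> (\<Sum>c\<in>C. \<Sum>s\<in>S. \<Sum>y\<in>Y. p c s y * log 2 (p c s y / (\<mu> c * R c y * Q c s y)))"
  proof (intro gibbs3)
    fix c s y assume "s \<in> S" "0 < p c s y"
    then have "0 < R c y" by (rule Rpos)
    moreover have "\<mu> c \<noteq> 0" using \<open>0 < p c s y\<close> by (auto simp: p_def)
    ultimately show "0 < \<mu> c * R c y * Q c s y" using \<mu>0[of c] Q0[of c s y] by simp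
  qed (simp_all add: fin p0 \<mu>0 R0 less_imp_le[OF Q0])
  also have "\<dots> \<le> (\<Sum>c\<in>C. \<Sum>s\<in>S. \<Sum>y\<in>Y. p c s y * log 2 (k c s) + p c s y * log 2 (N c s y / R c y)
       + (p c s y * (- log 2 (1 - \<delta>))
          + (log 2 (card S) - log 2 \<delta>) * (p c s y * of_bool (g c y \<noteq> s))))"
  proof (intro sum_mono)
    fix c s y assume *: "c \<in> C" "s \<in> S" "y \<in> Y"
    show "p c s y * log 2 (p c s y / (\<mu> c * R c y * Q c s y))
      \<le> p c s y * log 2 (k c s) + p c s y * log 2 (N c s y / R c y)
       + (p c s y * (- log 2 (1 - \<delta>))
          + (log 2 (card S) - log 2 \<delta>) * (p c s y * of_bool (g c y \<noteq> s)))"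
    proof (cases "p c s y = 0")
      case False
      then have pp: "0 < p c s y" using p0[of c s y] by simp
      then have pos: "0 < \<mu> c" "0 < k c s" "0 < N c s y" "0 < R c y"
        using \<mu>0[of c] k0[of c s] N0[of c s y] Rpos[OF *(2) pp] by (auto simp: p_def less_le)
      have "p c s y / (\<mu> c * R c y * Q c s y) = k c s * (N c s y / R c y) / Q c s y"
        using pos by (simp add: p_def)
      then have e: "log 2 (p c s y / (\<mu> c * R c y * Q c s y))
          = log 2 (k c s) + log 2 (N c s y / R c y) - log 2 (Q c s y)"
        using pos Q0[of c s y] by (simp add: log_mult log_divide)
      \<comment> \<open>A correct decision costs \<open>- log 2 (1 - \<delta>)\<close>. This cost is
        nonnegative, so it may be charged to the wrong decisions as well.\<close>
      have "- log 2 (Q c s y) \<le> - log 2 (1 - \<delta>)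
          + (log 2 (card S) - log 2 \<delta>) * of_bool (g c y \<noteq> s)"
        using \<delta> cS by (auto simp: Q_def log_divide)
      then have "log 2 (p c s y / (\<mu> c * R c y * Q c s y)) \<le> log 2 (k c s) + log 2 (N c s y / R c y)
          + (- log 2 (1 - \<delta>) + (log 2 (card S) - log 2 \<delta>) * of_bool (g c y \<noteq> s))"
        unfolding e by linarith
      then have "p c s y * log 2 (p c s y / (\<mu> c * R c y * Q c s y))
          \<le> p c s y * (log 2 (k c s) + log 2 (N c s y / R c y)
          + (- log 2 (1 - \<delta>) + (log 2 (card S) - log 2 \<delta>) * of_bool (g c y \<noteq> s)))"
        using p0 by (rule mult_left_mono)
      then show ?thesis by (simp add: algebra_simps)
    qed simp
  qed
  also have "\<dots> = (\<Sum>c\<in>C. \<Sum>s\<in>S. \<mu> c * k c s * log 2 (k c s))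
      + (\<Sum>c\<in>C. \<Sum>s\<in>S. \<Sum>y\<in>Y. p c s y * log 2 (N c s y / R c y))
      + (- log 2 (1 - \<delta>) + (log 2 (card S) - log 2 \<delta>)
          * (\<Sum>c\<in>C. \<Sum>s\<in>S. \<Sum>y\<in>Y. p c s y * of_bool (g c y \<noteq> s)))"
    unfolding sum.distrib psum
    by (simp only: sum_distrib_left[symmetric] sum_distrib_right[symmetric])
       (use k1 \<mu>1 in simp)
  also have "\<dots> \<le> (\<Sum>c\<in>C. \<Sum>s\<in>S. \<mu> c * k c s * log 2 (k c s))
      + (\<Sum>c\<in>C. \<Sum>s\<in>S. \<Sum>y\<in>Y. p c s y * log 2 (N c s y / R c y))
      + (- log 2 (1 - \<delta>) + (log 2 (card S) - log 2 \<delta>) * \<epsilon>)"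
  proof -
    have "0 \<le> log 2 (card S)" using cS by (simp add: zero_le_log_cancel_iff)
    moreover have "log 2 \<delta> \<le> 0" using \<delta> by simp
    ultimately show ?thesis using err by (intro add_left_mono mult_left_mono) (auto simp: p_def)
  qed
  finally show ?thesis by (simp add: p_def R_def algebra_simps)
qed

text \<open>The two sides differ by the divergence of the true output law \<open>R\<close> from
  \<open>Q\<close>. With a product law for \<open>Q\<close> this is the subadditivity of the output
  entropy, which reduces blocks to letters.\<close>

lemma output_entropy_bound:
  fixes \<mu> :: "'c \<Rightarrow> real" and k :: "'c \<Rightarrow> 's \<Rightarrow> real" and N :: "'c \<Rightarrow> 's \<Rightarrow> 'y \<Rightarrow> real"
    and Q :: "'c \<Rightarrow> 'y \<Rightarrow> real"
  assumes fin: "finite C" "finite S" "finite Y"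
    and \<mu>0: "\<And>c. 0 \<le> \<mu> c" and k0: "\<And>c s. 0 \<le> k c s" and N0: "\<And>c s y. 0 \<le> N c s y"
    and k1: "\<And>c. c \<in> C \<Longrightarrow> (\<Sum>s\<in>S. k c s) = 1"
    and N1: "\<And>c s. c \<in> C \<Longrightarrow> s \<in> S \<Longrightarrow> (\<Sum>y\<in>Y. N c s y) = 1"
    and Q0: "\<And>c y. 0 \<le> Q c y" and Q1: "\<And>c. c \<in> C \<Longrightarrow> (\<Sum>y\<in>Y. Q c y) \<le> 1"
    and Qpos: "\<And>c s y. c \<in> C \<Longrightarrow> s \<in> S \<Longrightarrow> y \<in> Y \<Longrightarrow> 0 < \<mu> c * k c s * N c s y \<Longrightarrow> 0 < Q c y"
  shows "(\<Sum>c\<in>C. \<Sum>s\<in>S. \<Sum>y\<in>Y. \<mu> c * k c s * N c s y * log 2 (N c s y / (\<Sum>s'\<in>S. k c s' * N c s' y)))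
    \<le> (\<Sum>c\<in>C. \<Sum>s\<in>S. \<Sum>y\<in>Y. \<mu> c * k c s * N c s y * log 2 (N c s y / Q c y))"
proof -
  define R where "R c y = (\<Sum>s'\<in>S. k c s' * N c s' y)" for c y
  have R0: "0 \<le> R c y" for c y unfolding R_def by (intro sum_nonneg mult_nonneg_nonneg k0 N0)
  have R1: "(\<Sum>y\<in>Y. R c y) = 1" if "c \<in> C" for c
  proof -
    have "(\<Sum>y\<in>Y. R c y) = (\<Sum>s\<in>S. k c s * (\<Sum>y\<in>Y. N c s y))"
      unfolding R_def by (subst sum.swap) (simp add: sum_distrib_left)
    then show ?thesis using N1 k1 that by simp
  qed
  have QR: "0 < Q c y" if "c \<in> C" "y \<in> Y" "0 < \<mu> c * R c y" for c y
  proof -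
    from that have "0 < \<mu> c" "0 < R c y" using \<mu>0[of c] R0[of c y] by (auto simp: zero_less_mult_iff)
    have "\<exists>s\<in>S. 0 < k c s * N c s y"
    proof (rule ccontr)
      assume "\<not> ?thesis"
      then have "R c y \<le> 0" unfolding R_def by (intro sum_nonpos) (simp add: not_less)
      with \<open>0 < R c y\<close> show False by simp
    qed
    then obtain s where "s \<in> S" "0 < k c s * N c s y" by blast
    then show ?thesis using Qpos[of c s y] that \<open>0 < \<mu> c\<close> by (simp add: mult.assoc)
  qed
  have "0 \<le> (\<Sum>c\<in>C. \<Sum>y\<in>Y. (\<mu> c * R c y) * log 2 ((\<mu> c * R c y) / (\<mu> c * Q c y)))"
  proof (rule gibbs2)
    show "(\<Sum>c\<in>C. \<Sum>y\<in>Y. \<mu> c * Q c y) \<le> (\<Sum>c\<in>C. \<Sum>y\<in>Y. \<mu> c * R c y)"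
      unfolding sum_distrib_left[symmetric]
      by (rule sum_mono, rule mult_left_mono[OF _ \<mu>0]) (use R1 Q1 in auto)
    show "0 < \<mu> c * Q c y" if "c \<in> C" "y \<in> Y" "0 < \<mu> c * R c y" for c y
      using QR[OF that] that \<mu>0[of c] R0[of c y] by (auto simp: zero_less_mult_iff)
  qed (use fin \<mu>0 R0 Q0 in auto)
  also have "\<dots> = (\<Sum>c\<in>C. \<Sum>y\<in>Y. \<Sum>s\<in>S. \<mu> c * k c s * N c s y * log 2 (R c y / Q c y))"
  proof (intro sum.cong refl)
    fix c y
    have "(\<mu> c * R c y) * log 2 ((\<mu> c * R c y) / (\<mu> c * Q c y)) = (\<mu> c * R c y) * log 2 (R c y / Q c y)"
      by (cases "\<mu> c = 0") auto
    also have "\<dots> = (\<Sum>s\<in>S. \<mu> c * k c s * N c s y * log 2 (R c y / Q c y))"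
      by (subst R_def) (simp add: sum_distrib_left sum_distrib_right mult.assoc)
    finally show "(\<mu> c * R c y) * log 2 ((\<mu> c * R c y) / (\<mu> c * Q c y)) = \<dots>" .
  qed
  also have "\<dots> = (\<Sum>c\<in>C. \<Sum>s\<in>S. \<Sum>y\<in>Y. \<mu> c * k c s * N c s y * log 2 (R c y / Q c y))"
    by (intro sum.cong refl sum.swap)
  also have "\<dots> = (\<Sum>c\<in>C. \<Sum>s\<in>S. \<Sum>y\<in>Y. \<mu> c * k c s * N c s y * log 2 (N c s y / Q c y)
      - \<mu> c * k c s * N c s y * log 2 (N c s y / R c y))"
  proof (intro sum.cong refl)
    fix c s y assume *: "c \<in> C" "s \<in> S" "y \<in> Y"
    show "\<mu> c * k c s * N c s y * log 2 (R c y / Q c y) = \<mu> c * k c s * N c s y * log 2 (N c s y / Q c y)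
      - \<mu> c * k c s * N c s y * log 2 (N c s y / R c y)"
    proof (cases "\<mu> c * k c s * N c s y = 0")
      case False
      then have pos: "0 < \<mu> c" "0 < k c s" "0 < N c s y"
        using \<mu>0[of c] k0[of c s] N0[of c s y] by (auto simp: less_le)
      have "0 < k c s * N c s y" using pos by simp
      also have "\<dots> \<le> R c y" unfolding R_def
        by (rule member_le_sum[of s S "\<lambda>s. k c s * N c s y"]) (use * fin k0 N0 in auto)
      finally have "0 < R c y" .
      moreover have "0 < Q c y" using Qpos[OF *] pos by simp
      ultimately show ?thesis using pos by (simp add: log_divide algebra_simps)
    qed auto
  qed
  finally show ?thesis by (simp add: sum_subtractf R_def)
qed

section \<open>More capable channels\<close>

text \<open>The weights \<open>a\<close> of the mutual information \<open>ginfo\<close> need not be normalized; conditioning on an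
  output \<open>y\<close> then just replaces \<open>a u\<close> by \<open>a u * N u y\<close>.\<close>

definition ginfo :: "'u set \<Rightarrow> ('u \<Rightarrow> real) \<Rightarrow> ('u \<Rightarrow> 'y \<Rightarrow> real) \<Rightarrow> 'y set \<Rightarrow> real" where
  "ginfo U a N Y = (\<Sum>u\<in>U. \<Sum>y\<in>Y. a u * N u y *
     log 2 (N u y * (\<Sum>u'\<in>U. a u') / (\<Sum>u'\<in>U. a u' * N u' y)))"

text \<open>The output weight \<open>B y\<close> cancels between the two logarithms, and the
  normalization of \<open>M\<close> removes \<open>z\<close> from the first one.\<close>

lemma ginfo_chain:
  assumes fin: "finite U" "finite Y" "finite Z"
    and a0: "\<And>u. 0 \<le> a u" and N0: "\<And>u y. 0 \<le> N u y" and M0: "\<And>u y. 0 \<le> M u y"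
    and M1: "\<And>u. u \<in> U \<Longrightarrow> (\<Sum>z\<in>Z. M u z) = 1"
  shows "ginfo U a (\<lambda>u (y, z). N u y * M u z) (Y \<times> Z)
    = ginfo U a N Y + (\<Sum>y\<in>Y. ginfo U (\<lambda>u. a u * N u y) M Z)"
proof -
  define A where "A = (\<Sum>u'\<in>U. a u')"
  define B where "B y = (\<Sum>u'\<in>U. a u' * N u' y)" for y
  define D where "D y z = (\<Sum>u'\<in>U. a u' * N u' y * M u' z)" for y z
  have "ginfo U a (\<lambda>u (y, z). N u y * M u z) (Y \<times> Z)
     = (\<Sum>u\<in>U. \<Sum>y\<in>Y. \<Sum>z\<in>Z. a u * (N u y * M u z) * log 2 (N u y * M u z * A / D y z))"
    by (simp add: ginfo_def sum.cartesian_product case_prod_unfold A_def D_def mult.assoc)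
  also have "\<dots> = (\<Sum>u\<in>U. \<Sum>y\<in>Y. \<Sum>z\<in>Z. a u * N u y * log 2 (N u y * A / B y) * M u z
       + a u * N u y * M u z * log 2 (M u z * B y / D y z))"
  proof (intro sum.cong refl)
    fix u y z assume *: "u \<in> U" "y \<in> Y" "z \<in> Z"
    show "a u * (N u y * M u z) * log 2 (N u y * M u z * A / D y z)
       = a u * N u y * log 2 (N u y * A / B y) * M u z
       + a u * N u y * M u z * log 2 (M u z * B y / D y z)"
    proof (cases "a u * N u y * M u z = 0")
      case False
      then have pos: "0 < a u" "0 < N u y" "0 < M u z"
        using a0[of u] N0[of u y] M0[of u z] by (auto simp: less_le)
      have "a u \<le> A" unfolding A_def using * fin a0 by (intro member_le_sum) auto
      moreover have "a u * N u y \<le> B y" unfolding B_def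
        by (rule member_le_sum[of u U "\<lambda>u. a u * N u y"]) (use * fin a0 N0 in auto)
      moreover have "a u * N u y * M u z \<le> D y z" unfolding D_def
        by (rule member_le_sum[of u U "\<lambda>u. a u * N u y * M u z"]) (use * fin a0 N0 M0 in auto)
      ultimately have pos': "0 < A" "0 < B y" "0 < D y z"
        using pos by (auto intro: less_le_trans[OF mult_pos_pos] less_le_trans[OF mult_pos_pos[OF mult_pos_pos]])
      show ?thesis using pos pos' by (simp add: log_divide log_mult algebra_simps)
    qed auto
  qed
  also have "\<dots> = ginfo U a N Y + (\<Sum>u\<in>U. \<Sum>y\<in>Y. \<Sum>z\<in>Z. a u * N u y * M u z * log 2 (M u z * B y / D y z))"
    unfolding sum.distrib sum_distrib_left[symmetric] using M1
    by (simp add: ginfo_def A_def B_def)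
  also have "(\<Sum>u\<in>U. \<Sum>y\<in>Y. \<Sum>z\<in>Z. a u * N u y * M u z * log 2 (M u z * B y / D y z))
     = (\<Sum>y\<in>Y. ginfo U (\<lambda>u. a u * N u y) M Z)"
    by (subst sum.swap) (simp add: ginfo_def B_def D_def)
  finally show ?thesis .
qed

lemma ginfo_reindex:
  assumes "inj_on h Y"
  shows "ginfo U a N (h ` Y) = ginfo U a (\<lambda>u y. N u (h y)) Y"
  unfolding ginfo_def by (simp add: sum.reindex[OF assms])

lemma ginfo_swap:
  "ginfo U a (\<lambda>u (z, y). N u (y, z)) (Z \<times> Y) = ginfo U a N (Y \<times> Z)"
proof -
  have e: "Y \<times> Z = prod.swap ` (Z \<times> Y)" by auto
  show ?thesis unfolding e by (subst ginfo_reindex) (auto simp: case_prod_unfold prod.swap_def)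
qed

lemma ginfo_seqs_Suc:
  "ginfo U a (\<lambda>u ys. \<Prod>j<Suc n. N j u (ys ! j)) (seqs (Suc n) :: 'y::finite list set)
    = ginfo U a (\<lambda>u (ys, y). (\<Prod>j<n. N j u (ys ! j)) * N n u y) (seqs n \<times> UNIV)"
proof -
  have "(\<Sum>ys\<in>seqs (Suc n). f ys) = (\<Sum>(ys,y)\<in>seqs n \<times> UNIV. f (ys @ [y]))" for f :: "'y list \<Rightarrow> real"
    by (simp add: sum_seqs_Suc sum.cartesian_product)
  moreover have "(\<Prod>j<Suc n. N j u ((ys @ [y]) ! j)) = (\<Prod>j<n. N j u (ys ! j)) * N n u y"
    if "ys \<in> seqs n" for u ys y
    using that by (rule prod_append_nth)
  ultimately show ?thesis unfolding ginfo_def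
    by (auto intro!: sum.cong simp del: prod.lessThan_Suc)
qed

text \<open>The chain rule is used in both orders: first the last output is exchanged given the other
  ones, then the other ones given the last.\<close>

lemma ginfo_seqs_mono:
  fixes N1 :: "nat \<Rightarrow> 'u \<Rightarrow> 'y::finite \<Rightarrow> real" and N2 :: "nat \<Rightarrow> 'u \<Rightarrow> 'z::finite \<Rightarrow> real"
  assumes fin: "finite U" and a0: "\<And>u. 0 \<le> a u"
    and N10: "\<And>j u y. 0 \<le> N1 j u y" and N20: "\<And>j u y. 0 \<le> N2 j u y"
    and N11: "\<And>j u. u \<in> U \<Longrightarrow> (\<Sum>y\<in>UNIV. N1 j u y) = 1"
    and N21: "\<And>j u. u \<in> U \<Longrightarrow> (\<Sum>y\<in>UNIV. N2 j u y) = 1"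
    and le: "\<And>j a. (\<And>u. 0 \<le> a u) \<Longrightarrow> ginfo U a (N2 j) UNIV \<le> ginfo U a (N1 j) UNIV"
  shows "ginfo U a (\<lambda>u ys. \<Prod>j<n. N2 j u (ys ! j)) (seqs n)
    \<le> ginfo U a (\<lambda>u ys. \<Prod>j<n. N1 j u (ys ! j)) (seqs n)"
  using a0
\<comment> \<open>The weights are generalized because the induction hypothesis is applied to
  \<open>a u * N1 n u y\<close>, the weights after the last output has been observed.\<close>
proof (induction n arbitrary: a)
  case 0
  then show ?case by (simp add: ginfo_def seqs_def)
next
  case (Suc n)
  let ?P1 = "\<lambda>u ys. \<Prod>j<n. N1 j u (ys ! j)" and ?P2 = "\<lambda>u ys. \<Prod>j<n. N2 j u (ys ! j)"
  have P0: "0 \<le> ?P1 u ys" "0 \<le> ?P2 u zs" for u ys zs by (intro prod_nonneg; simp add: N10 N20)+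
  have P1: "(\<Sum>ys\<in>seqs n. ?P1 u ys) = 1" "(\<Sum>ys\<in>seqs n. ?P2 u ys) = 1" if "u \<in> U" for u
    using that N11 N21 by (simp_all add: sum_seqs_prod[of "\<lambda>j. N1 j u"] sum_seqs_prod[of "\<lambda>j. N2 j u"])
  have "ginfo U a (\<lambda>u ys. \<Prod>j<Suc n. N2 j u (ys ! j)) (seqs (Suc n))
      = ginfo U a (\<lambda>u (ys, y). ?P2 u ys * N2 n u y) (seqs n \<times> UNIV)"
    by (rule ginfo_seqs_Suc)
  also have "\<dots> = ginfo U a ?P2 (seqs n) + (\<Sum>ys\<in>seqs n. ginfo U (\<lambda>u. a u * ?P2 u ys) (N2 n) UNIV)"
    by (rule ginfo_chain) (use fin Suc.prems P0 N20 N21 in auto)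
  also have "\<dots> \<le> ginfo U a ?P2 (seqs n) + (\<Sum>ys\<in>seqs n. ginfo U (\<lambda>u. a u * ?P2 u ys) (N1 n) UNIV)"
    by (intro add_left_mono sum_mono le mult_nonneg_nonneg Suc.prems P0)
  also have "\<dots> = ginfo U a (\<lambda>u (ys, y). ?P2 u ys * N1 n u y) (seqs n \<times> UNIV)"
    by (rule ginfo_chain[symmetric]) (use fin Suc.prems P0 N10 N11 in auto)
  also have "\<dots> = ginfo U a (\<lambda>u (y, ys). N1 n u y * ?P2 u ys) (UNIV \<times> seqs n)"
    by (subst ginfo_swap[symmetric]) (simp add: mult.commute case_prod_unfold)
  also have "\<dots> = ginfo U a (N1 n) UNIV + (\<Sum>y\<in>UNIV. ginfo U (\<lambda>u. a u * N1 n u y) ?P2 (seqs n))"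
    by (rule ginfo_chain) (use fin Suc.prems P0 N10 P1 in auto)
  also have "\<dots> \<le> ginfo U a (N1 n) UNIV + (\<Sum>y\<in>UNIV. ginfo U (\<lambda>u. a u * N1 n u y) ?P1 (seqs n))"
    by (intro add_left_mono sum_mono Suc.IH mult_nonneg_nonneg Suc.prems N10)
  also have "\<dots> = ginfo U a (\<lambda>u (y, ys). N1 n u y * ?P1 u ys) (UNIV \<times> seqs n)"
    by (rule ginfo_chain[symmetric]) (use fin Suc.prems P0 N10 P1 in auto)
  also have "\<dots> = ginfo U a (\<lambda>u (ys, y). ?P1 u ys * N1 n u y) (seqs n \<times> UNIV)"
    by (subst ginfo_swap[symmetric]) (simp add: mult.commute case_prod_unfold)
  also have "\<dots> = ginfo U a (\<lambda>u ys. \<Prod>j<Suc n. N1 j u (ys ! j)) (seqs (Suc n))"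
    by (rule ginfo_seqs_Suc[symmetric])
  finally show ?case .
qed

section \<open>The rate region\<close>

text \<open>\<open>mi1 V\<close> and \<open>mi1 (flip V)\<close> are the paper's \<open>I(X\<^sub>1;Y|X\<^sub>2)\<close> and \<open>I(X\<^sub>2;Y|X\<^sub>1)\<close>, and \<open>mi12 V\<close> is
  \<open>I(X\<^sub>1,X\<^sub>2;Y)\<close>, for independent inputs of the channel \<open>V\<close>.\<close>

definition mi1 :: "('a::finite \<Rightarrow> 'b::finite \<Rightarrow> 'y::finite \<Rightarrow> real) \<Rightarrow> ('a \<Rightarrow> real) \<Rightarrow> ('b \<Rightarrow> real) \<Rightarrow> real" where
  "mi1 V p1 p2 = (\<Sum>a\<in>UNIV. \<Sum>b\<in>UNIV. \<Sum>y\<in>UNIV. p1 a * p2 b * V a b y *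
     log 2 (V a b y / (\<Sum>a'\<in>UNIV. p1 a' * V a' b y)))"

definition mi12 :: "('a::finite \<Rightarrow> 'b::finite \<Rightarrow> 'y::finite \<Rightarrow> real) \<Rightarrow> ('a \<Rightarrow> real) \<Rightarrow> ('b \<Rightarrow> real) \<Rightarrow> real" where
  "mi12 V p1 p2 = (\<Sum>a\<in>UNIV. \<Sum>b\<in>UNIV. \<Sum>y\<in>UNIV. p1 a * p2 b * V a b y *
     log 2 (V a b y / (\<Sum>a'\<in>UNIV. \<Sum>b'\<in>UNIV. p1 a' * p2 b' * V a' b' y)))"

definition flip :: "('a \<Rightarrow> 'b \<Rightarrow> 'y) \<Rightarrow> 'b \<Rightarrow> 'a \<Rightarrow> 'y" where
  "flip V b a = V a b"

definition is_kernel :: "('a \<Rightarrow> 'b \<Rightarrow> 'y::finite \<Rightarrow> real) \<Rightarrow> bool" where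
  "is_kernel V \<longleftrightarrow> (\<forall>a b y. 0 \<le> V a b y) \<and> (\<forall>a b. (\<Sum>y\<in>UNIV. V a b y) = 1)"

lemma is_kernel_flip: "is_kernel (flip V) \<longleftrightarrow> is_kernel V"
  unfolding is_kernel_def flip_def by blast

lemma mi12_flip: "mi12 (flip V) p2 p1 = mi12 V p1 p2"
proof -
  have "(\<Sum>b'\<in>UNIV. \<Sum>a'\<in>UNIV. p2 b' * p1 a' * V a' b' y)
      = (\<Sum>a'\<in>UNIV. \<Sum>b'\<in>UNIV. p1 a' * p2 b' * V a' b' y)" for y
    by (subst sum.swap) (simp add: mult.commute)
  then have "mi12 (flip V) p2 p1 = (\<Sum>b\<in>UNIV. \<Sum>a\<in>UNIV. \<Sum>y\<in>UNIV. p1 a * p2 b * V a b y *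
     log 2 (V a b y / (\<Sum>a'\<in>UNIV. \<Sum>b'\<in>UNIV. p1 a' * p2 b' * V a' b' y)))"
    by (simp add: mi12_def flip_def mult.commute)
  also have "\<dots> = mi12 V p1 p2" unfolding mi12_def by (rule sum.swap)
  finally show ?thesis .
qed

section \<open>Continuity of the informations and compactness of the input laws\<close>

text \<open>Only the point \<open>0\<close> is critical. There \<open>ln z \<le> z - 1\<close> at
  \<open>z = 1 / sqrt x\<close> gives a bound of order \<open>sqrt x\<close>.\<close>

lemma continuous_on_xlogx: "continuous_on {0..} (\<lambda>x::real. x * log 2 x)"
  unfolding continuous_on_eq_continuous_within
proof
  fix x :: real assume "x \<in> {0..}"
  show "continuous (at x within {0..}) (\<lambda>x. x * log 2 x)"
  proof (cases "x = 0")
    case True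
    have lim: "((\<lambda>x::real. x * log 2 x) \<longlongrightarrow> 0) (at_right 0)"
    proof (rule Lim_null_comparison)
      have "norm (x * log 2 x) \<le> 2 * sqrt x / ln 2" if "x \<in> {0<..<1}" for x :: real
      proof -
        have "ln (1 / sqrt x) \<le> 1 / sqrt x - 1" using that by (intro ln_le_minus_one) simp
        then have "- ln x \<le> 2 / sqrt x" using that by (simp add: ln_div ln_sqrt)
        then have "x * (- ln x) \<le> x * (2 / sqrt x)" using that by (intro mult_left_mono) auto
        also have "\<dots> = 2 * sqrt x" using that real_div_sqrt[of x] by (simp add: field_simps)
        finally show ?thesis using that divide_right_mono[of "- (x * ln x)" "2 * sqrt x" "ln 2"]
          by (simp add: log_def abs_mult)
      qed
      then show "\<forall>\<^sub>F x in at_right 0. norm (x * log 2 x) \<le> 2 * sqrt x / ln 2"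
        by (intro eventually_at_rightI[of 0 1]) auto
      have "((\<lambda>x::real. 2 * sqrt x / ln 2) \<longlongrightarrow> 2 * sqrt 0 / ln 2) (at_right 0)"
        by (intro tendsto_intros) auto
      then show "((\<lambda>x::real. 2 * sqrt x / ln 2) \<longlongrightarrow> 0) (at_right 0)" by simp
    qed
    from lim show ?thesis using True by (simp add: continuous_within at_within_Ici_at_right)
  next
    case False
    then have "isCont (\<lambda>x. x * log 2 x) x"
      using \<open>x \<in> {0..}\<close> by (auto intro!: continuous_intros)
    then show ?thesis by (rule continuous_at_imp_continuous_at_within)
  qed
qed

text \<open>The logarithm of a quotient is not visibly continuous where the output law vanishes. As
  a difference of entropies an information contains the input laws only through polynomials and
  through \<open>x * log 2 x\<close>.\<close>

lemma split_density:
  fixes r :: "'b::finite \<Rightarrow> 'y::finite \<Rightarrow> real" and p1 :: "'a::finite \<Rightarrow> real"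
  assumes V: "is_kernel V" and p0: "\<And>a. 0 \<le> p1 a" "\<And>b. 0 \<le> p2 b"
    and r: "\<And>a b y. 0 < p1 a * p2 b * V a b y \<Longrightarrow> 0 < r b y"
  shows "(\<Sum>a\<in>UNIV. \<Sum>b\<in>UNIV. \<Sum>y\<in>UNIV. p1 a * p2 b * V a b y * log 2 (V a b y / r b y))
    = (\<Sum>a\<in>UNIV. \<Sum>b\<in>UNIV. \<Sum>y\<in>UNIV. p1 a * p2 b * V a b y * log 2 (V a b y))
     - (\<Sum>b\<in>UNIV. \<Sum>y\<in>UNIV. (\<Sum>a\<in>UNIV. p1 a * p2 b * V a b y) * log 2 (r b y))"
proof -
  have V0: "0 \<le> V a b y" for a b y using V by (simp add: is_kernel_def)
  have e: "p1 a * p2 b * V a b y * log 2 (V a b y / r b y)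
      = p1 a * p2 b * V a b y * log 2 (V a b y) - p1 a * p2 b * V a b y * log 2 (r b y)" for a b y
  proof (cases "p1 a * p2 b * V a b y = 0")
    case False
    then have "0 < p1 a * p2 b * V a b y" using p0(1)[of a] p0(2)[of b] V0[of a b y] by (simp add: less_le)
    then show ?thesis using r[of a b y] V0[of a b y] False by (simp add: log_divide right_diff_distrib)
  qed (simp only: mult_zero_left diff_zero)
  have "(\<Sum>a\<in>UNIV. \<Sum>b\<in>UNIV. \<Sum>y\<in>UNIV. p1 a * p2 b * V a b y * log 2 (r b y))
     = (\<Sum>b\<in>UNIV. \<Sum>y\<in>UNIV. \<Sum>a\<in>UNIV. p1 a * p2 b * V a b y * log 2 (r b y))"
    by (subst sum.swap, intro sum.cong refl, rule sum.swap)
  then show ?thesis unfolding e sum_subtractf by (simp add: sum_distrib_right)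
qed

lemma mi1_entropy:
  assumes "is_kernel V" and p0: "\<And>a. 0 \<le> p1 a" "\<And>b. 0 \<le> p2 b"
  shows "mi1 V p1 p2 = (\<Sum>a\<in>UNIV. \<Sum>b\<in>UNIV. \<Sum>y\<in>UNIV. p1 a * p2 b * V a b y * log 2 (V a b y))
     - (\<Sum>b\<in>UNIV. \<Sum>y\<in>UNIV. p2 b * ((\<Sum>a\<in>UNIV. p1 a * V a b y) * log 2 (\<Sum>a\<in>UNIV. p1 a * V a b y)))"
proof -
  have V0: "0 \<le> V a b y" for a b y using assms(1) by (simp add: is_kernel_def)
  have "0 < (\<Sum>a\<in>UNIV. p1 a * V a b y)" if "0 < p1 a * p2 b * V a b y" for a b y
  proof -
    have "0 < p1 a * V a b y" using that p0(1)[of a] p0(2)[of b] V0[of a b y]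
      by (auto simp: zero_less_mult_iff)
    also have "\<dots> \<le> (\<Sum>a\<in>UNIV. p1 a * V a b y)"
      by (rule member_le_sum[of a UNIV "\<lambda>a. p1 a * V a b y"]) (use p0 V0 in auto)
    finally show ?thesis .
  qed
  note pos = this
  have "mi1 V p1 p2 = (\<Sum>a\<in>UNIV. \<Sum>b\<in>UNIV. \<Sum>y\<in>UNIV. p1 a * p2 b * V a b y * log 2 (V a b y))
     - (\<Sum>b\<in>UNIV. \<Sum>y\<in>UNIV. (\<Sum>a\<in>UNIV. p1 a * p2 b * V a b y) * log 2 (\<Sum>a\<in>UNIV. p1 a * V a b y))"
    unfolding mi1_def by (rule split_density[OF assms]) (erule pos)
  then show ?thesis by (simp add: sum_distrib_left sum_distrib_right mult_ac)
qed

lemma mi12_entropy: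
  assumes "is_kernel V" and p0: "\<And>a. 0 \<le> p1 a" "\<And>b. 0 \<le> p2 b"
  shows "mi12 V p1 p2 = (\<Sum>a\<in>UNIV. \<Sum>b\<in>UNIV. \<Sum>y\<in>UNIV. p1 a * p2 b * V a b y * log 2 (V a b y))
     - (\<Sum>y\<in>UNIV. (\<Sum>a\<in>UNIV. \<Sum>b\<in>UNIV. p1 a * p2 b * V a b y)
        * log 2 (\<Sum>a\<in>UNIV. \<Sum>b\<in>UNIV. p1 a * p2 b * V a b y))"
proof -
  have V0: "0 \<le> V a b y" for a b y using assms(1) by (simp add: is_kernel_def)
  have t0: "0 \<le> p1 a * p2 b * V a b y" for a b y using p0 V0 by simp
  define r where "r y = (\<Sum>a\<in>UNIV. \<Sum>b\<in>UNIV. p1 a * p2 b * V a b y)" for y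
  have "0 < r y" if "0 < p1 a * p2 b * V a b y" for a b y
  proof -
    note that
    also have "p1 a * p2 b * V a b y \<le> (\<Sum>b\<in>UNIV. p1 a * p2 b * V a b y)"
      by (rule member_le_sum[of b UNIV "\<lambda>b. p1 a * p2 b * V a b y"]) (use t0 in auto)
    also have "\<dots> \<le> r y" unfolding r_def
      by (rule member_le_sum[of a UNIV "\<lambda>a. \<Sum>b\<in>UNIV. p1 a * p2 b * V a b y"])
         (use t0 in \<open>auto intro: sum_nonneg\<close>)
    finally show ?thesis .
  qed
  then have "mi12 V p1 p2 = (\<Sum>a\<in>UNIV. \<Sum>b\<in>UNIV. \<Sum>y\<in>UNIV. p1 a * p2 b * V a b y * log 2 (V a b y))
     - (\<Sum>b\<in>UNIV. \<Sum>y\<in>UNIV. (\<Sum>a\<in>UNIV. p1 a * p2 b * V a b y) * log 2 (r y))"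
    unfolding mi12_def r_def[symmetric] by (intro split_density[where r = "\<lambda>b. r"] assms)
  also have "(\<Sum>b\<in>UNIV. \<Sum>y\<in>UNIV. (\<Sum>a\<in>UNIV. p1 a * p2 b * V a b y) * log 2 (r y)) = (\<Sum>y\<in>UNIV. r y * log 2 (r y))"
    by (subst sum.swap, unfold sum_distrib_right[symmetric], subst sum.swap) (simp only: r_def)
  finally show ?thesis by (simp only: r_def)
qed

text \<open>Input laws as vectors of a Euclidean space, where compactness and convex hulls are at
  hand.\<close>

definition pmfs :: "(real ^ 'a) set" where
  "pmfs = {u. is_pmf (\<lambda>i. u $ i)}"

lemma compact_pmfs: "compact (pmfs :: (real ^ 'a) set)"
proof (rule compact_eq_bounded_closed[THEN iffD2], rule conjI)
  have *: "u \<in> pmfs \<Longrightarrow> norm u \<le> 1" for u :: "real ^ 'a"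
    using norm_le_l1_cart[of u] by (simp add: pmfs_def is_pmf_def)
  show "bounded (pmfs :: (real ^ 'a) set)" by (rule boundedI[of _ 1]) (rule *)
  have "pmfs = (\<Inter>i. {u :: real ^ 'a. 0 \<le> u $ i}) \<inter> {u. (\<Sum>i\<in>UNIV. u $ i) = 1}"
    by (auto simp: pmfs_def is_pmf_def)
  moreover have "closed (\<Inter>i. {u :: real ^ 'a. 0 \<le> u $ i})"
    by (intro closed_INT ballI closed_Collect_le continuous_intros)
  moreover have "closed {u :: real ^ 'a. (\<Sum>i\<in>UNIV. u $ i) = 1}"
    by (intro closed_Collect_eq continuous_intros)
  ultimately show "closed (pmfs :: (real ^ 'a) set)" by (metis closed_Int)
qed

lemma pmfs_nonneg: "u \<in> pmfs \<Longrightarrow> 0 \<le> u $ i"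
  by (simp add: pmfs_def is_pmf_def)

lemma continuous_on_mi1:
  assumes "is_kernel V"
  shows "continuous_on (pmfs \<times> pmfs) (\<lambda>z. mi1 V (\<lambda>i. fst z $ i) (\<lambda>i. snd z $ i))"
proof -
  have V0: "0 \<le> V a b y" for a b y using assms by (simp add: is_kernel_def)
  have [continuous_intros]: "continuous_on (pmfs \<times> pmfs)
      (\<lambda>z. (\<Sum>a\<in>UNIV. fst z $ a * V a b y) * log 2 (\<Sum>a\<in>UNIV. fst z $ a * V a b y))" for b y
    by (rule continuous_on_compose2[OF continuous_on_xlogx])
       (auto intro!: continuous_intros sum_nonneg mult_nonneg_nonneg pmfs_nonneg V0)
  show ?thesis
    by (subst continuous_on_cong[OF refl mi1_entropy[OF assms]])
       (auto intro!: continuous_intros simp: pmfs_nonneg)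
qed

lemma continuous_on_mi12:
  assumes "is_kernel V"
  shows "continuous_on (pmfs \<times> pmfs) (\<lambda>z. mi12 V (\<lambda>i. fst z $ i) (\<lambda>i. snd z $ i))"
proof -
  have V0: "0 \<le> V a b y" for a b y using assms by (simp add: is_kernel_def)
  have [continuous_intros]: "continuous_on (pmfs \<times> pmfs)
      (\<lambda>z. (\<Sum>a\<in>UNIV. \<Sum>b\<in>UNIV. fst z $ a * snd z $ b * V a b y)
         * log 2 (\<Sum>a\<in>UNIV. \<Sum>b\<in>UNIV. fst z $ a * snd z $ b * V a b y))" for y
    by (rule continuous_on_compose2[OF continuous_on_xlogx])
       (auto intro!: continuous_intros sum_nonneg mult_nonneg_nonneg pmfs_nonneg V0)
  show ?thesis
    by (subst continuous_on_cong[OF refl mi12_entropy[OF assms]])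
       (auto intro!: continuous_intros simp: pmfs_nonneg)
qed

lemma continuous_on_swap_pmfs:
  assumes "continuous_on (pmfs \<times> pmfs) (\<lambda>z. f (fst z) (snd z))"
  shows "continuous_on (pmfs \<times> pmfs) (\<lambda>z. f (snd z) (fst z))"
proof -
  have "continuous_on (pmfs \<times> pmfs) ((\<lambda>z. f (fst z) (snd z)) \<circ> prod.swap)"
    by (rule continuous_on_compose) (auto intro!: continuous_intros simp: prod.swap_def intro: continuous_on_subset[OF assms])
  then show ?thesis by (simp add: o_def)
qed

section \<open>Four points of a convex hull\<close>

text \<open>Pushing \<open>v\<close> in direction \<open>e\<close> to the boundary of the hull puts it on a proper face, which saves
  one of Caratheodory's \<open>DIM('a) + 1\<close> points.\<close>

lemma boundary_caratheodory:
  fixes A :: "'a::euclidean_space set"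
  assumes "compact A" "v \<in> convex hull A" "e \<noteq> 0"
  shows "\<exists>S t. finite S \<and> S \<subseteq> A \<and> card S \<le> DIM('a) \<and> 0 \<le> t \<and> v + t *\<^sub>R e \<in> convex hull S"
proof -
  define K where "K = convex hull A"
  have cK: "compact K" "convex K" "v \<in> K" using assms by (auto simp: K_def compact_convex_hull)
  define T where "T = {t. 0 \<le> t \<and> v + t *\<^sub>R e \<in> K}"
  have "T = {0..} \<inter> (\<lambda>t. v + t *\<^sub>R e) -` K" by (auto simp: T_def)
  moreover have "closed ((\<lambda>t. v + t *\<^sub>R e) -` K)"
    using cK(1) by (intro closed_vimage compact_imp_closed continuous_intros)
  ultimately have "closed T" by (simp add: closed_Int)
  obtain B where B: "\<And>x. x \<in> K \<Longrightarrow> norm x \<le> B" using cK(1) compact_imp_bounded bounded_iff by metis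
  have "bounded T"
  proof (rule boundedI)
    fix t assume "t \<in> T"
    then have "t \<ge> 0" "norm (v + t *\<^sub>R e) \<le> B" using B by (auto simp: T_def)
    moreover have "norm (t *\<^sub>R e) \<le> norm (v + t *\<^sub>R e) + norm v"
      using norm_triangle_ineq4[of "v + t *\<^sub>R e" v] by simp
    ultimately have "t * norm e \<le> B + norm v" by simp
    then show "norm t \<le> (B + norm v) / norm e" using assms(3) \<open>t \<ge> 0\<close> by (simp add: field_simps)
  qed
  with \<open>closed T\<close> have "compact T" by (simp add: compact_eq_bounded_closed)
  moreover have "0 \<in> T" using cK by (simp add: T_def)
  ultimately obtain t where t: "t \<in> T" "\<And>s. s \<in> T \<Longrightarrow> s \<le> t" using compact_attains_sup[of T] by auto
  define u where "u = v + t *\<^sub>R e"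
  have uK: "u \<in> K" "0 \<le> t" using t by (auto simp: u_def T_def)
  \<comment> \<open>The open ray beyond \<open>u\<close>. It misses \<open>K\<close> because
    \<open>t\<close> is maximal, so a hyperplane separates the two; \<open>u\<close> is a limit of
    points of \<open>L\<close>, hence the hyperplane supports \<open>K\<close> at
    \<open>u\<close>.\<close>
  define L where "L = (\<lambda>s. u + s *\<^sub>R e) ` {0<..}"
  have "K \<inter> L = {}"
  proof (rule ccontr)
    assume "K \<inter> L \<noteq> {}"
    then obtain s where s: "s > 0" "u + s *\<^sub>R e \<in> K" by (auto simp: L_def)
    then have "t + s \<in> T" using uK by (simp add: T_def u_def scaleR_add_left add.assoc)
    then show False using t(2)[of "t + s"] s by simp
  qed
  moreover have "convex L"
  proof -
    have "L = (+) u ` ((\<lambda>s. s *\<^sub>R e) ` {0<..})" by (auto simp: L_def image_image)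
    moreover have "convex ((\<lambda>s. s *\<^sub>R e) ` {0<..})"
      by (intro convex_linear_image linearI) (auto simp: scaleR_add_left)
    ultimately show ?thesis by (simp add: convex_translation)
  qed
  moreover have "L \<noteq> {}" by (auto simp: L_def)
  ultimately obtain a c where ac: "a \<noteq> 0" "\<forall>x\<in>K. a \<bullet> x \<le> c" "\<forall>x\<in>L. c \<le> a \<bullet> x"
    using separating_hyperplane_sets[of K L] cK by blast
  have "c \<le> a \<bullet> u"
  proof (rule field_le_epsilon)
    fix \<epsilon> :: real assume "0 < \<epsilon>"
    define s where "s = \<epsilon> / (\<bar>a \<bullet> e\<bar> + 1)"
    have "0 < s" using \<open>0 < \<epsilon>\<close> by (simp add: s_def divide_pos_pos)
    then have "c \<le> a \<bullet> u + s * (a \<bullet> e)" using ac(3) by (auto simp: L_def inner_add_right)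
    also have "s * (a \<bullet> e) \<le> s * (\<bar>a \<bullet> e\<bar> + 1)" using \<open>0 < s\<close> by (intro mult_left_mono) auto
    also have "\<dots> = \<epsilon>" by (simp add: s_def)
    finally show "c \<le> a \<bullet> u + \<epsilon>" by simp
  qed
  then have "a \<bullet> u = c" using ac(2) uK by force
  have "(K \<inter> {x. a \<bullet> x = c}) face_of K"
    using cK ac by (intro face_of_Int_supporting_hyperplane_le) auto
  then obtain S' where S': "S' \<subseteq> A" "K \<inter> {x. a \<bullet> x = c} = convex hull S'"
    using face_of_convex_hull_subset[OF assms(1)] unfolding K_def by metis
  have "S' \<subseteq> {x. a \<bullet> x = c}" using S'(2) hull_subset[of S' convex] by blast
  then have "aff_dim S' \<le> aff_dim {x. a \<bullet> x = c}" by (rule aff_dim_subset)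
  \<comment> \<open>The point saved: inside a hyperplane the affine dimension is at most
    \<open>DIM('a) - 1\<close>, and Caratheodory's theorem uses one point more than that.\<close>
  then have dim: "aff_dim S' + 1 \<le> DIM('a)" using ac(1) by (simp add: aff_dim_hyperplane)
  have "u \<in> convex hull S'" using S'(2) uK \<open>a \<bullet> u = c\<close> by blast
  then have "u \<in> {x. \<exists>S. finite S \<and> S \<subseteq> S' \<and> card S \<le> aff_dim S' + 1 \<and> x \<in> convex hull S}"
    by (simp only: caratheodory_aff_dim[of S', symmetric])
  then obtain S where "finite S" "S \<subseteq> S'" "card S \<le> aff_dim S' + 1" "u \<in> convex hull S"
    by blast
  then show ?thesis using S'(1) dim uK(2) unfolding u_def by (intro exI[of _ S] exI[of _ t]) auto
qed

text \<open>The smallest slack \<open>g\<close> of the four inequalities is continuous and attains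
  its maximum on the compact hull; the approximations force this maximum to be nonnegative. Moving
  the maximizer in direction \<open>(1,1,1,1)\<close> lowers no slack because
  \<open>0 \<le> b\<close>, so it can be taken to the boundary.\<close>

lemma four_point_region:
  fixes F :: "'p \<Rightarrow> real \<times> real \<times> real \<times> real"
  assumes cpt: "compact (F ` D)"
    and approx: "\<And>\<tau>. 0 < \<tau> \<Longrightarrow> \<exists>v\<in>convex hull (F ` D). h1 \<le> b * fst v + \<tau> \<and> h2 \<le> b * fst (snd v) + \<tau>
      \<and> h3 \<le> b * fst (snd (snd v)) + \<tau> \<and> h3 \<le> b * snd (snd (snd v)) + \<tau>"
    and "0 \<le> b"
  shows "\<exists>pq d. (\<forall>q. 0 \<le> pq q) \<and> (\<Sum>q<4. pq q) = 1 \<and> (\<forall>q::nat. d q \<in> D)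
     \<and> h1 \<le> b * (\<Sum>q<4. pq q * fst (F (d q))) \<and> h2 \<le> b * (\<Sum>q<4. pq q * fst (snd (F (d q))))
     \<and> h3 \<le> b * (\<Sum>q<4. pq q * fst (snd (snd (F (d q)))))
     \<and> h3 \<le> b * (\<Sum>q<4. pq q * snd (snd (snd (F (d q)))))"
proof -
  define K where "K = convex hull (F ` D)"
  define g where "g v = min (min (b * fst v - h1) (b * fst (snd v) - h2))
     (min (b * fst (snd (snd v)) - h3) (b * snd (snd (snd v)) - h3))" for v
  have "compact K" using cpt by (simp add: K_def compact_convex_hull)
  moreover have "K \<noteq> {}" using approx[of 1] by (auto simp: K_def)
  moreover have "continuous_on K g" unfolding g_def by (intro continuous_intros)
  ultimately obtain v where v: "v \<in> K" "\<And>x. x \<in> K \<Longrightarrow> g x \<le> g v"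
    using continuous_attains_sup[of K g] by blast
  have "0 \<le> g v"
  proof (rule field_le_epsilon)
    fix \<tau> :: real assume "0 < \<tau>"
    from approx[OF this] obtain x where "x \<in> K" "- \<tau> \<le> g x" by (auto simp: K_def g_def)
    then show "0 \<le> g v + \<tau>" using v(2)[of x] by simp
  qed
  obtain S t where S: "finite S" "S \<subseteq> F ` D" "card S \<le> DIM(real \<times> real \<times> real \<times> real)" "0 \<le> t"
      "v + t *\<^sub>R (1,1,1,1) \<in> convex hull S"
    using boundary_caratheodory[OF cpt, of v "(1,1,1,1)"] v(1) by (auto simp: K_def zero_prod_def)
  define w where "w = v + t *\<^sub>R (1,1,1,1)"
  have "b * 0 \<le> b * t" using S(4) \<open>0 \<le> b\<close> by (intro mult_left_mono) auto
  then have w: "h1 \<le> b * fst w" "h2 \<le> b * fst (snd w)" "h3 \<le> b * fst (snd (snd w))" "h3 \<le> b * snd (snd (snd w))"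
    using \<open>0 \<le> g v\<close> by (auto simp: w_def g_def algebra_simps)
  obtain u where u: "\<forall>x\<in>S. 0 \<le> u x" "sum u S = 1" "(\<Sum>x\<in>S. u x *\<^sub>R x) = w"
    using S(5) unfolding convex_hull_finite[OF S(1)] w_def by auto
  obtain f where f: "bij_betw f {0..<card S} S" using ex_bij_betw_nat_finite[OF S(1)] by blast
  have c4: "card S \<le> 4" using S(3) by simp
  have "\<forall>x\<in>S. \<exists>z. z \<in> D \<and> F z = x" using S(2) by blast
  then obtain z where z: "\<And>x. x \<in> S \<Longrightarrow> z x \<in> D \<and> F (z x) = x" by metis
  have "S \<noteq> {}" using u(2) by auto
  then obtain x0 where x0: "x0 \<in> S" by blast
  \<comment> \<open>If fewer than four points occur, the spare indices get weight zero and a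
    preimage of \<open>x0\<close>, so that \<open>d q\<close> lies in \<open>D\<close> for every
    \<open>q\<close>.\<close>
  define pq where "pq q = (if q < card S then u (f q) else 0)" for q
  define d where "d q = (if q < card S then z (f q) else z x0)" for q
  have fS: "q < card S \<Longrightarrow> f q \<in> S" for q using f by (auto simp: bij_betw_def)
  have S_sum: "(\<Sum>q<4. pq q * G (F (d q))) = (\<Sum>x\<in>S. u x * G x)" for G :: "_ \<Rightarrow> real"
  proof -
    have "(\<Sum>q<4. pq q * G (F (d q))) = (\<Sum>q\<in>{0..<card S}. pq q * G (F (d q)))"
      using c4 by (intro sum.mono_neutral_right) (auto simp: pq_def)
    also have "\<dots> = (\<Sum>q\<in>{0..<card S}. u (f q) * G (f q))"
      by (intro sum.cong refl) (use z fS in \<open>auto simp: pq_def d_def\<close>)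
    also have "\<dots> = (\<Sum>x\<in>S. u x * G x)" by (rule sum.reindex_bij_betw[OF f])
    finally show ?thesis .
  qed
  have "(\<Sum>q<4. pq q) = 1" using S_sum[of "\<lambda>_. 1"] u(2) by simp
  moreover have "0 \<le> pq q" "d q \<in> D" for q using u(1) z fS x0 by (auto simp: pq_def d_def)
  moreover have "fst w = (\<Sum>x\<in>S. u x * fst x)" "fst (snd w) = (\<Sum>x\<in>S. u x * fst (snd x))"
     "fst (snd (snd w)) = (\<Sum>x\<in>S. u x * fst (snd (snd x)))"
     "snd (snd (snd w)) = (\<Sum>x\<in>S. u x * snd (snd (snd x)))"
    unfolding u(3)[symmetric] by (simp_all add: fst_sum snd_sum)
  ultimately show ?thesis using w
    by (intro exI[of _ pq] exI[of _ d])
       (simp add: S_sum[of fst] S_sum[of "\<lambda>x. fst (snd x)"] S_sum[of "\<lambda>x. fst (snd (snd x))"]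
          S_sum[of "\<lambda>x. snd (snd (snd x))"])
qed

section \<open>The entropies and informations as explicit sums\<close>

lemma sum_UNIV_prod: "(\<Sum>v\<in>UNIV. f v) = (\<Sum>a\<in>UNIV. \<Sum>b\<in>UNIV. f (a, b))"
  by (simp add: sum.cartesian_product)

lemma sum_if_const: "(\<Sum>x\<in>A. if c then f x else 0) = (if c then sum f A else 0)"
  by simp

lemma mprob_if: "finite \<Omega> \<Longrightarrow> mprob \<Omega> J A a = (\<Sum>v\<in>\<Omega>. if A v = a then J v else 0)"
  unfolding mprob_def by (rule sum.inter_filter)

text \<open>\<open>\<pi>\<close> selects the output that is kept, so that the computations for both
  receivers are done once.\<close>

definition marg :: "('y1 \<Rightarrow> 'y2 \<Rightarrow> 'y) \<Rightarrow> ('x1 \<Rightarrow> 'x2 \<Rightarrow> 'y1::finite \<Rightarrow> 'y2::finite \<Rightarrow> real) \<Rightarrow> 'x1 \<Rightarrow> 'x2 \<Rightarrow> 'y \<Rightarrow> real" where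
  "marg \<pi> Ch x1 x2 y = (\<Sum>y1\<in>UNIV. \<Sum>y2\<in>UNIV. if \<pi> y1 y2 = y then Ch x1 x2 y1 y2 else 0)"

lemma sum_marg:
  fixes h :: "'y::finite \<Rightarrow> real"
  shows "(\<Sum>y1\<in>UNIV. \<Sum>y2\<in>UNIV. Ch x1 x2 y1 y2 * h (\<pi> y1 y2)) = (\<Sum>y\<in>UNIV. marg \<pi> Ch x1 x2 y * h y)"
proof -
  have "(\<Sum>y\<in>UNIV. marg \<pi> Ch x1 x2 y * h y)
      = (\<Sum>y\<in>UNIV. \<Sum>y1\<in>UNIV. \<Sum>y2\<in>UNIV. if y = \<pi> y1 y2 then Ch x1 x2 y1 y2 * h y else 0)"
    unfolding marg_def sum_distrib_right by (intro sum.cong refl) auto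
  also have "\<dots> = (\<Sum>y1\<in>UNIV. \<Sum>y\<in>UNIV. \<Sum>y2\<in>UNIV. if y = \<pi> y1 y2 then Ch x1 x2 y1 y2 * h y else 0)"
    by (rule sum.swap)
  also have "\<dots> = (\<Sum>y1\<in>UNIV. \<Sum>y2\<in>UNIV. \<Sum>y\<in>UNIV. if y = \<pi> y1 y2 then Ch x1 x2 y1 y2 * h y else 0)"
    by (intro sum.cong refl sum.swap)
  finally show ?thesis by simp
qed

lemma is_kernel_marg:
  fixes \<pi> :: "'y1::finite \<Rightarrow> 'y2::finite \<Rightarrow> 'y::finite"
  assumes "valid_channel Ch"
  shows "is_kernel (marg \<pi> Ch)"
  unfolding is_kernel_def
proof (intro conjI allI)
  show "0 \<le> marg \<pi> Ch a b y" for a b y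
    using assms unfolding marg_def valid_channel_def by (intro sum_nonneg) auto
  show "(\<Sum>y\<in>UNIV. marg \<pi> Ch a b y) = 1" for a b
    using sum_marg[of Ch a b "\<lambda>_. 1" \<pi>] assms by (simp add: valid_channel_def)
qed

text \<open>The marginals inside \<open>cond_mi\<close> have two shapes: a condition on the inputs
  together with one on the output, or a condition on the inputs alone.\<close>

lemma sum_prod_joint:
  "(\<Sum>v\<in>UNIV. if (\<lambda>(x1,x2,y1,y2). R x1 x2 \<and> \<pi> y1 y2 = y) v then prod_joint p1 p2 Ch v else 0)
    = (\<Sum>x1\<in>UNIV. \<Sum>x2\<in>UNIV. if R x1 x2 then p1 x1 * p2 x2 * marg \<pi> Ch x1 x2 y else 0)" (is ?A)
  "valid_channel Ch \<Longrightarrow> (\<Sum>v\<in>UNIV. if (\<lambda>(x1,x2,y1,y2). R x1 x2) v then prod_joint p1 p2 Ch v else 0)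
    = (\<Sum>x1\<in>UNIV. \<Sum>x2\<in>UNIV. if R x1 x2 then p1 x1 * p2 x2 else 0)" (is "_ \<Longrightarrow> ?B")
proof -
  show ?A unfolding sum_UNIV_prod prod_joint_def
    by (intro sum.cong refl) (auto simp: marg_def sum_distrib_left if_distrib cong: if_cong intro!: sum.cong)
  assume vc: "valid_channel Ch"
  show ?B unfolding sum_UNIV_prod prod_joint_def
    by (intro sum.cong refl) (use vc in \<open>auto simp: valid_channel_def simp flip: sum_distrib_left\<close>)
qed

lemma sum_Q_joint:
  "(\<Sum>v\<in>Q_omega. if (\<lambda>(q,x1,x2,y1,y2). R q x1 x2 \<and> \<pi> y1 y2 = y) v then Q_joint pq p1 p2 Ch v else 0)
    = (\<Sum>q<4. \<Sum>x1\<in>UNIV. \<Sum>x2\<in>UNIV. if R q x1 x2 then pq q * p1 q x1 * p2 q x2 * marg \<pi> Ch x1 x2 y else 0)" (is ?A)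
  "valid_channel Ch \<Longrightarrow> (\<Sum>v\<in>Q_omega. if (\<lambda>(q,x1,x2,y1,y2). R q x1 x2) v then Q_joint pq p1 p2 Ch v else 0)
    = (\<Sum>q<4. \<Sum>x1\<in>UNIV. \<Sum>x2\<in>UNIV. if R q x1 x2 then pq q * p1 q x1 * p2 q x2 else 0)" (is "_ \<Longrightarrow> ?B")
proof -
  show ?A unfolding Q_omega_def sum.cartesian_product' sum_UNIV_prod Q_joint_def
    by (intro sum.cong refl) (auto simp: marg_def sum_distrib_left if_distrib cong: if_cong intro!: sum.cong)
  assume vc: "valid_channel Ch"
  show ?B unfolding Q_omega_def sum.cartesian_product' sum_UNIV_prod Q_joint_def
    by (intro sum.cong refl) (use vc in \<open>auto simp: valid_channel_def simp flip: sum_distrib_left\<close>)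
qed

lemma mprob_prod_joint_out:
  fixes Ch :: "'x1::finite \<Rightarrow> 'x2::finite \<Rightarrow> 'y1::finite \<Rightarrow> 'y2::finite \<Rightarrow> real"
  assumes "\<And>x1 x2 y1 y2. G (x1, x2, y1, y2) = z \<longleftrightarrow> R x1 x2 \<and> \<pi> y1 y2 = y"
  shows "mprob UNIV (prod_joint p1 p2 Ch) G z
    = (\<Sum>x1\<in>UNIV. \<Sum>x2\<in>UNIV. if R x1 x2 then p1 x1 * p2 x2 * marg \<pi> Ch x1 x2 y else 0)"
proof -
  have e: "G v = z \<longleftrightarrow> (\<lambda>(x1,x2,y1,y2). R x1 x2 \<and> \<pi> y1 y2 = y) v" for v by (cases v) (simp add: assms)
  show ?thesis unfolding mprob_if[OF finite] e by (rule sum_prod_joint(1))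
qed

lemma mprob_prod_joint_in:
  assumes "valid_channel Ch" "\<And>x1 x2 y1 y2. G (x1, x2, y1, y2) = z \<longleftrightarrow> R x1 x2"
  shows "mprob UNIV (prod_joint p1 p2 Ch) G z
    = (\<Sum>x1\<in>UNIV. \<Sum>x2\<in>UNIV. if R x1 x2 then p1 x1 * p2 x2 else 0)"
proof -
  have e: "G v = z \<longleftrightarrow> (\<lambda>(x1,x2,y1,y2). R x1 x2) v" for v by (cases v) (simp add: assms(2))
  show ?thesis unfolding mprob_if[OF finite] e by (rule sum_prod_joint(2)[OF assms(1)])
qed

lemma finite_Q_omega: "finite (Q_omega :: (nat \<times> 'x1::finite \<times> 'x2::finite \<times> 'y1::finite \<times> 'y2::finite) set)"
  by (simp add: Q_omega_def)

lemma mprob_Q_joint_out: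
  fixes Ch :: "'x1::finite \<Rightarrow> 'x2::finite \<Rightarrow> 'y1::finite \<Rightarrow> 'y2::finite \<Rightarrow> real"
  assumes "\<And>q x1 x2 y1 y2. G (q, x1, x2, y1, y2) = z \<longleftrightarrow> R q x1 x2 \<and> \<pi> y1 y2 = y"
  shows "mprob Q_omega (Q_joint pq p1 p2 Ch) G z
    = (\<Sum>q<4. \<Sum>x1\<in>UNIV. \<Sum>x2\<in>UNIV. if R q x1 x2 then pq q * p1 q x1 * p2 q x2 * marg \<pi> Ch x1 x2 y else 0)"
proof -
  have e: "G v = z \<longleftrightarrow> (\<lambda>(q,x1,x2,y1,y2). R q x1 x2 \<and> \<pi> y1 y2 = y) v" for v by (cases v) (simp add: assms)
  show ?thesis unfolding mprob_if[OF finite_Q_omega] e by (rule sum_Q_joint(1))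
qed

lemma mprob_Q_joint_in:
  assumes "valid_channel Ch" "\<And>q x1 x2 y1 y2. G (q, x1, x2, y1, y2) = z \<longleftrightarrow> R q x1 x2"
  shows "mprob Q_omega (Q_joint pq p1 p2 Ch) G z
    = (\<Sum>q<4. \<Sum>x1\<in>UNIV. \<Sum>x2\<in>UNIV. if R q x1 x2 then pq q * p1 q x1 * p2 q x2 else 0)"
proof -
  have e: "G v = z \<longleftrightarrow> (\<lambda>(q,x1,x2,y1,y2). R q x1 x2) v" for v by (cases v) (simp add: assms(2))
  show ?thesis unfolding mprob_if[OF finite_Q_omega] e by (rule sum_Q_joint(2)[OF assms(1)])
qed

lemma sum_if_conj:
  "(\<Sum>x\<in>A. if c \<and> P x then f x else 0) = (if c then \<Sum>x\<in>A. if P x then f x else 0 else 0)"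
  by simp

text \<open>For independent inputs the input probabilities cancel in the density and leave the ratio
  of \<open>mi1\<close>. Where they vanish, the weight of the summand vanishes too.\<close>

lemma cond_mi_prod_joint:
  fixes Ch :: "'x1::finite \<Rightarrow> 'x2::finite \<Rightarrow> 'y1::finite \<Rightarrow> 'y2::finite \<Rightarrow> real"
    and \<pi> :: "'y1 \<Rightarrow> 'y2 \<Rightarrow> 'y::finite"
  assumes vc: "valid_channel Ch" and p1: "is_pmf p1" and p2: "is_pmf p2"
  shows "cond_mi UNIV (prod_joint p1 p2 Ch) (\<lambda>(x1,x2,y1,y2). x1) (\<lambda>(x1,x2,y1,y2). \<pi> y1 y2) (\<lambda>(x1,x2,y1,y2). x2)
      = mi1 (marg \<pi> Ch) p1 p2" (is ?A)
    and "cond_mi UNIV (prod_joint p1 p2 Ch) (\<lambda>(x1,x2,y1,y2). x2) (\<lambda>(x1,x2,y1,y2). \<pi> y1 y2) (\<lambda>(x1,x2,y1,y2). x1)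
      = mi1 (flip (marg \<pi> Ch)) p2 p1" (is ?B)
proof -
  let ?J = "prod_joint p1 p2 Ch" and ?V = "marg \<pi> Ch"
  let ?x1 = "\<lambda>(x1::'x1, x2::'x2, y1::'y1, y2::'y2). x1" and ?x2 = "\<lambda>(x1::'x1, x2::'x2, y1::'y1, y2::'y2). x2"
    and ?o = "\<lambda>(x1::'x1, x2::'x2, y1::'y1, y2::'y2). \<pi> y1 y2"
  have s: "(\<Sum>a\<in>UNIV. p1 a) = 1" "(\<Sum>b\<in>UNIV. p2 b) = 1" using p1 p2 by (auto simp: is_pmf_def)
  have s': "(\<Sum>a\<in>UNIV. p1 a * c) = c" "(\<Sum>b\<in>UNIV. c * p2 b) = c" for c
    using s by (simp_all flip: sum_distrib_left sum_distrib_right)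
  have m: "mprob UNIV ?J (\<lambda>v. (?x1 v, ?o v, ?x2 v)) (x1, y, x2)
      = p1 x1 * p2 x2 * ?V x1 x2 y"
    "mprob UNIV ?J (\<lambda>v. (?x2 v, ?o v, ?x1 v)) (x2, y, x1)
      = p1 x1 * p2 x2 * ?V x1 x2 y"
    "mprob UNIV ?J (\<lambda>v. (?o v, ?x2 v)) (y, x2)
      = p2 x2 * (\<Sum>a\<in>UNIV. p1 a * ?V a x2 y)"
    "mprob UNIV ?J (\<lambda>v. (?o v, ?x1 v)) (y, x1)
      = p1 x1 * (\<Sum>b\<in>UNIV. p2 b * ?V x1 b y)" for x1 x2 y
    by (subst mprob_prod_joint_out[where R = "\<lambda>a b. a = x1 \<and> b = x2" and \<pi> = \<pi> and y = y] mprob_prod_joint_out[where R = "\<lambda>a b. b = x2" and \<pi> = \<pi> and y = y]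
         mprob_prod_joint_out[where R = "\<lambda>a b. a = x1" and \<pi> = \<pi> and y = y];
       auto simp: sum_if_conj sum_if_const sum_distrib_left mult_ac)+
  have n: "mprob UNIV ?J (\<lambda>v. (?x1 v, ?x2 v)) (x1, x2) = p1 x1 * p2 x2"
    "mprob UNIV ?J (\<lambda>v. (?x2 v, ?x1 v)) (x2, x1) = p1 x1 * p2 x2"
    "mprob UNIV ?J ?x1 x1 = p1 x1"
    "mprob UNIV ?J ?x2 x2 = p2 x2" for x1 x2
    by (subst mprob_prod_joint_in[where R = "\<lambda>a b. a = x1 \<and> b = x2"] mprob_prod_joint_in[where R = "\<lambda>a b. b = x2"]
         mprob_prod_joint_in[where R = "\<lambda>a b. a = x1"];
       auto simp: vc sum_if_conj sum_if_const s')+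
  have J: "?J (x1,x2,y1,y2) = p1 x1 * p2 x2 * Ch x1 x2 y1 y2" for x1 x2 y1 y2 by (simp add: prod_joint_def)
  have V: "(\<Sum>y1\<in>UNIV. \<Sum>y2\<in>UNIV. ?J (x1,x2,y1,y2) * h (\<pi> y1 y2)) = (\<Sum>y\<in>UNIV. p1 x1 * p2 x2 * ?V x1 x2 y * h y)"
    for x1 x2 and h :: "'y \<Rightarrow> real"
    using sum_marg[of Ch x1 x2 h \<pi>] by (simp add: prod_joint_def mult.assoc flip: sum_distrib_left)
  have "cond_mi UNIV ?J ?x1 ?o ?x2
     = (\<Sum>x1\<in>UNIV. \<Sum>x2\<in>UNIV. \<Sum>y1\<in>UNIV. \<Sum>y2\<in>UNIV. ?J (x1,x2,y1,y2)
         * log 2 (?V x1 x2 (\<pi> y1 y2) / (\<Sum>a\<in>UNIV. p1 a * ?V a x2 (\<pi> y1 y2))))"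
    unfolding cond_mi_def sum_UNIV_prod
    by (intro sum.cong refl) (auto simp: m n J)
  then show ?A
    by (simp only: V[of x1 x2 "\<lambda>y. log 2 (?V x1 x2 y / (\<Sum>a\<in>UNIV. p1 a * ?V a x2 y))" for x1 x2] mi1_def)
  have "cond_mi UNIV ?J ?x2 ?o ?x1
     = (\<Sum>x1\<in>UNIV. \<Sum>x2\<in>UNIV. \<Sum>y1\<in>UNIV. \<Sum>y2\<in>UNIV. ?J (x1,x2,y1,y2)
         * log 2 (?V x1 x2 (\<pi> y1 y2) / (\<Sum>b\<in>UNIV. p2 b * ?V x1 b (\<pi> y1 y2))))"
    unfolding cond_mi_def sum_UNIV_prod
    by (intro sum.cong refl) (auto simp: m n J)
  also have "\<dots> = (\<Sum>x1\<in>UNIV. \<Sum>x2\<in>UNIV. \<Sum>y\<in>UNIV. p1 x1 * p2 x2 * ?V x1 x2 y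
         * log 2 (?V x1 x2 y / (\<Sum>b\<in>UNIV. p2 b * ?V x1 b y)))"
    by (simp only: V[of x1 x2 "\<lambda>y. log 2 (?V x1 x2 y / (\<Sum>b\<in>UNIV. p2 b * ?V x1 b y))" for x1 x2])
  also have "\<dots> = mi1 (flip ?V) p2 p1"
    unfolding mi1_def flip_def by (subst sum.swap) (simp add: mult_ac)
  finally show ?B .
qed

text \<open>An information depends on an output only through the partition that it induces. Hence
  \<open>out_Y\<close>, with values in a sum type, may be exchanged for \<open>\<pi>\<close> as soon
  as both separate the same points. Given \<open>q\<close> the inputs are independent, so the
  informations average over \<open>q\<close>.\<close>

lemma cond_mi_Q_joint:
  fixes Ch :: "'x1::finite \<Rightarrow> 'x2::finite \<Rightarrow> 'y1::finite \<Rightarrow> 'y2::finite \<Rightarrow> real"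
    and \<pi> :: "'y1 \<Rightarrow> 'y2 \<Rightarrow> 'y::finite"
  assumes vc: "valid_channel Ch" and Q: "Q_dist pq p1 p2"
    and out: "\<And>q x1 x2 y1 y2 q' x1' x2' y1' y2'. out (q', x1', x2', y1', y2') = out (q, x1, x2, y1, y2) \<longleftrightarrow> \<pi> y1' y2' = \<pi> y1 y2"
  shows "cond_mi Q_omega (Q_joint pq p1 p2 Ch) (\<lambda>(q,x1,x2,y1,y2). x1) out (\<lambda>(q,x1,x2,y1,y2). (x2, q))
      = (\<Sum>q<4. pq q * mi1 (marg \<pi> Ch) (p1 q) (p2 q))" (is ?A)
    and "cond_mi Q_omega (Q_joint pq p1 p2 Ch) (\<lambda>(q,x1,x2,y1,y2). x2) out (\<lambda>(q,x1,x2,y1,y2). (x1, q))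
      = (\<Sum>q<4. pq q * mi1 (flip (marg \<pi> Ch)) (p2 q) (p1 q))" (is ?B)
    and "cond_mi Q_omega (Q_joint pq p1 p2 Ch) (\<lambda>(q,x1,x2,y1,y2). (x1, x2)) out (\<lambda>(q,x1,x2,y1,y2). q)
      = (\<Sum>q<4. pq q * mi12 (marg \<pi> Ch) (p1 q) (p2 q))" (is ?C)
proof -
  let ?J = "Q_joint pq p1 p2 Ch" and ?V = "marg \<pi> Ch"
  let ?x1 = "\<lambda>(q::nat, x1::'x1, x2::'x2, y1::'y1, y2::'y2). x1"
    and ?x2 = "\<lambda>(q::nat, x1::'x1, x2::'x2, y1::'y1, y2::'y2). x2"
    and ?x12 = "\<lambda>(q::nat, x1::'x1, x2::'x2, y1::'y1, y2::'y2). (x1, x2)"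
    and ?q = "\<lambda>(q::nat, x1::'x1, x2::'x2, y1::'y1, y2::'y2). q"
    and ?x1q = "\<lambda>(q::nat, x1::'x1, x2::'x2, y1::'y1, y2::'y2). (x1, q)"
    and ?x2q = "\<lambda>(q::nat, x1::'x1, x2::'x2, y1::'y1, y2::'y2). (x2, q)"
  have s: "(\<Sum>a\<in>UNIV. p1 q a) = 1" "(\<Sum>b\<in>UNIV. p2 q b) = 1" if "q < 4" for q
    using Q that by (auto simp: Q_dist_def is_pmf_def)
  have s': "(\<Sum>a\<in>UNIV. c * p1 q a) = c" "(\<Sum>a\<in>UNIV. c * p1 q a * d) = c * d" "(\<Sum>b\<in>UNIV. c * p2 q b) = c" if "q < 4" for q c d
    using s[OF that] by (simp_all flip: sum_distrib_left sum_distrib_right)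
  have mABC: "mprob Q_omega ?J (\<lambda>v. (?x1 v, out v, ?x2q v)) (x1, out (q,x1,x2,y1,y2), x2, q)
      = pq q * p1 q x1 * p2 q x2 * ?V x1 x2 (\<pi> y1 y2)"
    "mprob Q_omega ?J (\<lambda>v. (?x2 v, out v, ?x1q v)) (x2, out (q,x1,x2,y1,y2), x1, q)
      = pq q * p1 q x1 * p2 q x2 * ?V x1 x2 (\<pi> y1 y2)"
    "mprob Q_omega ?J (\<lambda>v. (?x12 v, out v, ?q v)) ((x1, x2), out (q,x1,x2,y1,y2), q)
      = pq q * p1 q x1 * p2 q x2 * ?V x1 x2 (\<pi> y1 y2)"
    if "q < 4" for q x1 x2 y1 y2
    by (subst mprob_Q_joint_out[where R = "\<lambda>c a b. c = q \<and> a = x1 \<and> b = x2" and \<pi> = \<pi> and y = "\<pi> y1 y2"];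
        use that in \<open>auto simp: out sum_if_conj sum_if_const\<close>)+
  have mAC: "mprob Q_omega ?J (\<lambda>v. (?x1 v, ?x2q v)) (x1, x2, q)
      = pq q * p1 q x1 * p2 q x2"
    "mprob Q_omega ?J (\<lambda>v. (?x2 v, ?x1q v)) (x2, x1, q)
      = pq q * p1 q x1 * p2 q x2"
    "mprob Q_omega ?J (\<lambda>v. (?x12 v, ?q v)) ((x1, x2), q)
      = pq q * p1 q x1 * p2 q x2"
    if "q < 4" for q x1 x2
    by (subst mprob_Q_joint_in[where R = "\<lambda>c a b. c = q \<and> a = x1 \<and> b = x2"];
        use that in \<open>auto simp: vc sum_if_conj sum_if_const\<close>)+
  have mBC: "mprob Q_omega ?J (\<lambda>v. (out v, ?x2q v)) (out (q,x1,x2,y1,y2), x2, q)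
      = pq q * p2 q x2 * (\<Sum>a\<in>UNIV. p1 q a * ?V a x2 (\<pi> y1 y2))" if "q < 4" for q x1 x2 y1 y2
    by (subst mprob_Q_joint_out[where R = "\<lambda>c a b. c = q \<and> b = x2" and \<pi> = \<pi> and y = "\<pi> y1 y2"];
        use that in \<open>auto simp: out sum_if_conj sum_if_const sum_distrib_left mult_ac\<close>)
  have mBC': "mprob Q_omega ?J (\<lambda>v. (out v, ?x1q v)) (out (q,x1,x2,y1,y2), x1, q)
      = pq q * p1 q x1 * (\<Sum>b\<in>UNIV. p2 q b * ?V x1 b (\<pi> y1 y2))" if "q < 4" for q x1 x2 y1 y2
    by (subst mprob_Q_joint_out[where R = "\<lambda>c a b. c = q \<and> a = x1" and \<pi> = \<pi> and y = "\<pi> y1 y2"];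
        use that in \<open>auto simp: out sum_if_conj sum_if_const sum_distrib_left mult_ac\<close>)
  have mBC'': "mprob Q_omega ?J (\<lambda>v. (out v, ?q v)) (out (q,x1,x2,y1,y2), q)
      = pq q * (\<Sum>a\<in>UNIV. \<Sum>b\<in>UNIV. p1 q a * p2 q b * ?V a b (\<pi> y1 y2))" if "q < 4" for q x1 x2 y1 y2
    by (subst mprob_Q_joint_out[where R = "\<lambda>c a b. c = q" and \<pi> = \<pi> and y = "\<pi> y1 y2"];
        use that in \<open>auto simp: out sum_if_const sum_distrib_left mult_ac\<close>)
  have mC: "mprob Q_omega ?J ?x2q (x2, q) = pq q * p2 q x2"
    if "q < 4" for q x2
    by (subst mprob_Q_joint_in[where R = "\<lambda>c a b. c = q \<and> b = x2"];
        use that in \<open>auto simp: vc sum_if_conj sum_if_const s'\<close>)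
  have mC': "mprob Q_omega ?J ?x1q (x1, q) = pq q * p1 q x1"
    if "q < 4" for q x1
    by (subst mprob_Q_joint_in[where R = "\<lambda>c a b. c = q \<and> a = x1"];
        use that in \<open>auto simp: vc sum_if_conj sum_if_const s'\<close>)
  have mC'': "mprob Q_omega ?J ?q q = pq q"
    if "q < 4" for q
    by (subst mprob_Q_joint_in[where R = "\<lambda>c a b. c = q"];
        use that in \<open>auto simp: vc sum_if_const s'\<close>)
  have J: "?J (q,x1,x2,y1,y2) = pq q * p1 q x1 * p2 q x2 * Ch x1 x2 y1 y2" for q x1 x2 y1 y2
    by (simp add: Q_joint_def)
  have V: "(\<Sum>y1\<in>UNIV. \<Sum>y2\<in>UNIV. ?J (q,x1,x2,y1,y2) * h (\<pi> y1 y2)) = pq q * (\<Sum>y\<in>UNIV. p1 q x1 * p2 q x2 * ?V x1 x2 y * h y)"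
    for q x1 x2 and h :: "'y \<Rightarrow> real"
    using sum_marg[of Ch x1 x2 h \<pi>] by (simp add: Q_joint_def mult.assoc flip: sum_distrib_left)
  have "cond_mi Q_omega ?J ?x1 out ?x2q
     = (\<Sum>q<4. \<Sum>x1\<in>UNIV. \<Sum>x2\<in>UNIV. \<Sum>y1\<in>UNIV. \<Sum>y2\<in>UNIV. ?J (q,x1,x2,y1,y2)
         * log 2 (?V x1 x2 (\<pi> y1 y2) / (\<Sum>a\<in>UNIV. p1 q a * ?V a x2 (\<pi> y1 y2))))"
    unfolding cond_mi_def Q_omega_def sum.cartesian_product' sum_UNIV_prod
    unfolding Q_omega_def[symmetric]
    by (intro sum.cong refl) (auto simp: mABC mAC mBC mC J)
  then show ?A
    by (simp only: V[of q x1 x2 "\<lambda>y. log 2 (?V x1 x2 y / (\<Sum>a\<in>UNIV. p1 q a * ?V a x2 y))" for q x1 x2]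
        mi1_def sum_distrib_left)
  have "cond_mi Q_omega ?J ?x2 out ?x1q
     = (\<Sum>q<4. \<Sum>x1\<in>UNIV. \<Sum>x2\<in>UNIV. \<Sum>y1\<in>UNIV. \<Sum>y2\<in>UNIV. ?J (q,x1,x2,y1,y2)
         * log 2 (?V x1 x2 (\<pi> y1 y2) / (\<Sum>b\<in>UNIV. p2 q b * ?V x1 b (\<pi> y1 y2))))"
    unfolding cond_mi_def Q_omega_def sum.cartesian_product' sum_UNIV_prod
    unfolding Q_omega_def[symmetric]
    by (intro sum.cong refl) (auto simp: mABC mAC mBC' mC' J)
  also have "\<dots> = (\<Sum>q<4. \<Sum>x2\<in>UNIV. \<Sum>x1\<in>UNIV. pq q * (\<Sum>y\<in>UNIV. p1 q x1 * p2 q x2 * ?V x1 x2 y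
         * log 2 (?V x1 x2 y / (\<Sum>b\<in>UNIV. p2 q b * ?V x1 b y))))"
    unfolding V[of q x1 x2 "\<lambda>y. log 2 (?V x1 x2 y / (\<Sum>b\<in>UNIV. p2 q b * ?V x1 b y))" for q x1 x2]
    by (intro sum.cong refl sum.swap)
  finally show ?B by (simp add: mi1_def flip_def sum_distrib_left mult_ac)
  have "cond_mi Q_omega ?J ?x12 out ?q
     = (\<Sum>q<4. \<Sum>x1\<in>UNIV. \<Sum>x2\<in>UNIV. \<Sum>y1\<in>UNIV. \<Sum>y2\<in>UNIV. ?J (q,x1,x2,y1,y2)
         * log 2 (?V x1 x2 (\<pi> y1 y2) / (\<Sum>a\<in>UNIV. \<Sum>b\<in>UNIV. p1 q a * p2 q b * ?V a b (\<pi> y1 y2))))"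
    unfolding cond_mi_def Q_omega_def sum.cartesian_product' sum_UNIV_prod
    unfolding Q_omega_def[symmetric]
    by (intro sum.cong refl) (auto simp: mABC mAC mBC'' mC'' J)
  then show ?C
    by (simp only: V[of q x1 x2 "\<lambda>y. log 2 (?V x1 x2 y / (\<Sum>a\<in>UNIV. \<Sum>b\<in>UNIV. p1 q a * p2 q b * ?V a b y))" for q x1 x2]
        mi12_def sum_distrib_left)
qed

section \<open>The conditional source entropies\<close>

text \<open>The value for \<open>w\<close> of probability zero makes \<open>condK P w\<close> a probability vector for all \<open>w\<close>.\<close>

definition condK :: "('s1::finite \<Rightarrow> 's2::finite \<Rightarrow> 'w \<Rightarrow> real) \<Rightarrow> 'w \<Rightarrow> 's1 \<Rightarrow> real" where
  "condK P w s = (if (\<Sum>a\<in>UNIV. \<Sum>c\<in>UNIV. P a c w) = 0 then 1 / CARD('s1)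
     else (\<Sum>c\<in>UNIV. P s c w) / (\<Sum>a\<in>UNIV. \<Sum>c\<in>UNIV. P a c w))"

lemma condK_nonneg:
  assumes "valid_source P"
  shows "0 \<le> condK P w s"
  using assms unfolding condK_def valid_source_def by (auto intro!: divide_nonneg_nonneg sum_nonneg)

lemma condK_sum: "(\<Sum>s\<in>UNIV. condK P w s) = 1"
  by (cases "(\<Sum>a\<in>UNIV. \<Sum>c\<in>UNIV. P a c w) = 0") (auto simp: condK_def simp flip: sum_divide_distrib)

lemma valid_source_flip: "valid_source P \<Longrightarrow> valid_source (\<lambda>s2 s1. P s1 s2)"
  unfolding valid_source_def by (subst sum.swap) auto

lemma source_le_marginals:
  assumes "valid_source P"
  shows "P s1 s2 w \<le> (\<Sum>c\<in>UNIV. P s1 c w)" "(\<Sum>c\<in>UNIV. P s1 c w) \<le> (\<Sum>a\<in>UNIV. \<Sum>c\<in>UNIV. P a c w)"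
proof -
  have P0: "0 \<le> P a c w" for a c w using assms by (simp add: valid_source_def)
  show "P s1 s2 w \<le> (\<Sum>c\<in>UNIV. P s1 c w)"
    by (rule member_le_sum[of s2 UNIV "\<lambda>c. P s1 c w"]) (use P0 in auto)
  show "(\<Sum>c\<in>UNIV. P s1 c w) \<le> (\<Sum>a\<in>UNIV. \<Sum>c\<in>UNIV. P a c w)"
    by (rule member_le_sum[of s1 UNIV "\<lambda>a. \<Sum>c\<in>UNIV. P a c w"]) (use P0 in \<open>auto intro: sum_nonneg\<close>)
qed

lemma condK_pos:
  assumes "valid_source P" "0 < P s1 s2 w"
  shows "0 < condK P w s1"
  using source_le_marginals(1)[OF assms(1), of s1 s2 w] source_le_marginals(2)[OF assms(1), of s1 w] assms(2) by (auto simp: condK_def)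

text \<open>For a \<open>w\<close> of probability zero \<open>condK\<close> differs from the
  quotient in \<open>cond_ent\<close>, but there \<open>P\<close> vanishes.\<close>

lemma H_S1_W_eq:
  assumes "valid_source P"
  shows "H_S1_W P = - (\<Sum>s1\<in>UNIV. \<Sum>s2\<in>UNIV. \<Sum>w\<in>UNIV. P s1 s2 w * log 2 (condK P w s1))"
proof -
  have m: "mprob UNIV (src_joint P) (\<lambda>v. (case v of (s1,s2,w) \<Rightarrow> s1, case v of (s1,s2,w) \<Rightarrow> w)) (s1, w)
      = (\<Sum>c\<in>UNIV. P s1 c w)"
    "mprob UNIV (src_joint P) (\<lambda>(s1,s2,w). w) w = (\<Sum>a\<in>UNIV. \<Sum>c\<in>UNIV. P a c w)" for s1 w
  proof -
    have "mprob UNIV (src_joint P) (\<lambda>v. (case v of (s1,s2,w) \<Rightarrow> s1, case v of (s1,s2,w) \<Rightarrow> w)) (s1, w)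
      = (\<Sum>a\<in>UNIV. \<Sum>c\<in>UNIV. \<Sum>w'\<in>UNIV. if a = s1 \<and> w' = w then P a c w' else 0)"
      by (subst mprob_if) (auto simp: sum_UNIV_prod src_joint_def cong: if_cong)
    then show "mprob UNIV (src_joint P) (\<lambda>v. (case v of (s1,s2,w) \<Rightarrow> s1, case v of (s1,s2,w) \<Rightarrow> w)) (s1, w)
      = (\<Sum>c\<in>UNIV. P s1 c w)" by (simp add: sum_if_conj sum_if_const)
    show "mprob UNIV (src_joint P) (\<lambda>(s1,s2,w). w) w = (\<Sum>a\<in>UNIV. \<Sum>c\<in>UNIV. P a c w)"
      by (subst mprob_if) (auto simp: sum_UNIV_prod src_joint_def cong: if_cong)
  qed
  have e: "P s1 s2 w * log 2 ((\<Sum>c\<in>UNIV. P s1 c w) / (\<Sum>a\<in>UNIV. \<Sum>c\<in>UNIV. P a c w)) = P s1 s2 w * log 2 (condK P w s1)"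
    for s1 s2 w
  proof (cases "(\<Sum>a\<in>UNIV. \<Sum>c\<in>UNIV. P a c w) = 0")
    case True
    then have "P s1 s2 w \<le> 0" using source_le_marginals(1)[OF assms, of s1 s2 w] source_le_marginals(2)[OF assms, of s1 w] by simp
    moreover have "0 \<le> P s1 s2 w" using assms by (simp add: valid_source_def)
    ultimately show ?thesis by simp
  qed (simp add: condK_def)
  have "H_S1_W P = - (\<Sum>s1\<in>UNIV. \<Sum>s2\<in>UNIV. \<Sum>w\<in>UNIV. P s1 s2 w
      * log 2 ((\<Sum>c\<in>UNIV. P s1 c w) / (\<Sum>a\<in>UNIV. \<Sum>c\<in>UNIV. P a c w)))"
    unfolding H_S1_W_def cond_ent_def sum_UNIV_prod by (simp add: m) (simp add: src_joint_def)
  then show ?thesis by (simp only: e)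
qed

text \<open>Reduces every statement about the second source to the one about the first.\<close>

lemma H_S2_W_flip: "H_S2_W P = H_S1_W (\<lambda>s2 s1. P s1 s2)"
proof -
  have sw: "(\<Sum>v\<in>UNIV. f v) = (\<Sum>v\<in>UNIV. f ((\<lambda>(a,b,c). (b,a,c)) v))" for f :: "'a::finite \<times> 'b::finite \<times> 'c::finite \<Rightarrow> real"
    unfolding sum_UNIV_prod by (subst sum.swap) simp
  have m: "mprob UNIV (src_joint P) G z = mprob UNIV (src_joint (\<lambda>s2 s1. P s1 s2)) (G \<circ> (\<lambda>(a,b,c). (b,a,c))) z" for G and z :: 'z
    unfolding mprob_if[OF finite] by (subst sw) (auto intro!: sum.cong simp: src_joint_def)
  show ?thesis unfolding H_S1_W_def H_S2_W_def cond_ent_def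
    by (subst sw, subst m, subst m) (auto intro!: sum.cong simp: src_joint_def o_def case_prod_unfold)
qed

section \<open>The converse\<close>

definition seqP :: "nat \<Rightarrow> ('w \<Rightarrow> real) \<Rightarrow> 'w list \<Rightarrow> real" where
  "seqP m p w = (\<Prod>i<m. p (w ! i))"

definition seqK :: "nat \<Rightarrow> ('w \<Rightarrow> 's \<Rightarrow> real) \<Rightarrow> 'w list \<Rightarrow> 's list \<Rightarrow> real" where
  "seqK m K w s = (\<Prod>i<m. K (w ! i) (s ! i))"

definition seqV :: "nat \<Rightarrow> ('a \<Rightarrow> 'b \<Rightarrow> 'y \<Rightarrow> real) \<Rightarrow> 'a list \<Rightarrow> 'b list \<Rightarrow> 'y list \<Rightarrow> real" where
  "seqV n V x1 x2 y = (\<Prod>j<n. V (x1 ! j) (x2 ! j) (y ! j))"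

lemma seqP_nonneg: "(\<And>w. 0 \<le> p w) \<Longrightarrow> 0 \<le> seqP m p w"
  unfolding seqP_def by (rule prod_nonneg) simp

lemma seqK_nonneg: "(\<And>w s. 0 \<le> K w s) \<Longrightarrow> 0 \<le> seqK m K w s"
  unfolding seqK_def by (rule prod_nonneg) simp

lemma seqV_nonneg: "is_kernel V \<Longrightarrow> 0 \<le> seqV n V x1 x2 y"
  unfolding seqV_def is_kernel_def by (rule prod_nonneg) simp

lemma seqP_sum:
  fixes p :: "'w::finite \<Rightarrow> real"
  shows "(\<Sum>w\<in>UNIV. p w) = 1 \<Longrightarrow> (\<Sum>w\<in>seqs m. seqP m p w) = 1"
  unfolding seqP_def by (simp add: sum_seqs_prod[of "\<lambda>_. p"])

lemma seqK_sum:
  fixes K :: "'w \<Rightarrow> 's::finite \<Rightarrow> real"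
  shows "(\<And>w. (\<Sum>s\<in>UNIV. K w s) = 1) \<Longrightarrow> (\<Sum>s\<in>seqs m. seqK m K w s) = 1"
  unfolding seqK_def by (simp add: sum_seqs_prod[of "\<lambda>i. K (w ! i)"])

lemma seqV_sum: "is_kernel V \<Longrightarrow> (\<Sum>y\<in>seqs n. seqV n V x1 x2 y) = 1"
  unfolding seqV_def is_kernel_def by (simp add: sum_seqs_prod[of "\<lambda>j. V (x1 ! j) (x2 ! j)"])

lemma seqV_flip: "seqV n (flip V) x2 x1 y = seqV n V x1 x2 y"
  by (simp add: seqV_def flip_def)

lemma log_prod_sum:
  fixes g :: "nat \<Rightarrow> real"
  assumes "\<And>j. j < n \<Longrightarrow> 0 < g j"
  shows "log 2 (\<Prod>j<n. g j) = (\<Sum>j<n. log 2 (g j))"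
  unfolding log_def using assms
  by (subst ln_prod) (auto simp: sum_divide_distrib less_imp_neq[symmetric])

lemma prod_pos_imp_pos:
  fixes g :: "nat \<Rightarrow> real"
  assumes "\<And>j. 0 \<le> g j" "0 < (\<Prod>j<n. g j)" "j < n"
  shows "0 < g j"
proof (rule ccontr)
  assume "\<not> 0 < g j"
  then have "g j = 0" using assms(1)[of j] by simp
  then have "(\<Prod>j<n. g j) = 0" using assms(3) by (intro prod_zero) auto
  with assms(2) show False by simp
qed

lemma sum_seqs_prod2_coord:
  fixes g :: "'a::finite \<Rightarrow> 'b::finite \<Rightarrow> real"
  assumes "(\<Sum>a\<in>UNIV. \<Sum>b\<in>UNIV. g a b) = 1" "i < n"
  shows "(\<Sum>a\<in>seqs n. \<Sum>b\<in>seqs n. (\<Prod>j<n. g (a ! j) (b ! j)) * \<phi> (a ! i) (b ! i))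
    = (\<Sum>a\<in>UNIV. \<Sum>b\<in>UNIV. g a b * \<phi> a b)"
proof -
  let ?h = "\<lambda>j a b. g a b * (if j = i then \<phi> a b else 1)"
  have "(\<Sum>a\<in>seqs n. \<Sum>b\<in>seqs n. (\<Prod>j<n. g (a ! j) (b ! j)) * \<phi> (a ! i) (b ! i))
      = (\<Sum>a\<in>seqs n. \<Sum>b\<in>seqs n. \<Prod>j<n. ?h j (a ! j) (b ! j))"
    using assms(2) by (simp add: prod.distrib)
  also have "\<dots> = (\<Sum>a\<in>seqs n. \<Prod>j<n. \<Sum>b\<in>UNIV. ?h j (a ! j) b)"
    by (intro sum.cong refl) (rule sum_seqs_prod[of "\<lambda>j b. ?h j (_ ! j) b"])
  also have "\<dots> = (\<Prod>j<n. \<Sum>a\<in>UNIV. \<Sum>b\<in>UNIV. ?h j a b)"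
    by (rule sum_seqs_prod[of "\<lambda>j a. \<Sum>b\<in>UNIV. ?h j a b"])
  also have "\<dots> = (\<Prod>j<n. if j = i then \<Sum>a\<in>UNIV. \<Sum>b\<in>UNIV. g a b * \<phi> a b else 1)"
    by (rule prod.cong) (use assms(1) in auto)
  also have "\<dots> = (\<Sum>a\<in>UNIV. \<Sum>b\<in>UNIV. g a b * \<phi> a b)" using assms(2) by simp
  finally show ?thesis .
qed

text \<open>The logarithm of a product splits only where the product is positive; elsewhere the
  weight is zero. Each summand then depends on one coordinate and reduces to a letter.\<close>

lemma entropy_seq:
  fixes p :: "'w::finite \<Rightarrow> real" and K :: "'w \<Rightarrow> 's::finite \<Rightarrow> real"
  assumes "\<And>w. 0 \<le> p w" "(\<Sum>w\<in>UNIV. p w) = 1" "\<And>w s. 0 \<le> K w s" "\<And>w. (\<Sum>s\<in>UNIV. K w s) = 1"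
  shows "(\<Sum>w\<in>seqs m. \<Sum>s\<in>seqs m. seqP m p w * seqK m K w s * log 2 (seqK m K w s))
    = m * (\<Sum>w\<in>UNIV. \<Sum>s\<in>UNIV. p w * K w s * log 2 (K w s))"
proof -
  have g1: "(\<Sum>w\<in>UNIV. \<Sum>s\<in>UNIV. p w * K w s) = 1"
    using assms(2,4) by (simp flip: sum_distrib_left)
  have "(\<Sum>w\<in>seqs m. \<Sum>s\<in>seqs m. seqP m p w * seqK m K w s * log 2 (seqK m K w s))
     = (\<Sum>w\<in>seqs m. \<Sum>s\<in>seqs m. \<Sum>i<m. (\<Prod>j<m. p (w ! j) * K (w ! j) (s ! j)) * log 2 (K (w ! i) (s ! i)))"
  proof (intro sum.cong refl)
    fix w :: "'w list" and s :: "'s list"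
    have pk: "(\<Prod>j<m. p (w ! j) * K (w ! j) (s ! j)) = seqP m p w * seqK m K w s"
      by (simp add: seqP_def seqK_def prod.distrib)
    show "seqP m p w * seqK m K w s * log 2 (seqK m K w s)
      = (\<Sum>i<m. (\<Prod>j<m. p (w ! j) * K (w ! j) (s ! j)) * log 2 (K (w ! i) (s ! i)))"
    proof (cases "seqK m K w s = 0")
      case False
      then have "0 < seqK m K w s" using seqK_nonneg[of K m w s] assms(3) by (simp add: less_le)
      then have "log 2 (seqK m K w s) = (\<Sum>i<m. log 2 (K (w ! i) (s ! i)))"
        unfolding seqK_def using assms(3) by (intro log_prod_sum) (rule prod_pos_imp_pos[of "\<lambda>i. K (w ! i) (s ! i)"])
      then show ?thesis by (simp add: pk sum_distrib_left)
    qed (simp add: pk)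
  qed
  also have "\<dots> = (\<Sum>i<m. \<Sum>w\<in>seqs m. \<Sum>s\<in>seqs m. (\<Prod>j<m. p (w ! j) * K (w ! j) (s ! j)) * log 2 (K (w ! i) (s ! i)))"
    by (subst sum.swap[of _ "seqs m" "{..<m}"], subst sum.swap[of _ "seqs m" "{..<m}"]) simp
  also have "\<dots> = (\<Sum>i<m. \<Sum>w\<in>UNIV. \<Sum>s\<in>UNIV. p w * K w s * log 2 (K w s))"
    by (intro sum.cong refl)
       (rule sum_seqs_prod2_coord[of "\<lambda>w s. p w * K w s" _ _ "\<lambda>w s. log 2 (K w s)"], use g1 in auto)
  finally show ?thesis by simp
qed

section \<open>Letter laws of a code\<close>

lemma sum_pushforward:
  fixes h :: "'s \<Rightarrow> 'a::finite"
  shows "(\<Sum>s\<in>S. k s * \<psi> (h s)) = (\<Sum>a\<in>UNIV. (\<Sum>s\<in>S. k s * of_bool (h s = a)) * (\<psi> a :: real))"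
proof -
  have "(\<Sum>a\<in>UNIV. (\<Sum>s\<in>S. k s * of_bool (h s = a)) * \<psi> a)
      = (\<Sum>s\<in>S. \<Sum>a\<in>UNIV. k s * of_bool (h s = a) * \<psi> a)"
    unfolding sum_distrib_right by (rule sum.swap)
  also have "\<dots> = (\<Sum>s\<in>S. \<Sum>a\<in>UNIV. if a = h s then k s * \<psi> a else 0)"
    by (intro sum.cong refl) auto
  finally show ?thesis by simp
qed

text \<open>The law of the \<open>j\<close>-th channel input given \<open>w\<close>.\<close>

definition letter :: "nat \<Rightarrow> ('w \<Rightarrow> 's::finite \<Rightarrow> real) \<Rightarrow> ('s list \<Rightarrow> 'a list) \<Rightarrow> 'w list \<Rightarrow> nat \<Rightarrow> 'a \<Rightarrow> real" where
  "letter m K f w j a = (\<Sum>s\<in>seqs m. seqK m K w s * of_bool (f s ! j = a))"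

lemma letter_pmf:
  fixes f :: "'s::finite list \<Rightarrow> 'a::finite list"
  assumes "\<And>w s. 0 \<le> K w s" "\<And>w. (\<Sum>s\<in>UNIV. K w s) = 1"
  shows "is_pmf (letter m K f w j)"
  unfolding is_pmf_def letter_def
  using sum_pushforward[of "seqK m K w" "\<lambda>_. 1" "\<lambda>s. f s ! j" "seqs m"] seqK_sum[of K m w] assms
  by (auto intro!: sum_nonneg mult_nonneg_nonneg seqK_nonneg)

lemma letter_pos:
  assumes "\<And>w s. 0 \<le> K w s" "0 < seqK m K w s" "s \<in> seqs m"
  shows "0 < letter m K f w j (f s ! j)"
proof -
  have "seqK m K w s * of_bool (f s ! j = f s ! j) \<le> letter m K f w j (f s ! j)"
    unfolding letter_def
    by (rule member_le_sum[of s "seqs m" "\<lambda>s'. seqK m K w s' * of_bool (f s' ! j = f s ! j)"])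
       (use assms seqK_nonneg[of K] in auto)
  with assms show ?thesis by simp
qed

text \<open>The expectation of a sum over positions sees the codewords only letter by letter. Given
  \<open>w\<close> the sources are independent, so the two letter laws at a position multiply,
  however the letters at different positions depend on each other.\<close>

lemma sum_letters:
  fixes f1 :: "'s1::finite list \<Rightarrow> 'a::finite list" and f2 :: "'s2::finite list \<Rightarrow> 'b::finite list"
    and V :: "'a \<Rightarrow> 'b \<Rightarrow> 'y::finite \<Rightarrow> real"
  assumes "is_kernel V"
  shows "(\<Sum>s1\<in>seqs m. \<Sum>s2\<in>seqs m. \<Sum>y\<in>seqs n. seqK m K1 w s1 * seqK m K2 w s2 * seqV n V (f1 s1) (f2 s2) y
      * (\<Sum>j<n. \<phi> j (f1 s1 ! j) (f2 s2 ! j) (y ! j)))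
    = (\<Sum>j<n. \<Sum>a\<in>UNIV. \<Sum>b\<in>UNIV. \<Sum>y\<in>UNIV. letter m K1 f1 w j a * letter m K2 f2 w j b * V a b y * \<phi> j a b y)"
proof -
  define \<psi> where "\<psi> j a b = (\<Sum>y\<in>UNIV. V a b y * \<phi> j a b y)" for j a b
  have V1: "(\<Sum>y\<in>UNIV. V a b y) = 1" for a b using assms by (simp add: is_kernel_def)
  have "(\<Sum>s1\<in>seqs m. \<Sum>s2\<in>seqs m. \<Sum>y\<in>seqs n. seqK m K1 w s1 * seqK m K2 w s2 * seqV n V (f1 s1) (f2 s2) y
      * (\<Sum>j<n. \<phi> j (f1 s1 ! j) (f2 s2 ! j) (y ! j)))
    = (\<Sum>s1\<in>seqs m. \<Sum>s2\<in>seqs m. \<Sum>j<n. seqK m K1 w s1 * (seqK m K2 w s2 * \<psi> j (f1 s1 ! j) (f2 s2 ! j)))"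
  proof (intro sum.cong refl)
    fix s1 s2
    have "(\<Sum>y\<in>seqs n. seqK m K1 w s1 * seqK m K2 w s2 * seqV n V (f1 s1) (f2 s2) y
      * (\<Sum>j<n. \<phi> j (f1 s1 ! j) (f2 s2 ! j) (y ! j)))
      = (\<Sum>j<n. \<Sum>y\<in>seqs n. seqK m K1 w s1 * seqK m K2 w s2 * (seqV n V (f1 s1) (f2 s2) y
          * \<phi> j (f1 s1 ! j) (f2 s2 ! j) (y ! j)))"
      unfolding sum_distrib_left mult.assoc by (rule sum.swap)
    also have "\<dots> = (\<Sum>j<n. seqK m K1 w s1 * (seqK m K2 w s2 * \<psi> j (f1 s1 ! j) (f2 s2 ! j)))"
    proof (intro sum.cong refl)
      fix j assume "j \<in> {..<n}"
      then have "(\<Sum>y\<in>seqs n. seqV n V (f1 s1) (f2 s2) y * \<phi> j (f1 s1 ! j) (f2 s2 ! j) (y ! j)) = \<psi> j (f1 s1 ! j) (f2 s2 ! j)"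
        unfolding seqV_def \<psi>_def
        by (intro sum_seqs_prod_coord[of j n "\<lambda>j. V (f1 s1 ! j) (f2 s2 ! j)" "\<phi> j (f1 s1 ! j) (f2 s2 ! j)"]) (auto simp: V1)
      then show "(\<Sum>y\<in>seqs n. seqK m K1 w s1 * seqK m K2 w s2 * (seqV n V (f1 s1) (f2 s2) y
          * \<phi> j (f1 s1 ! j) (f2 s2 ! j) (y ! j))) = seqK m K1 w s1 * (seqK m K2 w s2 * \<psi> j (f1 s1 ! j) (f2 s2 ! j))"
        by (simp flip: sum_distrib_left)
    qed
    finally show "(\<Sum>y\<in>seqs n. seqK m K1 w s1 * seqK m K2 w s2 * seqV n V (f1 s1) (f2 s2) y
      * (\<Sum>j<n. \<phi> j (f1 s1 ! j) (f2 s2 ! j) (y ! j))) = \<dots>" .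
  qed
  also have "\<dots> = (\<Sum>j<n. \<Sum>s1\<in>seqs m. \<Sum>s2\<in>seqs m. seqK m K1 w s1 * (seqK m K2 w s2 * \<psi> j (f1 s1 ! j) (f2 s2 ! j)))"
    by (subst sum.swap[of _ "seqs m" "{..<n}"], subst sum.swap[of _ "seqs m" "{..<n}"]) simp
  also have "\<dots> = (\<Sum>j<n. \<Sum>s1\<in>seqs m. seqK m K1 w s1 * (\<Sum>b\<in>UNIV. letter m K2 f2 w j b * \<psi> j (f1 s1 ! j) b))"
    unfolding sum_distrib_left[symmetric] letter_def
    by (intro sum.cong refl arg_cong2[where f = "(*)"]) (rule sum_pushforward[of "seqK m K2 w" "\<lambda>b. \<psi> _ (f1 _ ! _) b"])
  also have "\<dots> = (\<Sum>j<n. \<Sum>a\<in>UNIV. letter m K1 f1 w j a * (\<Sum>b\<in>UNIV. letter m K2 f2 w j b * \<psi> j a b))"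
    unfolding letter_def[of m K1]
    by (intro sum.cong refl) (rule sum_pushforward[of "seqK m K1 w" "\<lambda>a. \<Sum>b\<in>UNIV. letter m K2 f2 w _ b * \<psi> _ a b"])
  also have "\<dots> = (\<Sum>j<n. \<Sum>a\<in>UNIV. \<Sum>b\<in>UNIV. \<Sum>y\<in>UNIV. letter m K1 f1 w j a * letter m K2 f2 w j b * V a b y * \<phi> j a b y)"
    by (simp add: \<psi>_def sum_distrib_left mult.assoc)
  finally show ?thesis .
qed

section \<open>Strong interference for blocks\<close>

text \<open>The order of Koerner and Marton on the channels from the second input, with the first
  input known to the receiver; \<open>V\<close> is the better one.\<close>

definition more_capable :: "('a::finite \<Rightarrow> 'b::finite \<Rightarrow> 'y::finite \<Rightarrow> real) \<Rightarrow> ('a \<Rightarrow> 'b \<Rightarrow> 'z::finite \<Rightarrow> real) \<Rightarrow> bool" where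
  "more_capable V V' \<longleftrightarrow> (\<forall>p1 p2. is_pmf p1 \<and> is_pmf p2 \<longrightarrow> mi1 (flip V') p2 p1 \<le> mi1 (flip V) p2 p1)"

text \<open>A point mass for the first input isolates the channel \<open>V x\<close>. The law of the
  second input is the image of the weights under \<open>g\<close>, normalized by
  \<open>A\<close>.\<close>

lemma ginfo_mi1:
  fixes V :: "'a::finite \<Rightarrow> 'b::finite \<Rightarrow> 'y::finite \<Rightarrow> real"
  assumes "finite U" and A: "(\<Sum>u\<in>U. a u) = A" "A \<noteq> 0"
  shows "ginfo U a (\<lambda>u. V x (g u)) UNIV
    = A * mi1 (flip V) (\<lambda>b. (\<Sum>u\<in>U. a u * of_bool (g u = b)) / A) (\<lambda>c. of_bool (c = x))"
proof -
  define p where "p b = (\<Sum>u\<in>U. a u * of_bool (g u = b)) / A" for b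
  define r where "r y = (\<Sum>b\<in>UNIV. p b * V x b y)" for y
  have push: "(\<Sum>u\<in>U. a u * \<psi> (g u)) = A * (\<Sum>b\<in>UNIV. p b * \<psi> b)" for \<psi>
    unfolding sum_pushforward p_def sum_distrib_left using A by (intro sum.cong) auto
  have "ginfo U a (\<lambda>u. V x (g u)) UNIV
      = (\<Sum>u\<in>U. a u * (\<Sum>y\<in>UNIV. V x (g u) y * log 2 (V x (g u) y / r y)))"
    unfolding ginfo_def A(1) push[of "\<lambda>b. V x b _"] r_def[symmetric] sum_distrib_left
    using A by (intro sum.cong refl) (simp add: divide_simps)
  also have "\<dots> = A * (\<Sum>b\<in>UNIV. p b * (\<Sum>y\<in>UNIV. V x b y * log 2 (V x b y / r y)))"
    by (rule push[of "\<lambda>b. \<Sum>y\<in>UNIV. V x b y * log 2 (V x b y / r y)"])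
  also have "(\<Sum>b\<in>UNIV. p b * (\<Sum>y\<in>UNIV. V x b y * log 2 (V x b y / r y))) = mi1 (flip V) p (\<lambda>c. of_bool (c = x))"
  proof -
    have "(\<Sum>c\<in>UNIV. \<Sum>y\<in>UNIV. p b * of_bool (c = x) * V c b y * log 2 (V c b y / (\<Sum>b'\<in>UNIV. p b' * V c b' y)))
       = (\<Sum>c\<in>UNIV. if c = x then p b * (\<Sum>y\<in>UNIV. V x b y * log 2 (V x b y / r y)) else 0)" for b
      by (intro sum.cong refl) (auto simp: r_def sum_distrib_left mult.assoc)
    then show ?thesis by (simp add: mi1_def flip_def)
  qed
  finally show ?thesis unfolding p_def .
qed

text \<open>The form of the order that tensorizes: it holds for each input letter \<open>x\<close>
  separately, and for unnormalized weights because \<open>ginfo\<close> scales with their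
  total.\<close>

lemma more_capable_ginfo:
  assumes mc: "more_capable V V'" and fin: "finite U" and a0: "\<And>u. 0 \<le> a u"
  shows "ginfo U a (\<lambda>u. V' x (g u)) UNIV \<le> ginfo U a (\<lambda>u. V x (g u)) UNIV"
proof (cases "(\<Sum>u\<in>U. a u) = 0")
  case True
  then have "\<forall>u\<in>U. a u = 0" using fin a0 by (simp add: sum_nonneg_eq_0_iff)
  then show ?thesis by (simp add: ginfo_def)
next
  case False
  define A where "A = (\<Sum>u\<in>U. a u)"
  have A: "0 < A" using False a0 by (simp add: A_def less_le sum_nonneg)
  have "is_pmf (\<lambda>b. (\<Sum>u\<in>U. a u * of_bool (g u = b)) / A)"
    unfolding is_pmf_def
    using sum_pushforward[of a "\<lambda>_. 1" g U] A a0
    by (auto simp: A_def[symmetric] simp flip: sum_divide_distrib intro!: divide_nonneg_nonneg sum_nonneg)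
  moreover have "is_pmf (\<lambda>c. of_bool (c = x) :: real)" by (simp add: is_pmf_def)
  ultimately show ?thesis using mc A
    unfolding ginfo_mi1[OF fin A_def[symmetric] A[THEN less_imp_neq, symmetric]]
    by (auto simp: more_capable_def intro!: mult_left_mono)
qed

text \<open>For a fixed first block the channel from the second input varies with the position; this
  is why \<open>ginfo_seqs_mono\<close> allows a different pair of channels at each
  \<open>j\<close>.\<close>

lemma more_capable_seq:
  assumes mc: "more_capable V V'" and V: "is_kernel V" "is_kernel V'"
    and fin: "finite U" and a0: "\<And>u. 0 \<le> a u"
  shows "ginfo U a (\<lambda>u. seqV n V' x (g u)) (seqs n) \<le> ginfo U a (\<lambda>u. seqV n V x (g u)) (seqs n)"
  unfolding seqV_def
  by (rule ginfo_seqs_mono[where ?N1.0 = "\<lambda>j u. V (x ! j) (g u ! j)" and ?N2.0 = "\<lambda>j u. V' (x ! j) (g u ! j)"])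
     (use fin a0 V more_capable_ginfo[OF mc fin] in \<open>auto simp: is_kernel_def\<close>)

section \<open>Entropy bounds for a given code\<close>

text \<open>The source is given in the factored form \<open>pw w * K1 w s1 * K2 w s2\<close> that
  the Markov chain provides. This form is symmetric in the users, so the locale can be interpreted a
  second time with their roles exchanged.\<close>

locale code =
  fixes pw :: "'w::finite \<Rightarrow> real" and K1 :: "'w \<Rightarrow> 's1::finite \<Rightarrow> real" and K2 :: "'w \<Rightarrow> 's2::finite \<Rightarrow> real"
    and m n :: nat and f1 :: "'s1 list \<Rightarrow> 'x1::finite list" and f2 :: "'s2 list \<Rightarrow> 'x2::finite list"
  assumes pw0: "\<And>w. 0 \<le> pw w" and pw1: "(\<Sum>w\<in>UNIV. pw w) = 1"
    and K10: "\<And>w s. 0 \<le> K1 w s" and K11: "\<And>w. (\<Sum>s\<in>UNIV. K1 w s) = 1"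
    and K20: "\<And>w s. 0 \<le> K2 w s" and K21: "\<And>w. (\<Sum>s\<in>UNIV. K2 w s) = 1"
begin

definition h1 where "h1 = - (\<Sum>w\<in>UNIV. \<Sum>s\<in>UNIV. pw w * K1 w s * log 2 (K1 w s))"
definition h2 where "h2 = - (\<Sum>w\<in>UNIV. \<Sum>s\<in>UNIV. pw w * K2 w s * log 2 (K2 w s))"
definition \<mu> where "\<mu> = seqP m pw"
definition k1 where "k1 = seqK m K1"
definition k2 where "k2 = seqK m K2"
definition pj1 where "pj1 = letter m K1 f1"
definition pj2 where "pj2 = letter m K2 f2"

lemma nonneg: "0 \<le> \<mu> w" "0 \<le> k1 w s1" "0 \<le> k2 w s2"
  unfolding \<mu>_def k1_def k2_def by (intro seqP_nonneg seqK_nonneg pw0 K10 K20)+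

lemma sums: "(\<Sum>w\<in>seqs m. \<mu> w) = 1" "(\<Sum>s1\<in>seqs m. k1 w s1) = 1" "(\<Sum>s2\<in>seqs m. k2 w s2) = 1"
  unfolding \<mu>_def k1_def k2_def by (intro seqP_sum seqK_sum pw1 K11 K21)+

lemma entropies:
  "- (\<Sum>w\<in>seqs m. \<Sum>s1\<in>seqs m. \<mu> w * k1 w s1 * log 2 (k1 w s1)) = m * h1"
  "- (\<Sum>w\<in>seqs m. \<Sum>s2\<in>seqs m. \<mu> w * k2 w s2 * log 2 (k2 w s2)) = m * h2"
  unfolding \<mu>_def k1_def k2_def h1_def h2_def
  by (simp_all add: entropy_seq[OF pw0 pw1 K10 K11] entropy_seq[OF pw0 pw1 K20 K21])

lemma pj_nonneg: "0 \<le> pj1 w j a" "0 \<le> pj2 w j b"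
  unfolding pj1_def pj2_def letter_def by (auto intro!: sum_nonneg mult_nonneg_nonneg seqK_nonneg K10 K20)

lemma pj_pmf: "is_pmf (pj1 w j)" "is_pmf (pj2 w j)"
  unfolding pj1_def pj2_def by (intro letter_pmf K10 K11 K20 K21)+

lemma pj_sum: "(\<Sum>a\<in>UNIV. pj1 w j a) = 1" "(\<Sum>b\<in>UNIV. pj2 w j b) = 1"
  using pj_pmf[of w j] by (auto simp: is_pmf_def)

text \<open>The laws of an output letter given \<open>w\<close>: \<open>out1\<close> if the second
  input letter is known as well, \<open>out12\<close> if neither input is.\<close>

definition out1 where "out1 V w j b y = (\<Sum>a\<in>UNIV. pj1 w j a * V a b y)"
definition out12 where "out12 V w j y = (\<Sum>a\<in>UNIV. \<Sum>b\<in>UNIV. pj1 w j a * pj2 w j b * V a b y)"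

lemma out_nonneg:
  assumes "is_kernel V"
  shows "0 \<le> out1 V w j b y" "0 \<le> out12 V w j y"
  unfolding out1_def out12_def using assms pj_nonneg
  by (auto intro!: sum_nonneg mult_nonneg_nonneg simp: is_kernel_def)

lemma out_sum:
  fixes V :: "'x1 \<Rightarrow> 'x2 \<Rightarrow> 'y::finite \<Rightarrow> real"
  assumes "is_kernel V"
  shows "(\<Sum>y\<in>UNIV. out1 V w j b y) = 1" "(\<Sum>y\<in>UNIV. out12 V w j y) = 1"
proof -
  have V1: "(\<Sum>y\<in>UNIV. V a b y) = 1" for a b using assms by (simp add: is_kernel_def)
  have "(\<Sum>y\<in>UNIV. out1 V w j b y) = (\<Sum>a\<in>UNIV. pj1 w j a * (\<Sum>y\<in>UNIV. V a b y))"
    unfolding out1_def by (subst sum.swap) (simp add: sum_distrib_left)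
  then show "(\<Sum>y\<in>UNIV. out1 V w j b y) = 1" by (simp add: V1 pj_sum)
  have "(\<Sum>y\<in>UNIV. out12 V w j y) = (\<Sum>a\<in>UNIV. \<Sum>y\<in>UNIV. \<Sum>b\<in>UNIV. pj1 w j a * pj2 w j b * V a b y)"
    unfolding out12_def by (rule sum.swap)
  also have "\<dots> = (\<Sum>a\<in>UNIV. \<Sum>b\<in>UNIV. pj1 w j a * pj2 w j b * (\<Sum>y\<in>UNIV. V a b y))"
    by (intro sum.cong refl) (subst sum.swap, simp add: sum_distrib_left)
  finally show "(\<Sum>y\<in>UNIV. out12 V w j y) = 1" by (simp add: V1 pj_sum flip: sum_distrib_left)
qed

lemma out_pos:
  assumes V: "is_kernel V" and s: "s1 \<in> seqs m" "s2 \<in> seqs m" and pos: "0 < k1 w s1" "0 < k2 w s2"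
    and "0 < V (f1 s1 ! j) (f2 s2 ! j) y"
  shows "0 < out1 V w j (f2 s2 ! j) y" "0 < out12 V w j y"
proof -
  have V0: "0 \<le> V a b y" for a b y using V by (simp add: is_kernel_def)
  let ?a = "f1 s1 ! j" and ?b = "f2 s2 ! j"
  have p: "0 < pj1 w j ?a" "0 < pj2 w j ?b"
    unfolding pj1_def pj2_def using s pos by (auto simp: k1_def k2_def intro!: letter_pos K10 K20)
  have "pj1 w j ?a * V ?a ?b y \<le> out1 V w j ?b y" unfolding out1_def
    by (rule member_le_sum[of ?a UNIV "\<lambda>a. pj1 w j a * V a ?b y"]) (use pj_nonneg V0 in auto)
  then show "0 < out1 V w j ?b y" using p assms(6) by (smt (verit) mult_pos_pos)
  have "pj1 w j ?a * pj2 w j ?b * V ?a ?b y \<le> (\<Sum>b\<in>UNIV. pj1 w j ?a * pj2 w j b * V ?a b y)"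
    by (rule member_le_sum[of ?b UNIV "\<lambda>b. pj1 w j ?a * pj2 w j b * V ?a b y"]) (use pj_nonneg V0 in auto)
  also have "\<dots> \<le> out12 V w j y" unfolding out12_def
    by (rule member_le_sum[of ?a UNIV "\<lambda>a. \<Sum>b\<in>UNIV. pj1 w j a * pj2 w j b * V a b y"])
       (use pj_nonneg V0 in \<open>auto intro!: sum_nonneg\<close>)
  finally show "0 < out12 V w j y" using p assms(6) by (smt (verit) mult_pos_pos)
qed

text \<open>\<open>D\<close> is \<open>out1\<close> in the single-user bound and
  \<open>out12\<close>, which ignores \<open>b\<close>, in the sum bound. Against a product law the
  log density of a memoryless channel is a sum over positions, so \<open>sum_letters\<close>
  applies. The second claim is the positivity that \<open>output_entropy_bound\<close> asks
  for.\<close>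

lemma expected_density:
  fixes V :: "'x1 \<Rightarrow> 'x2 \<Rightarrow> 'y::finite \<Rightarrow> real" and D :: "'w list \<Rightarrow> nat \<Rightarrow> 'x2 \<Rightarrow> 'y \<Rightarrow> real"
  assumes V: "is_kernel V"
    and D: "\<And>w s1 s2 j y. s1 \<in> seqs m \<Longrightarrow> s2 \<in> seqs m \<Longrightarrow> 0 < k1 w s1 \<Longrightarrow> 0 < k2 w s2
      \<Longrightarrow> 0 < V (f1 s1 ! j) (f2 s2 ! j) y \<Longrightarrow> 0 < D w j (f2 s2 ! j) y"
  shows "(\<Sum>w\<in>seqs m. \<Sum>s1\<in>seqs m. \<Sum>s2\<in>seqs m. \<Sum>y\<in>seqs n. \<mu> w * k1 w s1 * k2 w s2 * seqV n V (f1 s1) (f2 s2) y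
      * log 2 (seqV n V (f1 s1) (f2 s2) y / (\<Prod>j<n. D w j (f2 s2 ! j) (y ! j))))
    = (\<Sum>w\<in>seqs m. \<mu> w * (\<Sum>j<n. \<Sum>a\<in>UNIV. \<Sum>b\<in>UNIV. \<Sum>y\<in>UNIV.
        pj1 w j a * pj2 w j b * V a b y * log 2 (V a b y / D w j b y)))" (is ?expectation)
    and "s1 \<in> seqs m \<Longrightarrow> s2 \<in> seqs m \<Longrightarrow> 0 < k1 w s1 \<Longrightarrow> 0 < k2 w s2 \<Longrightarrow> 0 < seqV n V (f1 s1) (f2 s2) y
      \<Longrightarrow> 0 < (\<Prod>j<n. D w j (f2 s2 ! j) (y ! j))"
proof -
  have Vp: "0 < V (f1 s1 ! j) (f2 s2 ! j) (y ! j)" if "0 < seqV n V (f1 s1) (f2 s2) y" "j < n" for s1 s2 y j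
    by (rule prod_pos_imp_pos[of "\<lambda>j. V (f1 s1 ! j) (f2 s2 ! j) (y ! j)" n])
       (use V that in \<open>auto simp: is_kernel_def seqV_def\<close>)
  show "0 < (\<Prod>j<n. D w j (f2 s2 ! j) (y ! j))" if "s1 \<in> seqs m" "s2 \<in> seqs m" "0 < k1 w s1" "0 < k2 w s2"
      "0 < seqV n V (f1 s1) (f2 s2) y" for s1 s2 w y
    using D[OF that(1-4) Vp[OF that(5)]] by (auto intro!: prod_pos)
  have d: "k1 w s1 * k2 w s2 * seqV n V (f1 s1) (f2 s2) y
        * log 2 (seqV n V (f1 s1) (f2 s2) y / (\<Prod>j<n. D w j (f2 s2 ! j) (y ! j)))
     = k1 w s1 * k2 w s2 * seqV n V (f1 s1) (f2 s2) y
        * (\<Sum>j<n. log 2 (V (f1 s1 ! j) (f2 s2 ! j) (y ! j) / D w j (f2 s2 ! j) (y ! j)))"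
    if s: "s1 \<in> seqs m" "s2 \<in> seqs m" for w s1 s2 y
  proof (cases "k1 w s1 * k2 w s2 * seqV n V (f1 s1) (f2 s2) y = 0")
    case False
    then have pos: "0 < k1 w s1" "0 < k2 w s2" "0 < seqV n V (f1 s1) (f2 s2) y"
      using nonneg(2)[of w s1] nonneg(3)[of w s2] seqV_nonneg[OF V, of n "f1 s1" "f2 s2" y] by (auto simp: less_le)
    have "log 2 (seqV n V (f1 s1) (f2 s2) y / (\<Prod>j<n. D w j (f2 s2 ! j) (y ! j)))
      = (\<Sum>j<n. log 2 (V (f1 s1 ! j) (f2 s2 ! j) (y ! j) / D w j (f2 s2 ! j) (y ! j)))"
      unfolding seqV_def prod_dividef[symmetric]
      using Vp[OF pos(3)] D[OF s pos(1,2) Vp[OF pos(3)]] by (intro log_prod_sum) auto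
    then show ?thesis by (simp only:)
  qed (simp only: mult_zero_left)
  show ?expectation
  proof (intro sum.cong refl)
    fix w :: "'w list"
    have "(\<Sum>s1\<in>seqs m. \<Sum>s2\<in>seqs m. \<Sum>y\<in>seqs n. \<mu> w * k1 w s1 * k2 w s2 * seqV n V (f1 s1) (f2 s2) y
      * log 2 (seqV n V (f1 s1) (f2 s2) y / (\<Prod>j<n. D w j (f2 s2 ! j) (y ! j))))
      = \<mu> w * (\<Sum>s1\<in>seqs m. \<Sum>s2\<in>seqs m. \<Sum>y\<in>seqs n. k1 w s1 * k2 w s2 * seqV n V (f1 s1) (f2 s2) y
        * (\<Sum>j<n. log 2 (V (f1 s1 ! j) (f2 s2 ! j) (y ! j) / D w j (f2 s2 ! j) (y ! j))))"
      unfolding sum_distrib_left[of "\<mu> w"] by (intro sum.cong refl) (simp add: d[unfolded mult.assoc] mult.assoc)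
    then show "(\<Sum>s1\<in>seqs m. \<Sum>s2\<in>seqs m. \<Sum>y\<in>seqs n. \<mu> w * k1 w s1 * k2 w s2 * seqV n V (f1 s1) (f2 s2) y
      * log 2 (seqV n V (f1 s1) (f2 s2) y / (\<Prod>j<n. D w j (f2 s2 ! j) (y ! j)))) = \<mu> w * (\<Sum>j<n.
        \<Sum>a\<in>UNIV. \<Sum>b\<in>UNIV. \<Sum>y\<in>UNIV. pj1 w j a * pj2 w j b * V a b y * log 2 (V a b y / D w j b y))"
      unfolding k1_def k2_def unfolding sum_letters[OF V, where \<phi> = "\<lambda>j a b y. log 2 (V a b y / D w j b y)"]
      unfolding pj1_def pj2_def .
  qed
qed

text \<open>The loss in \<open>fano\<close> for an alphabet of \<open>c ^ m\<close> blocks.\<close>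

definition fano_term :: "real \<Rightarrow> real \<Rightarrow> nat \<Rightarrow> real" where
  "fano_term \<epsilon> \<delta> c = - log 2 (1 - \<delta>) + \<epsilon> * (m * log 2 c - log 2 \<delta>)"

lemma seqs_prod_sum:
  "(\<Sum>c\<in>seqs m \<times> seqs m. \<Sum>s\<in>S. F (fst c) (snd c) s) = (\<Sum>w\<in>seqs m. \<Sum>s\<in>S. \<Sum>t\<in>seqs m. F w t s)"
  for F :: "'w list \<Rightarrow> 't::finite list \<Rightarrow> 's \<Rightarrow> real"
  unfolding sum.cartesian_product' fst_conv snd_conv by (intro sum.cong refl sum.swap)

lemma seqs_prod_one: "(\<Sum>c\<in>seqs m \<times> seqs m. \<mu> (fst c) * k2 (fst c) (snd c)) = 1"
    "(\<Sum>c\<in>seqs m \<times> seqs m. \<mu> (fst c) * k1 (fst c) (snd c)) = 1"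
  unfolding sum.cartesian_product' fst_conv snd_conv sum_distrib_left[symmetric] by (simp_all add: sums)

text \<open>The context of \<open>fano\<close> is \<open>(w, s2)\<close>: with the second source
  revealed, user 1 faces a single-user channel, and the decoder ignores the gift. The product of the
  laws \<open>out1\<close> then reduces the block to its letters.\<close>

lemma single_user_bound:
  fixes V :: "'x1 \<Rightarrow> 'x2 \<Rightarrow> 'y::finite \<Rightarrow> real" and g :: "'y list \<Rightarrow> 'w list \<Rightarrow> 's1 list"
  assumes V: "is_kernel V" and \<delta>: "0 < \<delta>" "\<delta> < 1"
    and err: "(\<Sum>w\<in>seqs m. \<Sum>s1\<in>seqs m. \<Sum>s2\<in>seqs m. \<Sum>y\<in>seqs n. \<mu> w * k1 w s1 * k2 w s2
       * seqV n V (f1 s1) (f2 s2) y * of_bool (g y w \<noteq> s1)) \<le> \<epsilon>"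
  shows "m * h1 \<le> (\<Sum>w\<in>seqs m. \<mu> w * (\<Sum>j<n. mi1 V (pj1 w j) (pj2 w j))) + fano_term \<epsilon> \<delta> CARD('s1)"
proof -
  let ?C = "seqs m \<times> seqs m :: ('w list \<times> 's2 list) set"
  let ?\<mu> = "\<lambda>c. \<mu> (fst c) * k2 (fst c) (snd c)"
  let ?k = "\<lambda>c. k1 (fst c)"
  let ?N = "\<lambda>c s1. seqV n V (f1 s1) (f2 (snd c))"
  note out = expected_density[where V = V and D = "out1 V", OF V out_pos(1)[OF V]]
  let ?Q = "\<lambda>c y. \<Prod>j<n. out1 V (fst c) j (f2 (snd c) ! j) (y ! j)"
  have F: "- (\<Sum>c\<in>?C. \<Sum>s\<in>seqs m. ?\<mu> c * ?k c s * log 2 (?k c s))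
    \<le> (\<Sum>c\<in>?C. \<Sum>s\<in>seqs m. \<Sum>y\<in>seqs n. ?\<mu> c * ?k c s * ?N c s y * log 2 (?N c s y / (\<Sum>s'\<in>seqs m. ?k c s' * ?N c s' y)))
      - log 2 (1 - \<delta>) + \<epsilon> * (log 2 (card (seqs m :: 's1 list set)) - log 2 \<delta>)"
  proof (rule fano[where g = "\<lambda>c y. g y (fst c)"])
    show "(\<Sum>c\<in>?C. \<Sum>s\<in>seqs m. \<Sum>y\<in>seqs n. ?\<mu> c * ?k c s * ?N c s y * of_bool (g y (fst c) \<noteq> s)) \<le> \<epsilon>"
      unfolding seqs_prod_sum[where F = "\<lambda>w s2 s1. \<Sum>y\<in>seqs n. \<mu> w * k2 w s2 * k1 w s1 * seqV n V (f1 s1) (f2 s2) y * of_bool (g y w \<noteq> s1)"]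
      using err by (simp add: mult_ac)
  qed (use \<delta> in \<open>auto simp: seqs_nonempty nonneg seqV_nonneg[OF V] sums seqV_sum[OF V] seqs_prod_one\<close>)
  have "(\<Sum>c\<in>?C. \<Sum>s\<in>seqs m. ?\<mu> c * ?k c s * log 2 (?k c s))
     = (\<Sum>w\<in>seqs m. \<Sum>s1\<in>seqs m. (\<mu> w * k1 w s1 * log 2 (k1 w s1)) * (\<Sum>s2\<in>seqs m. k2 w s2))"
    unfolding seqs_prod_sum[where F = "\<lambda>w s2 s1. \<mu> w * k2 w s2 * k1 w s1 * log 2 (k1 w s1)"] sum_distrib_left
    by (simp add: mult_ac)
  then have L: "- (\<Sum>c\<in>?C. \<Sum>s\<in>seqs m. ?\<mu> c * ?k c s * log 2 (?k c s)) = m * h1"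
    by (simp add: sums entropies)
  have "(\<Sum>c\<in>?C. \<Sum>s\<in>seqs m. \<Sum>y\<in>seqs n. ?\<mu> c * ?k c s * ?N c s y * log 2 (?N c s y / (\<Sum>s'\<in>seqs m. ?k c s' * ?N c s' y)))
    \<le> (\<Sum>c\<in>?C. \<Sum>s\<in>seqs m. \<Sum>y\<in>seqs n. ?\<mu> c * ?k c s * ?N c s y * log 2 (?N c s y / ?Q c y))"
  proof (rule output_entropy_bound)
    show "0 < ?Q c y" if "c \<in> ?C" "s \<in> seqs m" "y \<in> seqs n" "0 < ?\<mu> c * ?k c s * ?N c s y" for c s y
    proof -
      have "?k c s \<noteq> 0" "k2 (fst c) (snd c) \<noteq> 0" "?N c s y \<noteq> 0" using that(4) by auto
      then have "0 < ?k c s" "0 < k2 (fst c) (snd c)" "0 < ?N c s y"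
        using nonneg(2)[of "fst c" s] nonneg(3)[of "fst c" "snd c"] seqV_nonneg[OF V, of n "f1 s" "f2 (snd c)" y] by auto
      then show ?thesis by (intro out(2)) (use that in auto)
    qed
    show "(\<Sum>y\<in>seqs n. ?Q c y) \<le> 1" for c
      by (simp add: sum_seqs_prod[of "\<lambda>j. out1 V (fst c) j (f2 (snd c) ! j)"] out_sum(1)[OF V])
    show "0 \<le> ?Q c y" for c y by (intro prod_nonneg ballI out_nonneg V)
  qed (auto simp: nonneg seqV_nonneg[OF V] sums seqV_sum[OF V])
  also have "\<dots> = (\<Sum>w\<in>seqs m. \<Sum>s1\<in>seqs m. \<Sum>s2\<in>seqs m. \<Sum>y\<in>seqs n. \<mu> w * k1 w s1 * k2 w s2 * seqV n V (f1 s1) (f2 s2) y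
      * log 2 (seqV n V (f1 s1) (f2 s2) y / (\<Prod>j<n. out1 V w j (f2 s2 ! j) (y ! j))))"
    unfolding sum.cartesian_product' fst_conv snd_conv
    by (rule sum.cong[OF refl], subst sum.swap) (simp add: mult_ac)
  also have "\<dots> = (\<Sum>w\<in>seqs m. \<mu> w * (\<Sum>j<n. mi1 V (pj1 w j) (pj2 w j)))"
    unfolding mi1_def out1_def[symmetric] by (rule out(1))
  finally show ?thesis using F unfolding L
    by (simp add: fano_term_def card_seqs log_nat_power)
qed

text \<open>The chain is \<open>I(S1;Y|W) + I(S2;Z|S1,W) \<le> I(S1;Y|W) + I(S2;Y|S1,W) =
  I(S1,S2;Y|W)\<close>: once \<open>s1\<close> is known, \<open>Y\<close> tells at least as much
  about \<open>s2\<close> as \<open>Z\<close>, although only the receiver of \<open>Z\<close> is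
  required to decode \<open>s2\<close>.\<close>

lemma sum_rate_bound:
  fixes V :: "'x1 \<Rightarrow> 'x2 \<Rightarrow> 'y::finite \<Rightarrow> real" and V' :: "'x1 \<Rightarrow> 'x2 \<Rightarrow> 'z::finite \<Rightarrow> real"
    and g :: "'y list \<Rightarrow> 'w list \<Rightarrow> 's1 list" and g' :: "'z list \<Rightarrow> 'w list \<Rightarrow> 's2 list"
  assumes V: "is_kernel V" "is_kernel V'" and mc: "more_capable V V'" and \<delta>: "0 < \<delta>" "\<delta> < 1"
    and err: "(\<Sum>w\<in>seqs m. \<Sum>s1\<in>seqs m. \<Sum>s2\<in>seqs m. \<Sum>y\<in>seqs n. \<mu> w * k1 w s1 * k2 w s2
       * seqV n V (f1 s1) (f2 s2) y * of_bool (g y w \<noteq> s1)) \<le> \<epsilon>"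
    and err': "(\<Sum>w\<in>seqs m. \<Sum>s1\<in>seqs m. \<Sum>s2\<in>seqs m. \<Sum>z\<in>seqs n. \<mu> w * k1 w s1 * k2 w s2
       * seqV n V' (f1 s1) (f2 s2) z * of_bool (g' z w \<noteq> s2)) \<le> \<epsilon>"
  shows "m * (h1 + h2) \<le> (\<Sum>w\<in>seqs m. \<mu> w * (\<Sum>j<n. mi12 V (pj1 w j) (pj2 w j)))
     + fano_term \<epsilon> \<delta> CARD('s1) + fano_term \<epsilon> \<delta> CARD('s2)"
proof -
  note out = expected_density[where V = V and D = "\<lambda>w j b. out12 V w j", OF V(1) out_pos(2)[OF V(1)]]
  define N where "N s1 s2 y = seqV n V (f1 s1) (f2 s2) y" for s1 s2 y
  define R2 where "R2 w s1 y = (\<Sum>s2\<in>seqs m. k2 w s2 * N s1 s2 y)" for w s1 y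
  define R0 where "R0 w y = (\<Sum>s1\<in>seqs m. k1 w s1 * R2 w s1 y)" for w y
  have N0: "0 \<le> N s1 s2 y" and N1: "(\<Sum>y\<in>seqs n. N s1 s2 y) = 1" for s1 s2 y
    by (simp_all add: N_def seqV_nonneg[OF V(1)] seqV_sum[OF V(1)])
  have R20: "0 \<le> R2 w s1 y" for w s1 y
    unfolding R2_def by (intro sum_nonneg mult_nonneg_nonneg nonneg N0)
  have R21: "(\<Sum>y\<in>seqs n. R2 w s1 y) = 1" for w s1
    unfolding R2_def by (subst sum.swap) (simp add: N1 sums flip: sum_distrib_left)
  have ex: "(\<Sum>y\<in>seqs n. \<mu> w * k1 w s1 * R2 w s1 y * h y)
      = (\<Sum>s2\<in>seqs m. \<Sum>y\<in>seqs n. \<mu> w * k1 w s1 * k2 w s2 * N s1 s2 y * h y)" for w s1 h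
    unfolding R2_def sum_distrib_left sum_distrib_right by (subst sum.swap) (simp add: mult_ac)
  let ?E = "\<lambda>h. \<Sum>w\<in>seqs m. \<Sum>s1\<in>seqs m. \<Sum>s2\<in>seqs m. \<Sum>y\<in>seqs n. \<mu> w * k1 w s1 * k2 w s2 * N s1 s2 y * h w s1 s2 y"

  \<comment> \<open>In this part the codeword of user 2 acts as noise, so the channel from
    \<open>s1\<close> is the average \<open>R2\<close>.\<close>
  have "- (\<Sum>w\<in>seqs m. \<Sum>s\<in>seqs m. \<mu> w * k1 w s * log 2 (k1 w s))
    \<le> (\<Sum>w\<in>seqs m. \<Sum>s\<in>seqs m. \<Sum>y\<in>seqs n. \<mu> w * k1 w s * R2 w s y * log 2 (R2 w s y / (\<Sum>s'\<in>seqs m. k1 w s' * R2 w s' y)))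
      - log 2 (1 - \<delta>) + \<epsilon> * (log 2 (card (seqs m :: 's1 list set)) - log 2 \<delta>)"
  proof (rule fano[where g = "\<lambda>w y. g y w"])
    show "(\<Sum>w\<in>seqs m. \<Sum>s\<in>seqs m. \<Sum>y\<in>seqs n. \<mu> w * k1 w s * R2 w s y * of_bool (g y w \<noteq> s)) \<le> \<epsilon>"
      unfolding ex using err by (simp add: N_def)
  qed (use \<delta> in \<open>auto simp: seqs_nonempty nonneg sums R20 R21\<close>)
  then have T1: "m * h1 \<le> ?E (\<lambda>w s1 s2 y. log 2 (R2 w s1 y / R0 w y)) + fano_term \<epsilon> \<delta> CARD('s1)"
    unfolding entropies ex R0_def[symmetric] by (simp add: fano_term_def card_seqs log_nat_power)

  \<comment> \<open>Context \<open>(w, s1)\<close>: the first source is revealed to the other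
    receiver, whose decoder \<open>g'\<close> does not look at it.\<close>
  let ?C = "seqs m \<times> seqs m :: ('w list \<times> 's1 list) set"
  let ?\<mu> = "\<lambda>c. \<mu> (fst c) * k1 (fst c) (snd c)"
  let ?k = "\<lambda>c. k2 (fst c)"
  let ?N = "\<lambda>c s2. seqV n V' (f1 (snd c)) (f2 s2)"
  have F: "- (\<Sum>c\<in>?C. \<Sum>s\<in>seqs m. ?\<mu> c * ?k c s * log 2 (?k c s))
    \<le> (\<Sum>c\<in>?C. \<Sum>s\<in>seqs m. \<Sum>y\<in>seqs n. ?\<mu> c * ?k c s * ?N c s y * log 2 (?N c s y / (\<Sum>s'\<in>seqs m. ?k c s' * ?N c s' y)))
      - log 2 (1 - \<delta>) + \<epsilon> * (log 2 (card (seqs m :: 's2 list set)) - log 2 \<delta>)"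
  proof (rule fano[where g = "\<lambda>c y. g' y (fst c)"])
    show "(\<Sum>c\<in>?C. \<Sum>s\<in>seqs m. \<Sum>y\<in>seqs n. ?\<mu> c * ?k c s * ?N c s y * of_bool (g' y (fst c) \<noteq> s)) \<le> \<epsilon>"
      unfolding sum.cartesian_product' fst_conv snd_conv using err' .
  qed (use \<delta> in \<open>auto simp: seqs_nonempty nonneg seqV_nonneg[OF V(2)] sums seqV_sum[OF V(2)] seqs_prod_one\<close>)
  have "(\<Sum>c\<in>?C. \<Sum>s\<in>seqs m. ?\<mu> c * ?k c s * log 2 (?k c s))
     = (\<Sum>w\<in>seqs m. \<Sum>s2\<in>seqs m. (\<mu> w * k2 w s2 * log 2 (k2 w s2)) * (\<Sum>s1\<in>seqs m. k1 w s1))"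
    unfolding seqs_prod_sum[where F = "\<lambda>w s1 s2. \<mu> w * k1 w s1 * k2 w s2 * log 2 (k2 w s2)"] sum_distrib_left
    by (simp add: mult_ac)
  then have L: "- (\<Sum>c\<in>?C. \<Sum>s\<in>seqs m. ?\<mu> c * ?k c s * log 2 (?k c s)) = m * h2"
    by (simp add: sums entropies)
  have "(\<Sum>c\<in>?C. \<Sum>s\<in>seqs m. \<Sum>y\<in>seqs n. ?\<mu> c * ?k c s * ?N c s y * log 2 (?N c s y / (\<Sum>s'\<in>seqs m. ?k c s' * ?N c s' y)))
     = (\<Sum>w\<in>seqs m. \<Sum>s1\<in>seqs m. \<mu> w * k1 w s1 * ginfo (seqs m) (k2 w) (\<lambda>s2. seqV n V' (f1 s1) (f2 s2)) (seqs n))"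
    unfolding sum.cartesian_product' fst_conv snd_conv ginfo_def sums sum_distrib_left by (simp add: mult_ac)
  also have "\<dots> \<le> (\<Sum>w\<in>seqs m. \<Sum>s1\<in>seqs m. \<mu> w * k1 w s1 * ginfo (seqs m) (k2 w) (\<lambda>s2. seqV n V (f1 s1) (f2 s2)) (seqs n))"
    by (intro sum_mono mult_left_mono more_capable_seq[OF mc V] mult_nonneg_nonneg nonneg finite_seqs)
  also have "\<dots> = ?E (\<lambda>w s1 s2 y. log 2 (N s1 s2 y / R2 w s1 y))"
    unfolding ginfo_def sums sum_distrib_left N_def R2_def by (simp add: mult_ac)
  finally have T2: "m * h2 \<le> ?E (\<lambda>w s1 s2 y. log 2 (N s1 s2 y / R2 w s1 y)) + fano_term \<epsilon> \<delta> CARD('s2)"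
    using F unfolding L by (simp add: fano_term_def card_seqs log_nat_power)

  \<comment> \<open>The chain rule: the intermediate output law \<open>R2\<close> cancels.\<close>
  have "?E (\<lambda>w s1 s2 y. log 2 (R2 w s1 y / R0 w y)) + ?E (\<lambda>w s1 s2 y. log 2 (N s1 s2 y / R2 w s1 y))
     = ?E (\<lambda>w s1 s2 y. log 2 (N s1 s2 y / R0 w y))"
    unfolding sum.distrib[symmetric]
  proof (intro sum.cong refl)
    fix w and s1 :: "'s1 list" and s2 :: "'s2 list" and y assume *: "s1 \<in> seqs m" "s2 \<in> seqs m"
    show "\<mu> w * k1 w s1 * k2 w s2 * N s1 s2 y * log 2 (R2 w s1 y / R0 w y)
       + \<mu> w * k1 w s1 * k2 w s2 * N s1 s2 y * log 2 (N s1 s2 y / R2 w s1 y)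
       = \<mu> w * k1 w s1 * k2 w s2 * N s1 s2 y * log 2 (N s1 s2 y / R0 w y)"
    proof (cases "\<mu> w * k1 w s1 * k2 w s2 * N s1 s2 y = 0")
      case False
      then have pos: "0 < k1 w s1" "0 < k2 w s2" "0 < N s1 s2 y"
        using nonneg(2)[of w s1] nonneg(3)[of w s2] N0[of s1 s2 y] by (auto simp: less_le)
      have "k2 w s2 * N s1 s2 y \<le> R2 w s1 y" unfolding R2_def
        by (rule member_le_sum[of s2 "seqs m" "\<lambda>s2. k2 w s2 * N s1 s2 y"]) (use * nonneg N0 in auto)
      then have R2p: "0 < R2 w s1 y" using mult_pos_pos[OF pos(2,3)] by linarith
      have "k1 w s1 * R2 w s1 y \<le> R0 w y" unfolding R0_def
        by (rule member_le_sum[of s1 "seqs m" "\<lambda>s1. k1 w s1 * R2 w s1 y"]) (use * nonneg R20 in auto)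
      then have "0 < R0 w y" using mult_pos_pos[OF pos(1) R2p] by linarith
      then show ?thesis using pos R2p by (simp add: log_divide_pos algebra_simps)
    qed (simp only: mult_zero_left add_0_left)
  qed
  also have "\<dots> = (\<Sum>w\<in>seqs m. \<Sum>s\<in>seqs m \<times> seqs m. \<Sum>y\<in>seqs n. \<mu> w * (k1 w (fst s) * k2 w (snd s)) * N (fst s) (snd s) y
      * log 2 (N (fst s) (snd s) y / (\<Sum>s'\<in>seqs m \<times> seqs m. k1 w (fst s') * k2 w (snd s') * N (fst s') (snd s') y)))"
    unfolding sum.cartesian_product' fst_conv snd_conv R0_def R2_def sum_distrib_left by (simp add: mult_ac)
  also have "\<dots> \<le> (\<Sum>w\<in>seqs m. \<Sum>s\<in>seqs m \<times> seqs m. \<Sum>y\<in>seqs n. \<mu> w * (k1 w (fst s) * k2 w (snd s)) * N (fst s) (snd s) y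
      * log 2 (N (fst s) (snd s) y / (\<Prod>j<n. out12 V w j (y ! j))))"
  proof (rule output_entropy_bound)
    show "0 < (\<Prod>j<n. out12 V w j (y ! j))" if "s \<in> seqs m \<times> seqs m"
      "0 < \<mu> w * (k1 w (fst s) * k2 w (snd s)) * N (fst s) (snd s) y" for w s y
    proof -
      have "k1 w (fst s) \<noteq> 0" "k2 w (snd s) \<noteq> 0" "N (fst s) (snd s) y \<noteq> 0" using that(2) by auto
      then have "0 < k1 w (fst s)" "0 < k2 w (snd s)" "0 < N (fst s) (snd s) y"
        using nonneg(2)[of w "fst s"] nonneg(3)[of w "snd s"] N0[of "fst s" "snd s" y] by auto
      then show ?thesis by (intro out(2)) (use that in \<open>auto simp: N_def\<close>)
    qed
    show "(\<Sum>y\<in>seqs n. \<Prod>j<n. out12 V w j (y ! j)) \<le> 1" for w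
      by (simp add: sum_seqs_prod[of "out12 V w"] out_sum(2)[OF V(1)])
    show "0 \<le> (\<Prod>j<n. out12 V w j (y ! j))" for w and y :: "'y list" by (intro prod_nonneg ballI out_nonneg V)
    show "(\<Sum>s\<in>seqs m \<times> seqs m. k1 w (fst s) * k2 w (snd s)) = 1" for w
      unfolding sum.cartesian_product' fst_conv snd_conv sum_distrib_left[symmetric] by (simp add: sums)
  qed (auto simp: nonneg N0 N1)
  also have "\<dots> = ?E (\<lambda>w s1 s2 y. log 2 (N s1 s2 y / (\<Prod>j<n. out12 V w j (y ! j))))"
    unfolding sum.cartesian_product' fst_conv snd_conv by (simp add: mult_ac)
  also have "\<dots> = (\<Sum>w\<in>seqs m. \<mu> w * (\<Sum>j<n. mi12 V (pj1 w j) (pj2 w j)))"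
    unfolding N_def mi12_def out12_def[symmetric] by (rule out(1))
  finally show ?thesis using T1 T2 by (simp add: algebra_simps)
qed

end

section \<open>Errors of the two receivers and the factored source\<close>

abbreviation chan1 :: "('x1 \<Rightarrow> 'x2 \<Rightarrow> 'y1::finite \<Rightarrow> 'y2::finite \<Rightarrow> real) \<Rightarrow> 'x1 \<Rightarrow> 'x2 \<Rightarrow> 'y1 \<Rightarrow> real" where
  "chan1 \<equiv> marg (\<lambda>y1 y2. y1)"

abbreviation chan2 :: "('x1 \<Rightarrow> 'x2 \<Rightarrow> 'y1::finite \<Rightarrow> 'y2::finite \<Rightarrow> real) \<Rightarrow> 'x1 \<Rightarrow> 'x2 \<Rightarrow> 'y2 \<Rightarrow> real" where
  "chan2 \<equiv> marg (\<lambda>y1 y2. y2)"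

text \<open>A receiver meets only its marginal of the channel, which is again memoryless; the
  dependence between the two outputs is invisible to the error of one receiver.\<close>

lemma ch_prob_marg:
  fixes Ch :: "'x1 \<Rightarrow> 'x2 \<Rightarrow> 'y1::finite \<Rightarrow> 'y2::finite \<Rightarrow> real"
  shows "(\<Sum>y2\<in>seqs n. ch_prob Ch n x1 x2 y1 y2) = seqV n (chan1 Ch) x1 x2 y1"
    and "(\<Sum>y1\<in>seqs n. ch_prob Ch n x1 x2 y1 y2) = seqV n (chan2 Ch) x1 x2 y2"
proof -
  have c1: "(\<Sum>b\<in>UNIV. Ch x1 x2 a b) = chan1 Ch x1 x2 a" for x1 x2 a
    unfolding marg_def sum_if_const by simp
  have c2: "(\<Sum>a\<in>UNIV. Ch x1 x2 a b) = chan2 Ch x1 x2 b" for x1 x2 b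
    unfolding marg_def by simp
  show "(\<Sum>y2\<in>seqs n. ch_prob Ch n x1 x2 y1 y2) = seqV n (chan1 Ch) x1 x2 y1"
    unfolding ch_prob_def seqV_def by (simp add: sum_seqs_prod[of "\<lambda>j. Ch (x1 ! j) (x2 ! j) (y1 ! j)"] c1)
  show "(\<Sum>y1\<in>seqs n. ch_prob Ch n x1 x2 y1 y2) = seqV n (chan2 Ch) x1 x2 y2"
    unfolding ch_prob_def seqV_def by (simp add: sum_seqs_prod[of "\<lambda>j y. Ch (x1 ! j) (x2 ! j) y (y2 ! j)"] c2)
qed

lemma src_prob_nonneg: "valid_source P \<Longrightarrow> 0 \<le> src_prob P m s1 s2 w"
  unfolding src_prob_def valid_source_def by (intro prod_nonneg) auto

lemma ch_prob_nonneg: "valid_channel Ch \<Longrightarrow> 0 \<le> ch_prob Ch n x1 x2 y1 y2"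
  unfolding ch_prob_def valid_channel_def by (intro prod_nonneg) auto

text \<open>The event is a parameter because the converse counts errors in the receiver's own
  source, while random coding counts errors in the pair.\<close>

definition recv_err where
  "recv_err P V m n f1 f2 bad = (\<Sum>s1\<in>seqs m. \<Sum>s2\<in>seqs m. \<Sum>w\<in>seqs m. \<Sum>y\<in>seqs n.
     src_prob P m s1 s2 w * seqV n V (f1 s1) (f2 s2) y * of_bool (bad s1 s2 w y))"

lemma recv_err_chan:
  fixes P :: "'s1::finite \<Rightarrow> 's2::finite \<Rightarrow> 'w::finite \<Rightarrow> real"
    and Ch :: "'x1::finite \<Rightarrow> 'x2::finite \<Rightarrow> 'y1::finite \<Rightarrow> 'y2::finite \<Rightarrow> real"
  shows "recv_err P (chan1 Ch) m n f1 f2 bad = (\<Sum>s1\<in>seqs m. \<Sum>s2\<in>seqs m. \<Sum>w\<in>seqs m. \<Sum>y1\<in>seqs n. \<Sum>y2\<in>seqs n.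
     src_prob P m s1 s2 w * ch_prob Ch n (f1 s1) (f2 s2) y1 y2 * of_bool (bad s1 s2 w y1))"
    and "recv_err P (chan2 Ch) m n f1 f2 bad' = (\<Sum>s1\<in>seqs m. \<Sum>s2\<in>seqs m. \<Sum>w\<in>seqs m. \<Sum>y1\<in>seqs n. \<Sum>y2\<in>seqs n.
     src_prob P m s1 s2 w * ch_prob Ch n (f1 s1) (f2 s2) y1 y2 * of_bool (bad' s1 s2 w y2))"
proof -
  show "recv_err P (chan1 Ch) m n f1 f2 bad = (\<Sum>s1\<in>seqs m. \<Sum>s2\<in>seqs m. \<Sum>w\<in>seqs m. \<Sum>y1\<in>seqs n. \<Sum>y2\<in>seqs n.
     src_prob P m s1 s2 w * ch_prob Ch n (f1 s1) (f2 s2) y1 y2 * of_bool (bad s1 s2 w y1))"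
    unfolding recv_err_def ch_prob_marg[symmetric] sum_distrib_left sum_distrib_right ..
  have "recv_err P (chan2 Ch) m n f1 f2 bad' = (\<Sum>s1\<in>seqs m. \<Sum>s2\<in>seqs m. \<Sum>w\<in>seqs m. \<Sum>y2\<in>seqs n. \<Sum>y1\<in>seqs n.
     src_prob P m s1 s2 w * ch_prob Ch n (f1 s1) (f2 s2) y1 y2 * of_bool (bad' s1 s2 w y2))"
    unfolding recv_err_def ch_prob_marg[symmetric] sum_distrib_left sum_distrib_right ..
  also have "\<dots> = (\<Sum>s1\<in>seqs m. \<Sum>s2\<in>seqs m. \<Sum>w\<in>seqs m. \<Sum>y1\<in>seqs n. \<Sum>y2\<in>seqs n.
     src_prob P m s1 s2 w * ch_prob Ch n (f1 s1) (f2 s2) y1 y2 * of_bool (bad' s1 s2 w y2))"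
    by (intro sum.cong refl sum.swap)
  finally show "recv_err P (chan2 Ch) m n f1 f2 bad' = \<dots>" .
qed

lemma recv_err_le_err_prob:
  fixes P :: "'s1::finite \<Rightarrow> 's2::finite \<Rightarrow> 'w::finite \<Rightarrow> real"
    and Ch :: "'x1::finite \<Rightarrow> 'x2::finite \<Rightarrow> 'y1::finite \<Rightarrow> 'y2::finite \<Rightarrow> real"
  assumes "valid_source P" "valid_channel Ch"
  shows "recv_err P (chan1 Ch) m n f1 f2 (\<lambda>s1 s2 w y. g1 y w \<noteq> s1) \<le> err_prob P Ch m n f1 f2 g1 g2"
    and "recv_err P (chan2 Ch) m n f1 f2 (\<lambda>s1 s2 w y. g2 y w \<noteq> s2) \<le> err_prob P Ch m n f1 f2 g1 g2"
  unfolding recv_err_chan err_prob_def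
  by (intro sum_mono mult_left_mono mult_nonneg_nonneg src_prob_nonneg ch_prob_nonneg assms; simp)+

lemma err_prob_le_recv_err:
  fixes P :: "'s1::finite \<Rightarrow> 's2::finite \<Rightarrow> 'w::finite \<Rightarrow> real"
    and Ch :: "'x1::finite \<Rightarrow> 'x2::finite \<Rightarrow> 'y1::finite \<Rightarrow> 'y2::finite \<Rightarrow> real"
  assumes "valid_source P" "valid_channel Ch"
  shows "err_prob P Ch m n f1 f2 g1 g2 \<le> recv_err P (chan1 Ch) m n f1 f2 (\<lambda>s1 s2 w y. g1 y w \<noteq> s1)
     + recv_err P (chan2 Ch) m n f1 f2 (\<lambda>s1 s2 w y. g2 y w \<noteq> s2)"
  unfolding recv_err_chan err_prob_def sum.distrib[symmetric] distrib_left[symmetric]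
  by (intro sum_mono mult_left_mono mult_nonneg_nonneg src_prob_nonneg ch_prob_nonneg assms; simp)

definition side_pmf :: "('s1::finite \<Rightarrow> 's2::finite \<Rightarrow> 'w \<Rightarrow> real) \<Rightarrow> 'w \<Rightarrow> real" where
  "side_pmf P w = (\<Sum>a\<in>UNIV. \<Sum>c\<in>UNIV. P a c w)"

lemma side_pmf_nonneg: "valid_source P \<Longrightarrow> 0 \<le> side_pmf P w"
  unfolding side_pmf_def valid_source_def by (auto intro!: sum_nonneg)

lemma side_pmf_sum:
  fixes P :: "'s1::finite \<Rightarrow> 's2::finite \<Rightarrow> 'w::finite \<Rightarrow> real"
  assumes "valid_source P"
  shows "(\<Sum>w\<in>UNIV. side_pmf P w) = 1"
proof -
  have "(\<Sum>w\<in>UNIV. side_pmf P w) = (\<Sum>a\<in>UNIV. \<Sum>w\<in>UNIV. \<Sum>c\<in>UNIV. P a c w)"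
    unfolding side_pmf_def by (rule sum.swap)
  also have "\<dots> = (\<Sum>a\<in>UNIV. \<Sum>c\<in>UNIV. \<Sum>w\<in>UNIV. P a c w)" by (intro sum.cong refl sum.swap)
  finally show ?thesis using assms by (simp add: valid_source_def)
qed

text \<open>This is where the Markov chain enters. For a \<open>w\<close> of probability zero both
  sides vanish, whatever the default value of \<open>condK\<close>.\<close>

lemma source_factor:
  assumes "valid_source P" "markov_S1_W_S2 P"
  shows "P s1 s2 w = side_pmf P w * condK P w s1 * condK (\<lambda>s2 s1. P s1 s2) w s2"
proof -
  have sw: "(\<Sum>a\<in>UNIV. \<Sum>c\<in>UNIV. P c a w) = side_pmf P w"
    unfolding side_pmf_def by (rule sum.swap)
  have m: "P s1 s2 w * side_pmf P w = (\<Sum>c\<in>UNIV. P s1 c w) * (\<Sum>a\<in>UNIV. P a s2 w)"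
    using assms(2) by (simp add: markov_S1_W_S2_def side_pmf_def)
  show ?thesis
  proof (cases "side_pmf P w = 0")
    case True
    then have "P s1 s2 w \<le> 0"
      using source_le_marginals(1)[OF assms(1), of s1 s2 w] source_le_marginals(2)[OF assms(1), of s1 w]
      by (simp add: side_pmf_def)
    moreover have "0 \<le> P s1 s2 w" using assms by (simp add: valid_source_def)
    ultimately show ?thesis using True by simp
  next
    case False
    then show ?thesis using m by (simp add: condK_def sw side_pmf_def[symmetric] field_simps)
  qed
qed

lemma src_prob_factor:
  assumes "valid_source P" "markov_S1_W_S2 P"
  shows "src_prob P m s1 s2 w
    = seqP m (side_pmf P) w * seqK m (condK P) w s1 * seqK m (condK (\<lambda>s2 s1. P s1 s2)) w s2"
proof -
  have "src_prob P m s1 s2 w = (\<Prod>i<m. side_pmf P (w ! i) * condK P (w ! i) (s1 ! i)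
      * condK (\<lambda>s2 s1. P s1 s2) (w ! i) (s2 ! i))"
    unfolding src_prob_def by (intro prod.cong refl source_factor[OF assms])
  then show ?thesis by (simp only: seqP_def seqK_def prod.distrib)
qed

lemma H_S1_W_code:
  fixes P :: "'s1::finite \<Rightarrow> 's2::finite \<Rightarrow> 'w::finite \<Rightarrow> real"
  assumes "valid_source P"
  shows "H_S1_W P = - (\<Sum>w\<in>UNIV. \<Sum>s\<in>UNIV. side_pmf P w * condK P w s * log 2 (condK P w s))"
proof -
  have e: "(\<Sum>c\<in>UNIV. P s c w) = side_pmf P w * condK P w s" for s w
  proof (cases "side_pmf P w = 0")
    case True
    then have "(\<Sum>c\<in>UNIV. P s c w) \<le> 0"
      using source_le_marginals(2)[OF assms(1), of s w] by (simp add: side_pmf_def)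
    moreover have "0 \<le> (\<Sum>c\<in>UNIV. P s c w)" using assms by (auto simp: valid_source_def intro: sum_nonneg)
    ultimately show ?thesis using True by simp
  qed (simp add: condK_def side_pmf_def)
  have "(\<Sum>s\<in>UNIV. \<Sum>c\<in>UNIV. \<Sum>w\<in>UNIV. P s c w * log 2 (condK P w s))
      = (\<Sum>s\<in>UNIV. \<Sum>w\<in>UNIV. \<Sum>c\<in>UNIV. P s c w * log 2 (condK P w s))"
    by (intro sum.cong refl sum.swap)
  also have "\<dots> = (\<Sum>w\<in>UNIV. \<Sum>s\<in>UNIV. \<Sum>c\<in>UNIV. P s c w * log 2 (condK P w s))" by (rule sum.swap)
  finally show ?thesis unfolding H_S1_W_eq[OF assms] by (simp add: e flip: sum_distrib_right)
qed

lemma side_pmf_flip: "side_pmf (\<lambda>s2 s1. P s1 s2) = side_pmf P"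
  unfolding side_pmf_def by (rule ext, rule sum.swap)

text \<open>The second inequality of strong interference makes receiver 1 the better one for the
  second input, and the first inequality makes receiver 2 the better one for the first input;
  \<open>flip\<close> gives the latter the same form.\<close>

lemma strong_interference_more_capable:
  assumes "valid_channel Ch" "strong_interference Ch"
  shows "more_capable (chan1 Ch) (chan2 Ch)" "more_capable (flip (chan2 Ch)) (flip (chan1 Ch))"
proof -
  have ff: "flip (flip V) = V" for V :: "'p \<Rightarrow> 'q \<Rightarrow> 'r" by (simp add: flip_def fun_eq_iff)
  note cm = cond_mi_prod_joint[OF assms(1), where \<pi> = "\<lambda>y1 y2. y1"] cond_mi_prod_joint[OF assms(1), where \<pi> = "\<lambda>y1 y2. y2"]
  show "more_capable (chan1 Ch) (chan2 Ch)" "more_capable (flip (chan2 Ch)) (flip (chan1 Ch))"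
    using assms(2) unfolding strong_interference_def more_capable_def ff by (auto simp: cm)
qed

section \<open>Vanishing loss and the region of a code\<close>

text \<open>A bound per source letter on one Fano term or on the sum of two, with
  \<open>\<delta> = \<epsilon>\<close>; the factor 2 pays for the constants of the second
  term.\<close>

definition fano_loss :: "nat \<Rightarrow> nat \<Rightarrow> real \<Rightarrow> real" where
  "fano_loss c c' \<epsilon> = 2 * (- log 2 (1 - \<epsilon>) + \<epsilon> * (log 2 c + log 2 c') - \<epsilon> * log 2 \<epsilon>)"

lemma fano_loss_small:
  assumes "0 < \<tau>"
  shows "\<exists>\<epsilon>. 0 < \<epsilon> \<and> \<epsilon> < 1 \<and> fano_loss c c' \<epsilon> < \<tau>"
proof -
  have x: "((\<lambda>x::real. x * log 2 x) \<longlongrightarrow> 0) (at_right 0)"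
    using continuous_on_xlogx unfolding continuous_on_def by (auto simp: at_within_Ici_at_right dest: bspec[of _ _ 0])
  have "((\<lambda>\<epsilon>. fano_loss c c' \<epsilon>) \<longlongrightarrow> 2 * (- log 2 (1 - 0) + 0 * (log 2 c + log 2 c') - 0)) (at_right 0)"
    unfolding fano_loss_def by (intro tendsto_intros x) auto
  then have "\<forall>\<^sub>F \<epsilon> in at_right 0. fano_loss c c' \<epsilon> < \<tau>"
    using assms by (auto dest: order_tendstoD(2))
  moreover have "\<forall>\<^sub>F \<epsilon> in at_right (0::real). 0 < \<epsilon> \<and> \<epsilon> < 1"
    by (intro eventually_at_rightI[of 0 1]) auto
  ultimately have "\<forall>\<^sub>F \<epsilon> in at_right 0. fano_loss c c' \<epsilon> < \<tau> \<and> 0 < \<epsilon> \<and> \<epsilon> < 1" by (rule eventually_conj)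
  then show ?thesis using eventually_happens[of _ "at_right (0::real)"] by fastforce
qed

text \<open>Since \<open>m\<close> is at least 1, the constants are at most \<open>m\<close> times
  themselves. The loss per letter is thus controlled by the error alone, for every block
  length.\<close>

lemma (in code) fano_term_le:
  assumes "0 < m" "0 < \<epsilon>" "\<epsilon> < 1" "0 < c" "0 < c'"
  shows "fano_term \<epsilon> \<epsilon> c \<le> m * fano_loss c c' \<epsilon>"
    and "fano_term \<epsilon> \<epsilon> c + fano_term \<epsilon> \<epsilon> c' \<le> m * fano_loss c c' \<epsilon>"
proof -
  define A B C C' where "A = - log 2 (1 - \<epsilon>)" and "B = - (\<epsilon> * log 2 \<epsilon>)"
    and "C = \<epsilon> * log 2 c" and "C' = \<epsilon> * log 2 c'"
  have l: "0 \<le> A" "0 \<le> B" "0 \<le> C" "0 \<le> C'"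
    using assms unfolding A_def B_def C_def C'_def by (auto simp: mult_le_0_iff)
  have m: "1 \<le> real m" using assms by simp
  have a: "A \<le> m * A" "B \<le> m * B" using mult_right_mono[OF m l(1)] mult_right_mono[OF m l(2)] by auto
  have b: "0 \<le> m * A" "0 \<le> m * B" "0 \<le> m * C" "0 \<le> m * C'" using l by simp_all
  have f: "fano_term \<epsilon> \<epsilon> c = A + m * C + B" "fano_term \<epsilon> \<epsilon> c' = A + m * C' + B"
    unfolding fano_term_def A_def B_def C_def C'_def by (simp_all add: algebra_simps)
  have g: "m * fano_loss c c' \<epsilon> = 2 * (m * A) + 2 * (m * C) + 2 * (m * C') + 2 * (m * B)"
    unfolding fano_loss_def A_def B_def C_def C'_def by (simp add: algebra_simps)
  show "fano_term \<epsilon> \<epsilon> c \<le> m * fano_loss c c' \<epsilon>"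
    "fano_term \<epsilon> \<epsilon> c + fano_term \<epsilon> \<epsilon> c' \<le> m * fano_loss c c' \<epsilon>"
    unfolding f g using a b by (smt (verit))+
qed

lemma code_recv_err:
  fixes P :: "'s1::finite \<Rightarrow> 's2::finite \<Rightarrow> 'w::finite \<Rightarrow> real"
  assumes "valid_source P" "markov_S1_W_S2 P"
  shows "(\<Sum>w\<in>seqs m. \<Sum>s1\<in>seqs m. \<Sum>s2\<in>seqs m. \<Sum>y\<in>seqs n. seqP m (side_pmf P) w * seqK m (condK P) w s1
      * seqK m (condK (\<lambda>s2 s1. P s1 s2)) w s2 * seqV n V (f1 s1) (f2 s2) y * of_bool (bad s1 s2 w y))
    = recv_err P V m n f1 f2 bad"
proof -
  let ?F = "\<lambda>s1 s2 w. \<Sum>y\<in>seqs n. seqP m (side_pmf P) w * seqK m (condK P) w s1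
      * seqK m (condK (\<lambda>s2 s1. P s1 s2)) w s2 * seqV n V (f1 s1) (f2 s2) y * of_bool (bad s1 s2 w y)"
  have "(\<Sum>w\<in>seqs m. \<Sum>s1\<in>seqs m. \<Sum>s2\<in>seqs m. ?F s1 s2 w) = (\<Sum>s1\<in>seqs m. \<Sum>w\<in>seqs m. \<Sum>s2\<in>seqs m. ?F s1 s2 w)"
    by (rule sum.swap)
  also have "\<dots> = (\<Sum>s1\<in>seqs m. \<Sum>s2\<in>seqs m. \<Sum>w\<in>seqs m. ?F s1 s2 w)"
    by (intro sum.cong refl sum.swap)
  finally show ?thesis unfolding recv_err_def src_prob_factor[OF assms] .
qed

definition region_point :: "('x1::finite \<Rightarrow> 'x2::finite \<Rightarrow> 'y1::finite \<Rightarrow> 'y2::finite \<Rightarrow> real)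
    \<Rightarrow> (real ^ 'x1) \<times> (real ^ 'x2) \<Rightarrow> real \<times> real \<times> real \<times> real" where
  "region_point Ch z =
     (mi1 (chan1 Ch) (\<lambda>i. fst z $ i) (\<lambda>i. snd z $ i), mi1 (flip (chan2 Ch)) (\<lambda>i. snd z $ i) (\<lambda>i. fst z $ i),
      mi12 (chan1 Ch) (\<lambda>i. fst z $ i) (\<lambda>i. snd z $ i), mi12 (chan2 Ch) (\<lambda>i. fst z $ i) (\<lambda>i. snd z $ i))"

lemma compact_region_points:
  assumes "valid_channel Ch"
  shows "compact (region_point Ch ` (pmfs \<times> pmfs))"
proof (rule compact_continuous_image)
  have k: "is_kernel (chan1 Ch)" "is_kernel (chan2 Ch)" "is_kernel (flip (chan2 Ch))"
    using assms by (simp_all add: is_kernel_marg is_kernel_flip)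
  show "continuous_on (pmfs \<times> pmfs) (region_point Ch)"
    unfolding region_point_def
    by (intro continuous_on_Pair continuous_on_mi1 continuous_on_mi12 k
        continuous_on_swap_pmfs[where f = "\<lambda>u v. mi1 (flip (chan2 Ch)) (\<lambda>i. u $ i) (\<lambda>i. v $ i)"])
  show "compact (pmfs \<times> pmfs :: ((real ^ _) \<times> (real ^ _)) set)"
    by (intro compact_Times compact_pmfs)
qed

text \<open>The point of the hull depends on the code, and hence on \<epsilon>. The loss does not
  depend on the block lengths, and this makes the limit in \<open>converse\<close> possible.\<close>

lemma code_region_point:
  fixes P :: "'s1::finite \<Rightarrow> 's2::finite \<Rightarrow> 'w::finite \<Rightarrow> real"
    and Ch :: "'x1::finite \<Rightarrow> 'x2::finite \<Rightarrow> 'y1::finite \<Rightarrow> 'y2::finite \<Rightarrow> real"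
  assumes P: "valid_source P" "markov_S1_W_S2 P" and Ch: "valid_channel Ch" "strong_interference Ch"
    and mn: "0 < m" "0 < n" and \<epsilon>: "0 < \<epsilon>" "\<epsilon> < 1"
    and err: "err_prob P Ch m n f1 f2 g1 g2 \<le> \<epsilon>"
  defines "\<tau> \<equiv> fano_loss CARD('s1) CARD('s2) \<epsilon>" and "b \<equiv> real n / real m"
  shows "\<exists>v\<in>convex hull (region_point Ch ` (pmfs \<times> pmfs)). H_S1_W P \<le> b * fst v + \<tau> \<and> H_S2_W P \<le> b * fst (snd v) + \<tau>
      \<and> H_S1_W P + H_S2_W P \<le> b * fst (snd (snd v)) + \<tau> \<and> H_S1_W P + H_S2_W P \<le> b * snd (snd (snd v)) + \<tau>"
proof -
  let ?P' = "\<lambda>s2 s1. P s1 s2"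
  have P': "valid_source ?P'" using P(1) by (rule valid_source_flip)
  have "code (side_pmf P) (condK P) (condK ?P')"
    by unfold_locales (simp_all add: side_pmf_nonneg side_pmf_sum condK_nonneg condK_sum P P')
  then interpret A: code "side_pmf P" "condK P" "condK ?P'" m n f1 f2 .
  \<comment> \<open>The second instance, with the users exchanged, yields the bound on
    \<open>H_S2_W P\<close> and the sum bound at receiver 2.\<close>
  have "code (side_pmf P) (condK ?P') (condK P)"
    by unfold_locales (simp_all add: side_pmf_nonneg side_pmf_sum condK_nonneg condK_sum P P')
  then interpret B: code "side_pmf P" "condK ?P'" "condK P" m n f2 f1 .
  have k: "is_kernel (chan1 Ch)" "is_kernel (chan2 Ch)" "is_kernel (flip (chan1 Ch))" "is_kernel (flip (chan2 Ch))"
    using Ch by (simp_all add: is_kernel_marg is_kernel_flip)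
  have sw: "A.h2 = H_S2_W P" "A.h1 = H_S1_W P" "B.h1 = H_S2_W P" "B.h2 = H_S1_W P"
    unfolding A.h1_def A.h2_def B.h1_def B.h2_def H_S2_W_flip H_S1_W_code[OF P(1)] H_S1_W_code[OF P'] side_pmf_flip[of P] by auto
  have e1: "(\<Sum>w\<in>seqs m. \<Sum>s1\<in>seqs m. \<Sum>s2\<in>seqs m. \<Sum>y\<in>seqs n. A.\<mu> w * A.k1 w s1 * A.k2 w s2
       * seqV n (chan1 Ch) (f1 s1) (f2 s2) y * of_bool (g1 y w \<noteq> s1)) \<le> \<epsilon>"
    and e2: "(\<Sum>w\<in>seqs m. \<Sum>s1\<in>seqs m. \<Sum>s2\<in>seqs m. \<Sum>y\<in>seqs n. A.\<mu> w * A.k1 w s1 * A.k2 w s2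
       * seqV n (chan2 Ch) (f1 s1) (f2 s2) y * of_bool (g2 y w \<noteq> s2)) \<le> \<epsilon>"
    unfolding A.\<mu>_def A.k1_def A.k2_def code_recv_err[OF P]
    using recv_err_le_err_prob[OF P(1) Ch(1), of m n f1 f2] err by (meson order_trans)+
  have "(\<Sum>w\<in>seqs m. \<Sum>s2\<in>seqs m. \<Sum>s1\<in>seqs m. \<Sum>y\<in>seqs n. B.\<mu> w * B.k1 w s2 * B.k2 w s1
       * seqV n (flip (chan1 Ch)) (f2 s2) (f1 s1) y * of_bool (g1 y w \<noteq> s1))
     = (\<Sum>w\<in>seqs m. \<Sum>s1\<in>seqs m. \<Sum>s2\<in>seqs m. \<Sum>y\<in>seqs n. A.\<mu> w * A.k1 w s1 * A.k2 w s2
       * seqV n (chan1 Ch) (f1 s1) (f2 s2) y * of_bool (g1 y w \<noteq> s1))"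
    unfolding A.\<mu>_def A.k1_def A.k2_def B.\<mu>_def B.k1_def B.k2_def seqV_flip
    by (intro sum.cong refl) (subst sum.swap, simp only: mult_ac)
  note e1' = order_trans[OF eq_refl[OF this] e1]
  have "(\<Sum>w\<in>seqs m. \<Sum>s2\<in>seqs m. \<Sum>s1\<in>seqs m. \<Sum>y\<in>seqs n. B.\<mu> w * B.k1 w s2 * B.k2 w s1
       * seqV n (flip (chan2 Ch)) (f2 s2) (f1 s1) y * of_bool (g2 y w \<noteq> s2))
     = (\<Sum>w\<in>seqs m. \<Sum>s1\<in>seqs m. \<Sum>s2\<in>seqs m. \<Sum>y\<in>seqs n. A.\<mu> w * A.k1 w s1 * A.k2 w s2
       * seqV n (chan2 Ch) (f1 s1) (f2 s2) y * of_bool (g2 y w \<noteq> s2))"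
    unfolding A.\<mu>_def A.k1_def A.k2_def B.\<mu>_def B.k1_def B.k2_def seqV_flip
    by (intro sum.cong refl) (subst sum.swap, simp only: mult_ac)
  note e2' = order_trans[OF eq_refl[OF this] e2]
  have pj: "B.pj1 = A.pj2" "B.pj2 = A.pj1"
    by (simp_all add: A.pj1_def A.pj2_def B.pj1_def B.pj2_def)
  define avg where "avg \<phi> = (\<Sum>w\<in>seqs m. A.\<mu> w * (\<Sum>j<n. \<phi> (A.pj1 w j) (A.pj2 w j)))" for \<phi> :: "_ \<Rightarrow> _ \<Rightarrow> real"
  have b1: "m * H_S1_W P \<le> avg (mi1 (chan1 Ch)) + A.fano_term \<epsilon> \<epsilon> CARD('s1)"
    using A.single_user_bound[OF k(1) \<epsilon> e1] unfolding sw avg_def .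
  have b2: "m * H_S2_W P \<le> avg (\<lambda>p1 p2. mi1 (flip (chan2 Ch)) p2 p1) + B.fano_term \<epsilon> \<epsilon> CARD('s2)"
    using B.single_user_bound[OF k(4) \<epsilon> e2'] unfolding sw avg_def pj .
  have b3: "m * (H_S1_W P + H_S2_W P) \<le> avg (mi12 (chan1 Ch)) + A.fano_term \<epsilon> \<epsilon> CARD('s1) + A.fano_term \<epsilon> \<epsilon> CARD('s2)"
    using A.sum_rate_bound[OF k(1,2) strong_interference_more_capable(1)[OF Ch] \<epsilon> e1 e2] unfolding sw avg_def .
  have b4: "m * (H_S2_W P + H_S1_W P) \<le> avg (mi12 (chan2 Ch)) + B.fano_term \<epsilon> \<epsilon> CARD('s2) + B.fano_term \<epsilon> \<epsilon> CARD('s1)"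
    using B.sum_rate_bound[OF k(4,3) strong_interference_more_capable(2)[OF Ch] \<epsilon>
       e2' e1'] unfolding sw avg_def pj mi12_flip .
  define y where "y i = region_point Ch (\<chi> a. A.pj1 (fst i) (snd i) a, \<chi> c. A.pj2 (fst i) (snd i) c)" for i
  \<comment> \<open>The weights of the time-sharing variable: \<open>w\<close> has its own law and
    the position is uniform and independent of \<open>w\<close>.\<close>
  define v where "v = (\<Sum>i\<in>seqs m \<times> {..<n}. (A.\<mu> (fst i) / n) *\<^sub>R y i)"
  have vl: "($) (vec_lambda f) = f" for f :: "'z::finite \<Rightarrow> real" by (simp add: fun_eq_iff)
  have vhull: "v \<in> convex hull (region_point Ch ` (pmfs \<times> pmfs))" unfolding v_def
  proof (rule convex_sum)
    show "(\<Sum>i\<in>seqs m \<times> {..<n}. A.\<mu> (fst i) / n) = 1"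
      unfolding sum.cartesian_product' fst_conv using mn by (simp add: A.sums)
    show "y i \<in> convex hull (region_point Ch ` (pmfs \<times> pmfs))" for i
      unfolding y_def by (intro hull_inc imageI) (simp add: pmfs_def vl A.pj_pmf)
  qed (simp_all add: A.nonneg convex_convex_hull)
  have coord: "(\<Sum>i\<in>seqs m \<times> {..<n}. (A.\<mu> (fst i) / n) * \<phi> (A.pj1 (fst i) (snd i)) (A.pj2 (fst i) (snd i))) = avg \<phi> / n" for \<phi>
    unfolding sum.cartesian_product' fst_conv snd_conv avg_def
    by (simp only: times_divide_eq_left sum_divide_distrib sum_distrib_left)
  have c: "fst v = avg (mi1 (chan1 Ch)) / n" "fst (snd v) = avg (\<lambda>p1 p2. mi1 (flip (chan2 Ch)) p2 p1) / n"
    "fst (snd (snd v)) = avg (mi12 (chan1 Ch)) / n" "snd (snd (snd v)) = avg (mi12 (chan2 Ch)) / n"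
    unfolding coord[symmetric] v_def fst_sum snd_sum fst_scaleR snd_scaleR y_def region_point_def fst_conv snd_conv vl real_scaleR_def
    by (rule refl)+
  \<comment> \<open>Division by \<open>m\<close>. The factor \<open>n\<close> comes from averaging
    over the positions, so that \<open>n / m = b\<close> appears.\<close>
  have fin: "h \<le> b * (a / n) + \<tau>" if "m * h \<le> a + t" "t \<le> m * \<tau>" for h a t :: real
  proof -
    have "m * (a / m + \<tau>) = a + m * \<tau>" using mn by (simp add: distrib_left)
    then have "m * h \<le> m * (a / m + \<tau>)" using that by linarith
    then have "h \<le> a / m + \<tau>" using mn by (subst (asm) mult_le_cancel_left_pos) auto
    also have "a / m = b * (a / n)" using mn by (simp add: b_def)
    finally show ?thesis .
  qed
  have cs: "0 < CARD('s1)" "0 < CARD('s2)" by simp_all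
  have comm: "fano_loss CARD('s2) CARD('s1) \<epsilon> = \<tau>" by (simp add: \<tau>_def fano_loss_def add.commute)
  note le = A.fano_term_le[OF mn(1) \<epsilon> cs, folded \<tau>_def] A.fano_term_le[OF mn(1) \<epsilon> cs(2,1), unfolded comm]
  have "H_S1_W P \<le> b * fst v + \<tau>" unfolding c by (rule fin[OF b1 le(1)])
  moreover have "H_S2_W P \<le> b * fst (snd v) + \<tau>" unfolding c by (rule fin[OF b2 le(3)])
  moreover have "H_S1_W P + H_S2_W P \<le> b * fst (snd (snd v)) + \<tau>"
    unfolding c by (rule fin[OF b3[unfolded add.assoc] le(2)])
  moreover have "H_S1_W P + H_S2_W P \<le> b * snd (snd (snd v)) + \<tau>"
    unfolding c add.commute[of "H_S1_W P"] by (rule fin[OF b4[unfolded add.assoc] le(4)])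
  ultimately show ?thesis using vhull by blast
qed

text \<open>Every tolerance is met by some code of the same rate \<open>b\<close>, whose hull point
  satisfies the inequalities up to that tolerance; \<open>four_point_region\<close> takes the
  limit.\<close>

lemma converse:
  fixes P :: "'s1::finite \<Rightarrow> 's2::finite \<Rightarrow> 'w::finite \<Rightarrow> real"
    and Ch :: "'x1::finite \<Rightarrow> 'x2::finite \<Rightarrow> 'y1::finite \<Rightarrow> 'y2::finite \<Rightarrow> real"
  assumes P: "valid_source P" "markov_S1_W_S2 P" and Ch: "valid_channel Ch" "strong_interference Ch"
    and ach: "achievable P Ch b"
  shows "\<exists>pq p1 p2. Q_dist pq p1 p2 \<and> region_conds (\<le>) P Ch b pq p1 p2"
proof -
  have b0: "0 \<le> b"
  proof -
    obtain m n :: nat where "real n / real m = b" using ach unfolding achievable_def by (meson zero_less_one)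
    then show ?thesis by auto
  qed
  have "\<exists>v\<in>convex hull (region_point Ch ` (pmfs \<times> pmfs)). H_S1_W P \<le> b * fst v + \<tau> \<and> H_S2_W P \<le> b * fst (snd v) + \<tau>
      \<and> H_S1_W P + H_S2_W P \<le> b * fst (snd (snd v)) + \<tau> \<and> H_S1_W P + H_S2_W P \<le> b * snd (snd (snd v)) + \<tau>"
    if \<tau>: "0 < \<tau>" for \<tau>
  proof -
    obtain \<epsilon> where \<epsilon>: "0 < \<epsilon>" "\<epsilon> < 1" "fano_loss CARD('s1) CARD('s2) \<epsilon> < \<tau>"
      using fano_loss_small[OF \<tau>] by blast
    obtain m n f1 f2 g1 g2 where c: "0 < m" "0 < n" "real n / real m = b"
        "err_prob P Ch m n f1 f2 g1 g2 < \<epsilon>"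
      using ach \<epsilon>(1) unfolding achievable_def by meson
    obtain v where "v \<in> convex hull (region_point Ch ` (pmfs \<times> pmfs))"
        "H_S1_W P \<le> b * fst v + fano_loss CARD('s1) CARD('s2) \<epsilon>"
        "H_S2_W P \<le> b * fst (snd v) + fano_loss CARD('s1) CARD('s2) \<epsilon>"
        "H_S1_W P + H_S2_W P \<le> b * fst (snd (snd v)) + fano_loss CARD('s1) CARD('s2) \<epsilon>"
        "H_S1_W P + H_S2_W P \<le> b * snd (snd (snd v)) + fano_loss CARD('s1) CARD('s2) \<epsilon>"
      using code_region_point[OF P Ch c(1,2) \<epsilon>(1,2) less_imp_le[OF c(4)]] unfolding c(3) by blast
    then show ?thesis using \<epsilon>(3) by (intro bexI[of _ v]) auto
  qed
  from four_point_region[OF compact_region_points[OF Ch(1)] this b0]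
  obtain pq d where pq: "\<forall>q. 0 \<le> pq q" "(\<Sum>q<4. pq q) = 1" "\<forall>q::nat. d q \<in> pmfs \<times> pmfs"
    and i: "H_S1_W P \<le> b * (\<Sum>q<4. pq q * fst (region_point Ch (d q)))"
      "H_S2_W P \<le> b * (\<Sum>q<4. pq q * fst (snd (region_point Ch (d q))))"
      "H_S1_W P + H_S2_W P \<le> b * (\<Sum>q<4. pq q * fst (snd (snd (region_point Ch (d q)))))"
      "H_S1_W P + H_S2_W P \<le> b * (\<Sum>q<4. pq q * snd (snd (snd (region_point Ch (d q)))))"
    by blast
  define p1 where "p1 q a = fst (d q) $ a" for q a
  define p2 where "p2 q c = snd (d q) $ c" for q c
  have pm: "is_pmf (p1 q)" "is_pmf (p2 q)" for q
    using pq(3)[rule_format, of q] by (auto simp: p1_def[abs_def] p2_def[abs_def] pmfs_def mem_Times_iff)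
  have Q: "Q_dist pq p1 p2" using pq pm by (simp add: Q_dist_def)
  note cm1 = cond_mi_Q_joint[OF Ch(1) Q, where \<pi> = "\<lambda>y1 y2. y1" and out = "out_Y 1"]
  note cm2 = cond_mi_Q_joint[OF Ch(1) Q, where \<pi> = "\<lambda>y1 y2. y2" and out = "out_Y 2"]
  have o1: "out_Y 1 (q', x1', x2', y1', y2') = out_Y 1 (q, x1, x2, y1, y2) \<longleftrightarrow> y1' = y1"
    and o2: "out_Y 2 (q', x1', x2', y1', y2') = out_Y 2 (q, x1, x2, y1, y2) \<longleftrightarrow> y2' = y2"
    for q q' :: nat and x1 x1' :: 'x1 and x2 x2' :: 'x2 and y1 y1' :: 'y1 and y2 y2' :: 'y2
    by (simp_all add: out_Y_def)
  have rp: "region_point Ch (d q) = (mi1 (chan1 Ch) (p1 q) (p2 q), mi1 (flip (chan2 Ch)) (p2 q) (p1 q),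
      mi12 (chan1 Ch) (p1 q) (p2 q), mi12 (chan2 Ch) (p1 q) (p2 q))" for q
    unfolding region_point_def p1_def[abs_def] p2_def[abs_def] ..
  have ff: "flip (flip V) = V" for V :: "'p \<Rightarrow> 'q \<Rightarrow> 'r" by (simp add: flip_def fun_eq_iff)
  \<comment> \<open>The two bounds at the receiver of the other user are not coordinates of the
    region. They follow for each \<open>q\<close> from strong interference, applied to the product
    law of that \<open>q\<close>.\<close>
  have s1: "mi1 (chan1 Ch) (p1 q) (p2 q) \<le> mi1 (chan2 Ch) (p1 q) (p2 q)"
    and s2: "mi1 (flip (chan2 Ch)) (p2 q) (p1 q) \<le> mi1 (flip (chan1 Ch)) (p2 q) (p1 q)" for q
    using strong_interference_more_capable[OF Ch] pm unfolding more_capable_def ff by auto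
  have "b * (\<Sum>q<4. pq q * mi1 (chan1 Ch) (p1 q) (p2 q)) \<le> b * (\<Sum>q<4. pq q * mi1 (chan2 Ch) (p1 q) (p2 q))"
    "b * (\<Sum>q<4. pq q * mi1 (flip (chan2 Ch)) (p2 q) (p1 q)) \<le> b * (\<Sum>q<4. pq q * mi1 (flip (chan1 Ch)) (p2 q) (p1 q))"
    using pq(1) b0 by (intro mult_left_mono sum_mono s1 s2; simp)+
  then have "region_conds (\<le>) P Ch b pq p1 p2"
    unfolding region_conds_def using i by (simp add: cm1[OF o1] cm2[OF o2] rp del: One_nat_def)
  then show ?thesis using Q by blast
qed

section \<open>Random coding\<close>

text \<open>A codebook is a function in \<open>PiE\<close>. These form a finite set, so drawing a
  random codebook is a finite weighted sum.\<close>

lemma sum_PiE_insert: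
  assumes "s \<notin> A"
  shows "(\<Sum>f\<in>PiE (insert s A) (\<lambda>_. B). h f) = (\<Sum>x\<in>B. \<Sum>g\<in>PiE A (\<lambda>_. B). h (g(s := x)))"
proof -
  have "(\<Sum>f\<in>PiE (insert s A) (\<lambda>_. B). h f) = (\<Sum>i\<in>B \<times> PiE A (\<lambda>_. B). h ((\<lambda>(y, g). g(s := y)) i))"
    unfolding PiE_insert_eq by (rule sum.reindex[OF inj_combinator[OF assms], unfolded o_def])
  then show ?thesis by (simp add: sum.cartesian_product case_prod_unfold)
qed

lemma sum_PiE_prod:
  fixes p :: "'x \<Rightarrow> real"
  assumes "finite A" "finite B" "(\<Sum>x\<in>B. p x) = 1"
  shows "(\<Sum>f\<in>PiE A (\<lambda>_. B). \<Prod>s\<in>A. p (f s)) = 1"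
  using prod_sum_PiE[of A "\<lambda>_. B" "\<lambda>_. p"] assms by simp

text \<open>Once the codeword of \<open>s\<close> is split off, the weights of all other codewords
  sum to one.\<close>

lemma random_codeword:
  fixes p :: "'x \<Rightarrow> real"
  assumes "finite A" "finite B" "(\<Sum>x\<in>B. p x) = 1" "s \<in> A"
  shows "(\<Sum>f\<in>PiE A (\<lambda>_. B). (\<Prod>s\<in>A. p (f s)) * \<phi> (f s)) = (\<Sum>x\<in>B. p x * \<phi> x)"
proof -
  define A' where "A' = A - {s}"
  have A: "A = insert s A'" "s \<notin> A'" "finite A'" using assms by (auto simp: A'_def)
  have "(\<Sum>f\<in>PiE A (\<lambda>_. B). (\<Prod>s\<in>A. p (f s)) * \<phi> (f s))
     = (\<Sum>x\<in>B. \<Sum>g\<in>PiE A' (\<lambda>_. B). (p x * \<phi> x) * (\<Prod>s\<in>A'. p (g s)))"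
    unfolding A(1) sum_PiE_insert[OF A(2)]
  proof (intro sum.cong refl)
    fix x g
    have "(\<Prod>s'\<in>A'. p ((g(s := x)) s')) = (\<Prod>s'\<in>A'. p (g s'))" using A by (intro prod.cong) auto
    then show "(\<Prod>s'\<in>insert s A'. p ((g(s := x)) s')) * \<phi> ((g(s := x)) s) = p x * \<phi> x * (\<Prod>s\<in>A'. p (g s))"
      using A by simp
  qed
  also have "\<dots> = (\<Sum>x\<in>B. p x * \<phi> x)"
    unfolding sum_distrib_left[symmetric] sum_PiE_prod[OF A(3) assms(2,3)] by simp
  finally show ?thesis .
qed

text \<open>Distinct messages have independent codewords. Independence of pairs is all that a union
  bound over wrong messages requires.\<close>

lemma random_codeword_pair:
  fixes p :: "'x \<Rightarrow> real"
  assumes "finite A" "finite B" "(\<Sum>x\<in>B. p x) = 1" "s \<in> A" "s' \<in> A" "s \<noteq> s'"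
  shows "(\<Sum>f\<in>PiE A (\<lambda>_. B). (\<Prod>s\<in>A. p (f s)) * \<phi> (f s) (f s')) = (\<Sum>x\<in>B. \<Sum>x'\<in>B. p x * p x' * \<phi> x x')"
proof -
  define A' where "A' = A - {s}"
  have A: "A = insert s A'" "s \<notin> A'" "finite A'" "s' \<in> A'" using assms by (auto simp: A'_def)
  have "(\<Sum>f\<in>PiE A (\<lambda>_. B). (\<Prod>s\<in>A. p (f s)) * \<phi> (f s) (f s'))
     = (\<Sum>x\<in>B. \<Sum>g\<in>PiE A' (\<lambda>_. B). p x * ((\<Prod>s\<in>A'. p (g s)) * \<phi> x (g s')))"
    unfolding A(1) sum_PiE_insert[OF A(2)]
  proof (intro sum.cong refl)
    fix x g
    have "(\<Prod>s'\<in>A'. p ((g(s := x)) s')) = (\<Prod>s'\<in>A'. p (g s'))" using A by (intro prod.cong) auto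
    then show "(\<Prod>s'\<in>insert s A'. p ((g(s := x)) s')) * \<phi> ((g(s := x)) s) ((g(s := x)) s')
        = p x * ((\<Prod>s\<in>A'. p (g s)) * \<phi> x (g s'))"
      using A assms(6) by simp
  qed
  also have "\<dots> = (\<Sum>x\<in>B. p x * (\<Sum>x'\<in>B. p x' * \<phi> x x'))"
    unfolding sum_distrib_left[symmetric] using random_codeword[OF A(3) assms(2,3) A(4)] by simp
  finally show ?thesis by (simp add: sum_distrib_left mult.assoc)
qed

text \<open>The hypothesis on \<open>good\<close> charges a wrong message \<open>z\<close> its prior weight \<open>\<kappa> z\<close>, so the union bound
  costs a factor \<open>\<Sum>\<kappa> \<le> 1\<close> instead of the number of messages.\<close>

lemma false_alarm_bound:
  fixes a :: "'u \<Rightarrow> real" and b :: "'x \<Rightarrow> real" and N :: "'u \<Rightarrow> 'x \<Rightarrow> 'y \<Rightarrow> real" and \<kappa> :: "'z \<Rightarrow> real"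
  assumes a: "\<And>u. 0 \<le> a u" "(\<Sum>u\<in>U. a u) = 1" and b: "\<And>x. 0 \<le> b x" "(\<Sum>x\<in>X. b x) = 1"
    and N: "\<And>u x y. 0 \<le> N u x y" "\<And>u x. u \<in> U \<Longrightarrow> x \<in> X \<Longrightarrow> (\<Sum>y\<in>Y. N u x y) = 1"
    and \<kappa>: "\<And>z. 0 \<le> \<kappa> z" "(\<Sum>z\<in>Z. \<kappa> z) \<le> 1" and "0 < \<tau>"
    and good: "\<And>z u x y. good z u x y \<Longrightarrow> \<tau> * (\<Sum>x'\<in>X. b x' * N u x' y) \<le> N u x y * \<kappa> z"
  shows "(\<Sum>z\<in>Z. \<Sum>u\<in>U. \<Sum>x'\<in>X. \<Sum>x\<in>X. a u * b x' * b x * (\<Sum>y\<in>Y. N u x y * of_bool (good z u x' y))) \<le> 1 / \<tau>"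
proof -
  \<comment> \<open>A change of measure. The output is independent of the wrong codeword
    \<open>x'\<close> given \<open>u\<close>, so it follows the averaged law, and on
    \<open>good\<close> this law is at most \<open>\<kappa> z / \<tau>\<close> times the law under
    \<open>x'\<close>.\<close>
  have inner: "(\<Sum>x\<in>X. a u * b x' * b x * (\<Sum>y\<in>Y. N u x y * of_bool (good z u x' y))) \<le> a u * b x' * (\<kappa> z / \<tau>)"
    if "u \<in> U" "x' \<in> X" for z u x'
  proof -
    have "(\<Sum>x\<in>X. a u * b x' * b x * (\<Sum>y\<in>Y. N u x y * of_bool (good z u x' y)))
       = a u * b x' * (\<Sum>y\<in>Y. (\<Sum>x\<in>X. b x * N u x y) * of_bool (good z u x' y))"
      unfolding sum_distrib_left sum_distrib_right by (subst sum.swap) (simp add: mult_ac)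
    also have "\<dots> \<le> a u * b x' * (\<Sum>y\<in>Y. N u x' y * (\<kappa> z / \<tau>))"
    proof (intro mult_left_mono sum_mono mult_nonneg_nonneg a b)
      fix y
      show "(\<Sum>x\<in>X. b x * N u x y) * of_bool (good z u x' y) \<le> N u x' y * (\<kappa> z / \<tau>)"
        using good[of z u x' y] \<open>0 < \<tau>\<close> N(1)[of u x' y] \<kappa>(1)[of z]
        by (cases "good z u x' y") (auto simp: field_simps)
    qed
    also have "\<dots> = a u * b x' * (\<kappa> z / \<tau>)" unfolding sum_distrib_right[symmetric] N(2)[OF that] by simp
    finally show ?thesis .
  qed
  have "(\<Sum>z\<in>Z. \<Sum>u\<in>U. \<Sum>x'\<in>X. \<Sum>x\<in>X. a u * b x' * b x * (\<Sum>y\<in>Y. N u x y * of_bool (good z u x' y)))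
    \<le> (\<Sum>z\<in>Z. \<Sum>u\<in>U. \<Sum>x'\<in>X. a u * b x' * (\<kappa> z / \<tau>))"
    by (intro sum_mono inner)
  also have "\<dots> = (\<Sum>z\<in>Z. \<kappa> z / \<tau>)"
    unfolding sum_distrib_right[symmetric] sum_distrib_left[symmetric] b(2) by (simp add: a(2) flip: sum_distrib_right)
  also have "\<dots> \<le> 1 / \<tau>" using \<kappa>(2) \<open>0 < \<tau>\<close> by (simp add: divide_right_mono flip: sum_divide_distrib)
  finally show ?thesis .
qed

text \<open>Derandomization: extracts a fixed choice from a bound on the ensemble mean.\<close>

lemma ex_le_weighted_average:
  fixes w :: "'i \<Rightarrow> real"
  assumes "finite I" "\<And>i. i \<in> I \<Longrightarrow> 0 \<le> w i" "(\<Sum>i\<in>I. w i) = 1" "(\<Sum>i\<in>I. w i * e i) \<le> B"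
  shows "\<exists>i\<in>I. e i \<le> B"
proof (rule ccontr)
  assume "\<not> ?thesis"
  then have gt: "\<And>i. i \<in> I \<Longrightarrow> B < e i" by force
  obtain i where i: "i \<in> I" "0 < w i"
  proof (rule ccontr)
    assume "\<not> thesis"
    then have "\<And>i. i \<in> I \<Longrightarrow> w i = 0" using assms(2) that by force
    then have "(\<Sum>i\<in>I. w i) = 0" by simp
    with assms(3) show False by simp
  qed
  have "(\<Sum>i\<in>I. w i * B) < (\<Sum>i\<in>I. w i * e i)"
  proof (rule sum_strict_mono_ex1)
    show "\<forall>i\<in>I. w i * B \<le> w i * e i" by (intro ballI mult_left_mono less_imp_le[OF gt] assms(2))
    show "\<exists>i\<in>I. w i * B < w i * e i" using i gt by (intro bexI[of _ i]) auto
  qed (use assms in auto)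
  then show False using assms(3,4) by (simp flip: sum_distrib_right)
qed

section \<open>A single use of a multiple access channel\<close>

text \<open>Blocks will be the letters of this channel, for fixed \<open>q\<close> and
  \<open>w\<close>. The weights \<open>k1\<close> and \<open>k2\<close> only shape the decoder's
  test; the bounds hold for every fixed message pair, whatever the joint law of the messages
  is.\<close>

locale one_shot =
  fixes S1 :: "'s1 set" and S2 :: "'s2 set" and X1 :: "'x1 set" and X2 :: "'x2 set" and Y :: "'y set"
    and p1 :: "'x1 \<Rightarrow> real" and p2 :: "'x2 \<Rightarrow> real" and V :: "'x1 \<Rightarrow> 'x2 \<Rightarrow> 'y \<Rightarrow> real"
    and k1 :: "'s1 \<Rightarrow> real" and k2 :: "'s2 \<Rightarrow> real" and \<tau> :: real
  assumes fin: "finite S1" "finite S2" "finite X1" "finite X2" "finite Y"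
    and p1: "\<And>x. 0 \<le> p1 x" "(\<Sum>x\<in>X1. p1 x) = 1" and p2: "\<And>x. 0 \<le> p2 x" "(\<Sum>x\<in>X2. p2 x) = 1"
    and V: "\<And>x1 x2 y. 0 \<le> V x1 x2 y" "\<And>x1 x2. x1 \<in> X1 \<Longrightarrow> x2 \<in> X2 \<Longrightarrow> (\<Sum>y\<in>Y. V x1 x2 y) = 1"
    and k1: "\<And>s. 0 \<le> k1 s" "(\<Sum>s\<in>S1. k1 s) = 1" and k2: "\<And>s. 0 \<le> k2 s" "(\<Sum>s\<in>S2. k2 s) = 1"
    and \<tau>: "0 < \<tau>"
begin

text \<open>One condition for each way in which a competing pair can be wrong: in the first source
  only, in the second only, or in both.\<close>

definition good where
  "good s1 s2 x1 x2 y \<longleftrightarrow>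
     \<tau> * (\<Sum>a\<in>X1. p1 a * V a x2 y) < V x1 x2 y * k1 s1 \<and>
     \<tau> * (\<Sum>c\<in>X2. p2 c * V x1 c y) < V x1 x2 y * k2 s2 \<and>
     \<tau> * (\<Sum>a\<in>X1. \<Sum>c\<in>X2. p1 a * p2 c * V a c y) < V x1 x2 y * (k1 s1 * k2 s2)"

text \<open>Any passing pair will do. Without one the value is unspecified, but then the true pair
  fails as well and the error is counted there.\<close>

definition dec where
  "dec f1 f2 y = (SOME s. s \<in> S1 \<times> S2 \<and> good (fst s) (snd s) (f1 (fst s)) (f2 (snd s)) y)"

definition avg where
  "avg \<phi> = (\<Sum>f1\<in>PiE S1 (\<lambda>_. X1). \<Sum>f2\<in>PiE S2 (\<lambda>_. X2). (\<Prod>s\<in>S1. p1 (f1 s)) * (\<Prod>s\<in>S2. p2 (f2 s)) * \<phi> f1 f2)"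

lemma avg_nested:
  "avg \<phi> = (\<Sum>f1\<in>PiE S1 (\<lambda>_. X1). (\<Prod>s\<in>S1. p1 (f1 s)) * (\<Sum>f2\<in>PiE S2 (\<lambda>_. X2). (\<Prod>s\<in>S2. p2 (f2 s)) * \<phi> f1 f2))"
  by (simp add: avg_def sum_distrib_left mult.assoc)

lemma avg_mono: "(\<And>f1 f2. \<phi> f1 f2 \<le> \<psi> f1 f2) \<Longrightarrow> avg \<phi> \<le> avg \<psi>"
  unfolding avg_def by (intro sum_mono mult_left_mono mult_nonneg_nonneg prod_nonneg ballI p1 p2)

lemma avg_add: "avg (\<lambda>f1 f2. \<phi> f1 f2 + \<psi> f1 f2) = avg \<phi> + avg \<psi>"
  by (simp add: avg_def distrib_left sum.distrib)

lemma avg_sum: "avg (\<lambda>f1 f2. \<Sum>z\<in>Z. \<phi> z f1 f2) = (\<Sum>z\<in>Z. avg (\<phi> z))"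
proof -
  have "avg (\<lambda>f1 f2. \<Sum>z\<in>Z. \<phi> z f1 f2) = (\<Sum>f1\<in>PiE S1 (\<lambda>_. X1). \<Sum>z\<in>Z. \<Sum>f2\<in>PiE S2 (\<lambda>_. X2).
      (\<Prod>s\<in>S1. p1 (f1 s)) * (\<Prod>s\<in>S2. p2 (f2 s)) * \<phi> z f1 f2)"
    unfolding avg_def sum_distrib_left by (intro sum.cong refl sum.swap)
  also have "\<dots> = (\<Sum>z\<in>Z. avg (\<phi> z))" unfolding avg_def by (rule sum.swap)
  finally show ?thesis .
qed

text \<open>The digits in this and the next names count the distinct codewords of each user on which
  \<open>\<phi>\<close> depends.\<close>

lemma avg11:
  assumes "s1 \<in> S1" "s2 \<in> S2"
  shows "avg (\<lambda>f1 f2. \<phi> (f1 s1) (f2 s2)) = (\<Sum>x1\<in>X1. \<Sum>x2\<in>X2. p1 x1 * p2 x2 * \<phi> x1 x2)"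
  unfolding avg_nested random_codeword[OF fin(2,4) p2(2) assms(2)]
    random_codeword[OF fin(1,3) p1(2) assms(1), of "\<lambda>x1. \<Sum>x2\<in>X2. p2 x2 * \<phi> x1 x2"]
  by (simp add: sum_distrib_left mult.assoc)

lemma avg21:
  assumes "s1 \<in> S1" "t1 \<in> S1" "s1 \<noteq> t1" "s2 \<in> S2"
  shows "avg (\<lambda>f1 f2. \<phi> (f1 s1) (f1 t1) (f2 s2)) = (\<Sum>x1\<in>X1. \<Sum>a\<in>X1. \<Sum>x2\<in>X2. p1 x1 * p1 a * p2 x2 * \<phi> x1 a x2)"
  unfolding avg_nested random_codeword[OF fin(2,4) p2(2) assms(4)]
    random_codeword_pair[OF fin(1,3) p1(2) assms(1-3), of "\<lambda>x1 a. \<Sum>x2\<in>X2. p2 x2 * \<phi> x1 a x2"]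
  by (simp add: sum_distrib_left mult.assoc)

lemma avg12:
  assumes "s1 \<in> S1" "s2 \<in> S2" "t2 \<in> S2" "s2 \<noteq> t2"
  shows "avg (\<lambda>f1 f2. \<phi> (f1 s1) (f2 s2) (f2 t2)) = (\<Sum>x1\<in>X1. \<Sum>x2\<in>X2. \<Sum>c\<in>X2. p1 x1 * (p2 x2 * p2 c) * \<phi> x1 x2 c)"
  unfolding avg_nested random_codeword_pair[OF fin(2,4) p2(2) assms(2-4)]
    random_codeword[OF fin(1,3) p1(2) assms(1), of "\<lambda>x1. \<Sum>x2\<in>X2. \<Sum>c\<in>X2. p2 x2 * p2 c * \<phi> x1 x2 c"]
  by (simp add: sum_distrib_left mult.assoc)

lemma avg22:
  assumes "s1 \<in> S1" "t1 \<in> S1" "s1 \<noteq> t1" "s2 \<in> S2" "t2 \<in> S2" "s2 \<noteq> t2"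
  shows "avg (\<lambda>f1 f2. \<phi> (f1 s1) (f1 t1) (f2 s2) (f2 t2))
    = (\<Sum>x1\<in>X1. \<Sum>a\<in>X1. \<Sum>x2\<in>X2. \<Sum>c\<in>X2. p1 x1 * p1 a * (p2 x2 * p2 c) * \<phi> x1 a x2 c)"
  unfolding avg_nested random_codeword_pair[OF fin(2,4) p2(2) assms(4-6)]
    random_codeword_pair[OF fin(1,3) p1(2) assms(1-3), of "\<lambda>x1 a. \<Sum>x2\<in>X2. \<Sum>c\<in>X2. p2 x2 * p2 c * \<phi> x1 a x2 c"]
  by (simp add: sum_distrib_left mult.assoc)

text \<open>If the true pair passes, the decoder returns a passing pair, so an error exhibits a
  passing competitor of one of the three kinds.\<close>

lemma decoding_error_cases:
  assumes s: "s1 \<in> S1" "s2 \<in> S2"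
  shows "of_bool (dec f1 f2 y \<noteq> (s1, s2)) \<le> (of_bool (\<not> good s1 s2 (f1 s1) (f2 s2) y)
    + (\<Sum>t1\<in>S1 - {s1}. of_bool (good t1 s2 (f1 t1) (f2 s2) y))
    + (\<Sum>t2\<in>S2 - {s2}. of_bool (good s1 t2 (f1 s1) (f2 t2) y))
    + (\<Sum>t1\<in>S1 - {s1}. \<Sum>t2\<in>S2 - {s2}. of_bool (good t1 t2 (f1 t1) (f2 t2) y)) :: real)"
proof -
  let ?g = "\<lambda>t1 t2. of_bool (good t1 t2 (f1 t1) (f2 t2) y) :: real"
  have nn: "0 \<le> (\<Sum>t1\<in>S1 - {s1}. ?g t1 s2)" "0 \<le> (\<Sum>t2\<in>S2 - {s2}. ?g s1 t2)"
    "0 \<le> (\<Sum>t1\<in>S1 - {s1}. \<Sum>t2\<in>S2 - {s2}. ?g t1 t2)" by (intro sum_nonneg; simp)+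
  show ?thesis
  proof (cases "good s1 s2 (f1 s1) (f2 s2) y \<and> dec f1 f2 y \<noteq> (s1, s2)")
    case False
    then show ?thesis using nn by auto
  next
    case True
    obtain t1 t2 where t: "dec f1 f2 y = (t1, t2)" by (cases "dec f1 f2 y")
    have "dec f1 f2 y \<in> S1 \<times> S2 \<and> good (fst (dec f1 f2 y)) (snd (dec f1 f2 y)) (f1 (fst (dec f1 f2 y))) (f2 (snd (dec f1 f2 y))) y"
      unfolding dec_def by (rule someI[of _ "(s1, s2)"]) (use True s in auto)
    then have tg: "t1 \<in> S1" "t2 \<in> S2" "?g t1 t2 = 1" by (auto simp: t)
    have "1 \<le> (\<Sum>t1\<in>S1 - {s1}. ?g t1 s2) + (\<Sum>t2\<in>S2 - {s2}. ?g s1 t2) + (\<Sum>t1\<in>S1 - {s1}. \<Sum>t2\<in>S2 - {s2}. ?g t1 t2)"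
    proof (cases "t1 = s1")
      case eq: True
      then have "t2 \<in> S2 - {s2}" using True t tg by auto
      then have "?g s1 t2 \<le> (\<Sum>t2\<in>S2 - {s2}. ?g s1 t2)" using fin by (intro member_le_sum) auto
      then show ?thesis using nn tg eq by simp
    next
      case ne: False
      then have t1: "t1 \<in> S1 - {s1}" using tg by auto
      show ?thesis
      proof (cases "t2 = s2")
        case eq: True
        have "?g t1 s2 \<le> (\<Sum>t1\<in>S1 - {s1}. ?g t1 s2)" using fin t1 by (intro member_le_sum[of t1 _ "\<lambda>t1. ?g t1 s2"]) auto
        then show ?thesis using nn tg eq by simp
      next
        case ne: False
        then have "t2 \<in> S2 - {s2}" using tg by auto
        then have "?g t1 t2 \<le> (\<Sum>t2\<in>S2 - {s2}. ?g t1 t2)" using fin by (intro member_le_sum) auto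
        also have "\<dots> \<le> (\<Sum>t1\<in>S1 - {s1}. \<Sum>t2\<in>S2 - {s2}. ?g t1 t2)"
          using fin t1 by (intro member_le_sum[of t1 _ "\<lambda>t1. \<Sum>t2\<in>S2 - {s2}. ?g t1 t2"]) (auto intro: sum_nonneg)
        finally show ?thesis using nn tg by simp
      qed
    qed
    then show ?thesis using True by simp
  qed
qed

lemma sum_Diff_le: "finite S \<Longrightarrow> (\<And>s. 0 \<le> k s) \<Longrightarrow> sum k S = 1 \<Longrightarrow> sum k (S - T) \<le> (1::real)"
  using sum_mono2[of S "S - T" k] by auto

text \<open>As \<open>s2\<close> is right, its codeword is shared by the true pair and the
  competitor; it becomes the context \<open>u\<close> of \<open>false_alarm_bound\<close>.\<close>

lemma false_alarm1:
  assumes s: "s1 \<in> S1" "s2 \<in> S2"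
  shows "(\<Sum>t1\<in>S1 - {s1}. avg (\<lambda>f1 f2. \<Sum>y\<in>Y. V (f1 s1) (f2 s2) y * of_bool (good t1 s2 (f1 t1) (f2 s2) y))) \<le> 1 / \<tau>"
proof -
  have "(\<Sum>t1\<in>S1 - {s1}. avg (\<lambda>f1 f2. \<Sum>y\<in>Y. V (f1 s1) (f2 s2) y * of_bool (good t1 s2 (f1 t1) (f2 s2) y)))
     = (\<Sum>t1\<in>S1 - {s1}. \<Sum>x2\<in>X2. \<Sum>a\<in>X1. \<Sum>x1\<in>X1. p2 x2 * p1 a * p1 x1 * (\<Sum>y\<in>Y. V x1 x2 y * of_bool (good t1 s2 a x2 y)))"
  proof (intro sum.cong refl)
    fix t1 assume "t1 \<in> S1 - {s1}"
    then have "avg (\<lambda>f1 f2. \<Sum>y\<in>Y. V (f1 s1) (f2 s2) y * of_bool (good t1 s2 (f1 t1) (f2 s2) y))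
      = (\<Sum>x1\<in>X1. \<Sum>a\<in>X1. \<Sum>x2\<in>X2. p1 x1 * p1 a * p2 x2 * (\<Sum>y\<in>Y. V x1 x2 y * of_bool (good t1 s2 a x2 y)))"
      using s by (intro avg21) auto
    also have "\<dots> = (\<Sum>x1\<in>X1. \<Sum>x2\<in>X2. \<Sum>a\<in>X1. p1 x1 * p1 a * p2 x2 * (\<Sum>y\<in>Y. V x1 x2 y * of_bool (good t1 s2 a x2 y)))"
      by (intro sum.cong refl sum.swap)
    also have "\<dots> = (\<Sum>x2\<in>X2. \<Sum>x1\<in>X1. \<Sum>a\<in>X1. p1 x1 * p1 a * p2 x2 * (\<Sum>y\<in>Y. V x1 x2 y * of_bool (good t1 s2 a x2 y)))"
      by (rule sum.swap)
    also have "\<dots> = (\<Sum>x2\<in>X2. \<Sum>a\<in>X1. \<Sum>x1\<in>X1. p2 x2 * p1 a * p1 x1 * (\<Sum>y\<in>Y. V x1 x2 y * of_bool (good t1 s2 a x2 y)))"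
      by (rule sum.cong[OF refl], subst sum.swap) (simp add: mult_ac)
    finally show "avg (\<lambda>f1 f2. \<Sum>y\<in>Y. V (f1 s1) (f2 s2) y * of_bool (good t1 s2 (f1 t1) (f2 s2) y)) = \<dots>" .
  qed
  also have "\<dots> \<le> 1 / \<tau>"
    by (rule false_alarm_bound[where a = p2 and b = p1 and N = "\<lambda>x2 x1. V x1 x2" and \<kappa> = k1 and good = "\<lambda>t1 x2 a y. good t1 s2 a x2 y"])
       (use p1 p2 V k1 \<tau> fin in \<open>auto simp: good_def intro!: sum_Diff_le\<close>)
  finally show ?thesis .
qed

lemma false_alarm2:
  assumes s: "s1 \<in> S1" "s2 \<in> S2"
  shows "(\<Sum>t2\<in>S2 - {s2}. avg (\<lambda>f1 f2. \<Sum>y\<in>Y. V (f1 s1) (f2 s2) y * of_bool (good s1 t2 (f1 s1) (f2 t2) y))) \<le> 1 / \<tau>"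
proof -
  have "(\<Sum>t2\<in>S2 - {s2}. avg (\<lambda>f1 f2. \<Sum>y\<in>Y. V (f1 s1) (f2 s2) y * of_bool (good s1 t2 (f1 s1) (f2 t2) y)))
     = (\<Sum>t2\<in>S2 - {s2}. \<Sum>x1\<in>X1. \<Sum>c\<in>X2. \<Sum>x2\<in>X2. p1 x1 * p2 c * p2 x2 * (\<Sum>y\<in>Y. V x1 x2 y * of_bool (good s1 t2 x1 c y)))"
  proof (intro sum.cong refl)
    fix t2 assume "t2 \<in> S2 - {s2}"
    then have "avg (\<lambda>f1 f2. \<Sum>y\<in>Y. V (f1 s1) (f2 s2) y * of_bool (good s1 t2 (f1 s1) (f2 t2) y))
      = (\<Sum>x1\<in>X1. \<Sum>x2\<in>X2. \<Sum>c\<in>X2. p1 x1 * (p2 x2 * p2 c) * (\<Sum>y\<in>Y. V x1 x2 y * of_bool (good s1 t2 x1 c y)))"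
      using s by (intro avg12) auto
    also have "\<dots> = (\<Sum>x1\<in>X1. \<Sum>c\<in>X2. \<Sum>x2\<in>X2. p1 x1 * p2 c * p2 x2 * (\<Sum>y\<in>Y. V x1 x2 y * of_bool (good s1 t2 x1 c y)))"
      by (rule sum.cong[OF refl], subst sum.swap) (simp add: mult_ac)
    finally show "avg (\<lambda>f1 f2. \<Sum>y\<in>Y. V (f1 s1) (f2 s2) y * of_bool (good s1 t2 (f1 s1) (f2 t2) y)) = \<dots>" .
  qed
  also have "\<dots> \<le> 1 / \<tau>"
    by (rule false_alarm_bound[where a = p1 and b = p2 and N = V and \<kappa> = k2 and good = "\<lambda>t2 x1 c y. good s1 t2 x1 c y"])
       (use p1 p2 V k2 \<tau> fin in \<open>auto simp: good_def intro!: sum_Diff_le\<close>)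
  finally show ?thesis .
qed

lemma false_alarm12:
  assumes s: "s1 \<in> S1" "s2 \<in> S2"
  shows "(\<Sum>t1\<in>S1 - {s1}. \<Sum>t2\<in>S2 - {s2}. avg (\<lambda>f1 f2. \<Sum>y\<in>Y. V (f1 s1) (f2 s2) y * of_bool (good t1 t2 (f1 t1) (f2 t2) y))) \<le> 1 / \<tau>"
proof -
  let ?Z = "(S1 - {s1}) \<times> (S2 - {s2})" and ?X = "X1 \<times> X2"
  have "(\<Sum>t1\<in>S1 - {s1}. \<Sum>t2\<in>S2 - {s2}. avg (\<lambda>f1 f2. \<Sum>y\<in>Y. V (f1 s1) (f2 s2) y * of_bool (good t1 t2 (f1 t1) (f2 t2) y)))
     = (\<Sum>t1\<in>S1 - {s1}. \<Sum>t2\<in>S2 - {s2}. \<Sum>a\<in>X1. \<Sum>c\<in>X2. \<Sum>x1\<in>X1. \<Sum>x2\<in>X2.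
        1 * (p1 a * p2 c) * (p1 x1 * p2 x2) * (\<Sum>y\<in>Y. V x1 x2 y * of_bool (good t1 t2 a c y)))"
  proof (intro sum.cong refl)
    fix t1 t2 assume "t1 \<in> S1 - {s1}" "t2 \<in> S2 - {s2}"
    let ?h = "\<lambda>a c x1 x2. 1 * (p1 a * p2 c) * (p1 x1 * p2 x2) * (\<Sum>y\<in>Y. V x1 x2 y * of_bool (good t1 t2 a c y))"
    from \<open>t1 \<in> _\<close> \<open>t2 \<in> _\<close> have "avg (\<lambda>f1 f2. \<Sum>y\<in>Y. V (f1 s1) (f2 s2) y * of_bool (good t1 t2 (f1 t1) (f2 t2) y))
      = (\<Sum>x1\<in>X1. \<Sum>a\<in>X1. \<Sum>x2\<in>X2. \<Sum>c\<in>X2. p1 x1 * p1 a * (p2 x2 * p2 c) * (\<Sum>y\<in>Y. V x1 x2 y * of_bool (good t1 t2 a c y)))"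
      using s by (intro avg22[of s1 t1 s2 t2 "\<lambda>x1 a x2 c. \<Sum>y\<in>Y. V x1 x2 y * of_bool (good t1 t2 a c y)"]) auto
    also have "\<dots> = (\<Sum>x1\<in>X1. \<Sum>a\<in>X1. \<Sum>x2\<in>X2. \<Sum>c\<in>X2. ?h a c x1 x2)"
      by (simp add: mult_ac)
    also have "\<dots> = (\<Sum>x1\<in>X1. \<Sum>a\<in>X1. \<Sum>c\<in>X2. \<Sum>x2\<in>X2. ?h a c x1 x2)"
      by (intro sum.cong refl sum.swap)
    also have "\<dots> = (\<Sum>a\<in>X1. \<Sum>x1\<in>X1. \<Sum>c\<in>X2. \<Sum>x2\<in>X2. ?h a c x1 x2)"
      by (rule sum.swap)
    also have "\<dots> = (\<Sum>a\<in>X1. \<Sum>c\<in>X2. \<Sum>x1\<in>X1. \<Sum>x2\<in>X2. ?h a c x1 x2)"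
      by (rule sum.cong[OF refl], rule sum.swap)
    finally show "avg (\<lambda>f1 f2. \<Sum>y\<in>Y. V (f1 s1) (f2 s2) y * of_bool (good t1 t2 (f1 t1) (f2 t2) y)) = \<dots>" .
  qed
  also have "\<dots> = (\<Sum>t\<in>?Z. \<Sum>u\<in>{()}. \<Sum>a\<in>?X. \<Sum>x\<in>?X. 1 * (p1 (fst a) * p2 (snd a)) * (p1 (fst x) * p2 (snd x))
       * (\<Sum>y\<in>Y. V (fst x) (snd x) y * of_bool (good (fst t) (snd t) (fst a) (snd a) y)))"
    unfolding sum.cartesian_product' fst_conv snd_conv by simp
  also have "\<dots> \<le> 1 / \<tau>"
  \<comment> \<open>With both messages wrong no codeword is shared. The context is a single point,
    and pairs of codewords take the place of codewords.\<close>
  proof (rule false_alarm_bound[where a = "\<lambda>_. 1" and b = "\<lambda>x. p1 (fst x) * p2 (snd x)" and N = "\<lambda>_ x. V (fst x) (snd x)"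
        and \<kappa> = "\<lambda>t. k1 (fst t) * k2 (snd t)" and good = "\<lambda>t _ a y. good (fst t) (snd t) (fst a) (snd a) y"])
    have "(\<Sum>t\<in>?Z. k1 (fst t) * k2 (snd t)) = (\<Sum>t\<in>S1 - {s1}. k1 t) * (\<Sum>t\<in>S2 - {s2}. k2 t)"
      unfolding sum.cartesian_product' fst_conv snd_conv by (simp add: sum_product)
    also have "\<dots> \<le> 1 * 1"
      by (intro mult_mono sum_Diff_le) (use fin k1 k2 in \<open>auto intro: sum_nonneg\<close>)
    finally show "(\<Sum>t\<in>?Z. k1 (fst t) * k2 (snd t)) \<le> 1" by simp
    show "(\<Sum>x\<in>?X. p1 (fst x) * p2 (snd x)) = 1"
      unfolding sum.cartesian_product' fst_conv snd_conv by (simp add: p1 p2 flip: sum_distrib_left)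
    show "\<tau> * (\<Sum>x'\<in>?X. p1 (fst x') * p2 (snd x') * V (fst x') (snd x') y) \<le> V (fst x) (snd x) y * (k1 (fst z) * k2 (snd z))"
      if "good (fst z) (snd z) (fst x) (snd x) y" for z x y
      using that unfolding sum.cartesian_product' fst_conv snd_conv good_def by simp
  qed (use p1 p2 V k1 k2 \<tau> in auto)
  finally show ?thesis .
qed

lemma average_error:
  assumes s: "s1 \<in> S1" "s2 \<in> S2"
  shows "avg (\<lambda>f1 f2. \<Sum>y\<in>Y. V (f1 s1) (f2 s2) y * of_bool (dec f1 f2 y \<noteq> (s1, s2)))
    \<le> (\<Sum>x1\<in>X1. \<Sum>x2\<in>X2. \<Sum>y\<in>Y. p1 x1 * p2 x2 * V x1 x2 y * of_bool (\<not> good s1 s2 x1 x2 y)) + 3 / \<tau>"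
proof -
  let ?v = "\<lambda>f1 f2 y. V (f1 s1) (f2 s2) y"
  have "avg (\<lambda>f1 f2. \<Sum>y\<in>Y. ?v f1 f2 y * of_bool (dec f1 f2 y \<noteq> (s1, s2)))
    \<le> avg (\<lambda>f1 f2. (\<Sum>y\<in>Y. ?v f1 f2 y * of_bool (\<not> good s1 s2 (f1 s1) (f2 s2) y))
      + (\<Sum>t1\<in>S1 - {s1}. \<Sum>y\<in>Y. ?v f1 f2 y * of_bool (good t1 s2 (f1 t1) (f2 s2) y))
      + (\<Sum>t2\<in>S2 - {s2}. \<Sum>y\<in>Y. ?v f1 f2 y * of_bool (good s1 t2 (f1 s1) (f2 t2) y))
      + (\<Sum>t1\<in>S1 - {s1}. \<Sum>t2\<in>S2 - {s2}. \<Sum>y\<in>Y. ?v f1 f2 y * of_bool (good t1 t2 (f1 t1) (f2 t2) y)))"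
  proof (rule avg_mono)
    fix f1 f2
    have "(\<Sum>y\<in>Y. ?v f1 f2 y * of_bool (dec f1 f2 y \<noteq> (s1, s2)))
      \<le> (\<Sum>y\<in>Y. ?v f1 f2 y * (of_bool (\<not> good s1 s2 (f1 s1) (f2 s2) y)
    + (\<Sum>t1\<in>S1 - {s1}. of_bool (good t1 s2 (f1 t1) (f2 s2) y))
    + (\<Sum>t2\<in>S2 - {s2}. of_bool (good s1 t2 (f1 s1) (f2 t2) y))
    + (\<Sum>t1\<in>S1 - {s1}. \<Sum>t2\<in>S2 - {s2}. of_bool (good t1 t2 (f1 t1) (f2 t2) y))))"
      by (intro sum_mono mult_left_mono decoding_error_cases s V)
    also have "\<dots> = (\<Sum>y\<in>Y. ?v f1 f2 y * of_bool (\<not> good s1 s2 (f1 s1) (f2 s2) y))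
      + (\<Sum>t1\<in>S1 - {s1}. \<Sum>y\<in>Y. ?v f1 f2 y * of_bool (good t1 s2 (f1 t1) (f2 s2) y))
      + (\<Sum>t2\<in>S2 - {s2}. \<Sum>y\<in>Y. ?v f1 f2 y * of_bool (good s1 t2 (f1 s1) (f2 t2) y))
      + (\<Sum>t1\<in>S1 - {s1}. \<Sum>t2\<in>S2 - {s2}. \<Sum>y\<in>Y. ?v f1 f2 y * of_bool (good t1 t2 (f1 t1) (f2 t2) y))"
      unfolding distrib_left sum.distrib sum_distrib_left
      by (subst (2 4 6 8) sum.swap) (simp only: sum.swap[of _ Y "S2 - {s2}"])
    finally show "(\<Sum>y\<in>Y. ?v f1 f2 y * of_bool (dec f1 f2 y \<noteq> (s1, s2))) \<le> \<dots>" .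
  qed
  also have "\<dots> = (\<Sum>x1\<in>X1. \<Sum>x2\<in>X2. p1 x1 * p2 x2 * (\<Sum>y\<in>Y. V x1 x2 y * of_bool (\<not> good s1 s2 x1 x2 y)))
      + (\<Sum>t1\<in>S1 - {s1}. avg (\<lambda>f1 f2. \<Sum>y\<in>Y. ?v f1 f2 y * of_bool (good t1 s2 (f1 t1) (f2 s2) y)))
      + (\<Sum>t2\<in>S2 - {s2}. avg (\<lambda>f1 f2. \<Sum>y\<in>Y. ?v f1 f2 y * of_bool (good s1 t2 (f1 s1) (f2 t2) y)))
      + (\<Sum>t1\<in>S1 - {s1}. \<Sum>t2\<in>S2 - {s2}. avg (\<lambda>f1 f2. \<Sum>y\<in>Y. ?v f1 f2 y * of_bool (good t1 t2 (f1 t1) (f2 t2) y)))"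
    unfolding avg_add avg_sum[where Z = "S1 - {s1}"] avg_sum[where Z = "S2 - {s2}"]
      avg11[OF s, of "\<lambda>x1 x2. \<Sum>y\<in>Y. V x1 x2 y * of_bool (\<not> good s1 s2 x1 x2 y)"] ..
  also have "\<dots> \<le> (\<Sum>x1\<in>X1. \<Sum>x2\<in>X2. p1 x1 * p2 x2 * (\<Sum>y\<in>Y. V x1 x2 y * of_bool (\<not> good s1 s2 x1 x2 y))) + 3 / \<tau>"
    using false_alarm1[OF s] false_alarm2[OF s] false_alarm12[OF s] by simp
  finally show ?thesis by (simp add: sum_distrib_left mult.assoc)
qed

end

section \<open>Error exponents\<close>

text \<open>Under the ensemble the true codewords do not depend on the source blocks that they
  represent, so source and channel blocks are independent of each other, each with i.i.d.
  letters.\<close>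

definition event_prob where
  "event_prob P J m n E = (\<Sum>s1\<in>seqs m. \<Sum>s2\<in>seqs m. \<Sum>w\<in>seqs m. \<Sum>q\<in>seqs n. \<Sum>x1\<in>seqs n. \<Sum>x2\<in>seqs n. \<Sum>y\<in>seqs n.
     (\<Prod>i<m. P (s1 ! i) (s2 ! i) (w ! i)) * (\<Prod>j<n. J (q ! j) (x1 ! j) (x2 ! j) (y ! j))
       * of_bool (E s1 s2 w q x1 x2 y) :: real)"

lemma event_prob_union3:
  assumes "\<And>s1 s2 w. 0 \<le> P s1 s2 w" "\<And>q x1 x2 y. 0 \<le> J q x1 x2 y"
    and "\<And>s1 s2 w q x1 x2 y. E s1 s2 w q x1 x2 y \<Longrightarrow> E1 s1 s2 w q x1 x2 y \<or> E2 s1 s2 w q x1 x2 y \<or> E3 s1 s2 w q x1 x2 y"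
  shows "event_prob P J m n E \<le> event_prob P J m n E1 + event_prob P J m n E2 + event_prob P J m n E3"
proof -
  have "event_prob P J m n E \<le> (\<Sum>s1\<in>seqs m. \<Sum>s2\<in>seqs m. \<Sum>w\<in>seqs m. \<Sum>q\<in>seqs n. \<Sum>x1\<in>seqs n. \<Sum>x2\<in>seqs n. \<Sum>y\<in>seqs n.
     (\<Prod>i<m. P (s1 ! i) (s2 ! i) (w ! i)) * (\<Prod>j<n. J (q ! j) (x1 ! j) (x2 ! j) (y ! j))
       * (of_bool (E1 s1 s2 w q x1 x2 y) + of_bool (E2 s1 s2 w q x1 x2 y) + of_bool (E3 s1 s2 w q x1 x2 y)))"
    unfolding event_prob_def
  proof (intro sum_mono mult_left_mono mult_nonneg_nonneg prod_nonneg ballI assms(1,2))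
    fix s1 s2 w q x1 x2 y
    show "of_bool (E s1 s2 w q x1 x2 y)
      \<le> (of_bool (E1 s1 s2 w q x1 x2 y) + of_bool (E2 s1 s2 w q x1 x2 y) + of_bool (E3 s1 s2 w q x1 x2 y) :: real)"
      using assms(3)[of s1 s2 w q x1 x2 y] by (cases "E s1 s2 w q x1 x2 y") auto
  qed
  then show ?thesis unfolding event_prob_def distrib_left sum.distrib .
qed

text \<open>On the event the ratio \<open>\<tau> * r / (v * K)\<close> is at least 1, and so is its
  power \<open>t\<close>. The powers are written separately to keep the source factor apart from the
  channel factor.\<close>

lemma chernoff_pointwise:
  fixes K v r :: real
  assumes "0 < K" "0 < v" "0 \<le> r" "0 < \<tau>" "0 < t"
  shows "of_bool (v * K \<le> \<tau> * r) \<le> \<tau> powr t * K powr (-t) * (r / v) powr t"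
proof (cases "v * K \<le> \<tau> * r")
  case True
  then have "1 \<le> \<tau> * r / (v * K)" using assms by (simp add: field_simps)
  then have "1 \<le> (\<tau> * r / (v * K)) powr t" using assms by (simp add: ge_one_powr_ge_zero)
  also have "\<tau> * r / (v * K) = \<tau> * (1 / K) * (r / v)" by simp
  also have "(\<tau> * (1 / K) * (r / v)) powr t = \<tau> powr t * (1 / K) powr t * (r / v) powr t"
    by (simp only: powr_mult)
  also have "(1 / K) powr t = K powr (-t)" using assms by (simp add: powr_minus_divide powr_divide)
  finally show ?thesis using True by simp
qed simp

text \<open>The pointwise Chernoff bound is a product over letters, so its expectation is a product
  of single-letter moments.\<close>

lemma chernoff_seq:
  fixes P \<kappa> :: "'s1::finite \<Rightarrow> 's2::finite \<Rightarrow> 'w::finite \<Rightarrow> real"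
    and J R V :: "'q::finite \<Rightarrow> 'x1::finite \<Rightarrow> 'x2::finite \<Rightarrow> 'y::finite \<Rightarrow> real"
  assumes P0: "\<And>s1 s2 w. 0 \<le> P s1 s2 w" and \<kappa>0: "\<And>s1 s2 w. 0 \<le> \<kappa> s1 s2 w"
    and \<kappa>pos: "\<And>s1 s2 w. 0 < P s1 s2 w \<Longrightarrow> 0 < \<kappa> s1 s2 w"
    and J0: "\<And>q x1 x2 y. 0 \<le> J q x1 x2 y" and R0: "\<And>q x1 x2 y. 0 \<le> R q x1 x2 y"
    and V0: "\<And>q x1 x2 y. 0 \<le> V q x1 x2 y" and Vpos: "\<And>q x1 x2 y. 0 < J q x1 x2 y \<Longrightarrow> 0 < V q x1 x2 y"
    and \<tau>: "0 < \<tau>" and t: "0 < t"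
  shows "event_prob P J m n (\<lambda>s1 s2 w q x1 x2 y. (\<Prod>j<n. V (q ! j) (x1 ! j) (x2 ! j) (y ! j)) * (\<Prod>i<m. \<kappa> (s1 ! i) (s2 ! i) (w ! i))
        \<le> \<tau> * (\<Prod>j<n. R (q ! j) (x1 ! j) (x2 ! j) (y ! j)))
    \<le> \<tau> powr t * (\<Sum>s1\<in>UNIV. \<Sum>s2\<in>UNIV. \<Sum>w\<in>UNIV. P s1 s2 w * \<kappa> s1 s2 w powr (-t)) ^ m
      * (\<Sum>q\<in>UNIV. \<Sum>x1\<in>UNIV. \<Sum>x2\<in>UNIV. \<Sum>y\<in>UNIV. J q x1 x2 y * (R q x1 x2 y / V q x1 x2 y) powr t) ^ n"
proof -
  let ?A = "\<lambda>s1 s2 w. P s1 s2 w * \<kappa> s1 s2 w powr (-t)"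
  let ?B = "\<lambda>q x1 x2 y. J q x1 x2 y * (R q x1 x2 y / V q x1 x2 y) powr t"
  have pw: "(\<Prod>i<m. P (s1 ! i) (s2 ! i) (w ! i)) * (\<Prod>j<n. J (q ! j) (x1 ! j) (x2 ! j) (y ! j))
       * of_bool ((\<Prod>j<n. V (q ! j) (x1 ! j) (x2 ! j) (y ! j)) * (\<Prod>i<m. \<kappa> (s1 ! i) (s2 ! i) (w ! i))
        \<le> \<tau> * (\<Prod>j<n. R (q ! j) (x1 ! j) (x2 ! j) (y ! j)))
     \<le> \<tau> powr t * (\<Prod>i<m. ?A (s1 ! i) (s2 ! i) (w ! i)) * (\<Prod>j<n. ?B (q ! j) (x1 ! j) (x2 ! j) (y ! j))"
    for s1 :: "'s1 list" and s2 :: "'s2 list" and w :: "'w list" and q :: "'q list" and x1 :: "'x1 list" and x2 :: "'x2 list" and y :: "'y list"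
  proof -
    define PP where "PP = (\<Prod>i<m. P (s1 ! i) (s2 ! i) (w ! i))"
    define JJ where "JJ = (\<Prod>j<n. J (q ! j) (x1 ! j) (x2 ! j) (y ! j))"
    define KK where "KK = (\<Prod>i<m. \<kappa> (s1 ! i) (s2 ! i) (w ! i))"
    define VV where "VV = (\<Prod>j<n. V (q ! j) (x1 ! j) (x2 ! j) (y ! j))"
    define RR where "RR = (\<Prod>j<n. R (q ! j) (x1 ! j) (x2 ! j) (y ! j))"
    have nn: "0 \<le> PP" "0 \<le> JJ" "0 \<le> RR" unfolding PP_def JJ_def RR_def
      by (intro prod_nonneg ballI P0 J0 R0)+
    have A: "(\<Prod>i<m. ?A (s1 ! i) (s2 ! i) (w ! i)) = PP * KK powr (-t)"
      unfolding PP_def KK_def by (simp add: prod.distrib prod_powr_distrib \<kappa>0)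
    have B: "(\<Prod>j<n. ?B (q ! j) (x1 ! j) (x2 ! j) (y ! j)) = JJ * (RR / VV) powr t"
      unfolding JJ_def RR_def VV_def prod_dividef[symmetric]
      by (simp only: prod.distrib prod_powr_distrib)
    show ?thesis
      unfolding A B PP_def[symmetric] JJ_def[symmetric] KK_def[symmetric] VV_def[symmetric] RR_def[symmetric]
    \<comment> \<open>Positivity of \<open>\<kappa>\<close> and \<open>V\<close> is known only on
      the support of the two laws; off the support the left side is zero.\<close>
    proof (cases "PP * JJ = 0")
      case True
      moreover have "0 \<le> \<tau> powr t * (PP * KK powr (-t)) * (JJ * (RR / VV) powr t)" using nn by simp
      ultimately show "PP * JJ * of_bool (VV * KK \<le> \<tau> * RR) \<le> \<tau> powr t * (PP * KK powr (-t)) * (JJ * (RR / VV) powr t)"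
        by (metis mult_zero_left)
    next
      case False
      then have "0 < PP" "0 < JJ" using nn by (auto simp: less_le)
      have "0 < P (s1 ! i) (s2 ! i) (w ! i)" if "i < m" for i
        by (rule prod_pos_imp_pos[of "\<lambda>i. P (s1 ! i) (s2 ! i) (w ! i)" m])
           (use \<open>0 < PP\<close> P0 that in \<open>auto simp: PP_def\<close>)
      then have "0 < KK" unfolding KK_def by (intro prod_pos ballI \<kappa>pos) auto
      moreover have "0 < J (q ! j) (x1 ! j) (x2 ! j) (y ! j)" if "j < n" for j
        by (rule prod_pos_imp_pos[of "\<lambda>j. J (q ! j) (x1 ! j) (x2 ! j) (y ! j)" n])
           (use \<open>0 < JJ\<close> J0 that in \<open>auto simp: JJ_def\<close>)
      then have "0 < VV" unfolding VV_def by (intro prod_pos ballI Vpos) auto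
      ultimately have "of_bool (VV * KK \<le> \<tau> * RR) \<le> \<tau> powr t * KK powr (-t) * (RR / VV) powr t"
        using nn \<tau> t by (intro chernoff_pointwise) auto
      then have "PP * JJ * of_bool (VV * KK \<le> \<tau> * RR) \<le> PP * JJ * (\<tau> powr t * KK powr (-t) * (RR / VV) powr t)"
        using nn by (intro mult_left_mono) auto
      then show "PP * JJ * of_bool (VV * KK \<le> \<tau> * RR) \<le> \<tau> powr t * (PP * KK powr (-t)) * (JJ * (RR / VV) powr t)"
        by (simp only: mult_ac)
    qed
  qed
  have "event_prob P J m n (\<lambda>s1 s2 w q x1 x2 y. (\<Prod>j<n. V (q ! j) (x1 ! j) (x2 ! j) (y ! j)) * (\<Prod>i<m. \<kappa> (s1 ! i) (s2 ! i) (w ! i))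
        \<le> \<tau> * (\<Prod>j<n. R (q ! j) (x1 ! j) (x2 ! j) (y ! j)))
    \<le> (\<Sum>s1\<in>seqs m. \<Sum>s2\<in>seqs m. \<Sum>w\<in>seqs m. \<Sum>q\<in>seqs n. \<Sum>x1\<in>seqs n. \<Sum>x2\<in>seqs n. \<Sum>y\<in>seqs n.
        \<tau> powr t * (\<Prod>i<m. ?A (s1 ! i) (s2 ! i) (w ! i)) * (\<Prod>j<n. ?B (q ! j) (x1 ! j) (x2 ! j) (y ! j)))"
    unfolding event_prob_def by (intro sum_mono pw)
  also have "\<dots> = \<tau> powr t * (\<Sum>s1\<in>seqs m. \<Sum>s2\<in>seqs m. \<Sum>w\<in>seqs m. \<Prod>i<m. ?A (s1 ! i) (s2 ! i) (w ! i))
     * (\<Sum>q\<in>seqs n. \<Sum>x1\<in>seqs n. \<Sum>x2\<in>seqs n. \<Sum>y\<in>seqs n. \<Prod>j<n. ?B (q ! j) (x1 ! j) (x2 ! j) (y ! j))"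
    by (simp only: sum_distrib_left[symmetric] sum_distrib_right[symmetric])
  finally show ?thesis
    unfolding sum_seqs_prod3[of ?A] sum_seqs_prod4[of ?B] .
qed

text \<open>The derivative at 0 of a moment generating function is the mean, here of
  \<open>ln (r i)\<close>. Terms of weight zero are constant.\<close>

lemma exponential_moment_derivative:
  fixes p :: "'i \<Rightarrow> real"
  assumes "finite I" "\<And>i. i \<in> I \<Longrightarrow> p i \<noteq> 0 \<Longrightarrow> 0 < r i"
  shows "((\<lambda>t. \<Sum>i\<in>I. p i * r i powr t) has_real_derivative (\<Sum>i\<in>I. p i * ln (r i))) (at 0)"
proof -
  have "((\<lambda>t. p i * r i powr t) has_real_derivative p i * ln (r i)) (at 0)" if "i \<in> I" for i
  proof (cases "p i = 0")
    case False
    then have "0 < r i" using assms(2) that by blast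
    then show ?thesis by (auto intro!: derivative_eq_intros)
  qed simp
  then show ?thesis by (rule DERIV_sum)
qed

text \<open>The product equals 1 at \<open>t = 0\<close>, where its derivative is the expression in
  \<open>neg\<close>; hence it drops below 1 for small positive \<open>t\<close>.\<close>

lemma negative_exponent:
  fixes S A :: "real \<Rightarrow> real"
  assumes S: "S 0 = 1" "(S has_real_derivative S') (at 0)" and A: "A 0 = 1" "(A has_real_derivative A') (at 0)"
    and neg: "real n * c + real m * S' + real n * A' < 0"
  shows "\<exists>t>0. exp (c * t) ^ n * S t ^ m * A t ^ n < 1"
proof -
  let ?g = "\<lambda>t. exp (c * t) ^ n * S t ^ m * A t ^ n"
  have "(?g has_real_derivative (real n * c + real m * S' + real n * A')) (at 0)"
    by (auto intro!: derivative_eq_intros S(2) A(2) simp: S(1) A(1))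
  from DERIV_neg_dec_right[OF this neg] obtain d where "d > 0" "\<forall>h>0. h < d \<longrightarrow> ?g (0 + h) < ?g 0" by blast
  then have "?g (0 + d / 2) < ?g 0" by (metis half_gt_zero field_sum_of_halves less_add_same_cancel1)
  then show ?thesis using \<open>d > 0\<close> S(1) A(1) by (intro exI[of _ "d / 2"]) simp
qed

text \<open>Block lengths run through the multiples of \<open>(m0, n0)\<close>, so that their ratio
  is fixed and the Chernoff bound is the power \<open>l\<close> of one number
  \<open>\<rho>\<close>.\<close>

lemma bad_event_vanishes:
  fixes P \<kappa> :: "'s1::finite \<Rightarrow> 's2::finite \<Rightarrow> 'w::finite \<Rightarrow> real"
    and J R V :: "'q::finite \<Rightarrow> 'x1::finite \<Rightarrow> 'x2::finite \<Rightarrow> 'y::finite \<Rightarrow> real"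
  assumes P0: "\<And>s1 s2 w. 0 \<le> P s1 s2 w" and P1: "(\<Sum>s1\<in>UNIV. \<Sum>s2\<in>UNIV. \<Sum>w\<in>UNIV. P s1 s2 w) = 1"
    and \<kappa>0: "\<And>s1 s2 w. 0 \<le> \<kappa> s1 s2 w" and \<kappa>pos: "\<And>s1 s2 w. 0 < P s1 s2 w \<Longrightarrow> 0 < \<kappa> s1 s2 w"
    and J0: "\<And>q x1 x2 y. 0 \<le> J q x1 x2 y" and J1: "(\<Sum>q\<in>UNIV. \<Sum>x1\<in>UNIV. \<Sum>x2\<in>UNIV. \<Sum>y\<in>UNIV. J q x1 x2 y) = 1"
    and R0: "\<And>q x1 x2 y. 0 \<le> R q x1 x2 y" and V0: "\<And>q x1 x2 y. 0 \<le> V q x1 x2 y"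
    and pos: "\<And>q x1 x2 y. 0 < J q x1 x2 y \<Longrightarrow> 0 < V q x1 x2 y \<and> 0 < R q x1 x2 y"
    and neg: "real n0 * \<gamma> - real m0 * (\<Sum>s1\<in>UNIV. \<Sum>s2\<in>UNIV. \<Sum>w\<in>UNIV. P s1 s2 w * log 2 (\<kappa> s1 s2 w))
       < real n0 * (\<Sum>q\<in>UNIV. \<Sum>x1\<in>UNIV. \<Sum>x2\<in>UNIV. \<Sum>y\<in>UNIV. J q x1 x2 y * log 2 (V q x1 x2 y / R q x1 x2 y))"
  shows "\<exists>\<rho>. 0 \<le> \<rho> \<and> \<rho> < 1 \<and> (\<forall>l. event_prob P J (l * m0) (l * n0)
     (\<lambda>s1 s2 w q x1 x2 y. (\<Prod>j<l*n0. V (q ! j) (x1 ! j) (x2 ! j) (y ! j)) * (\<Prod>i<l*m0. \<kappa> (s1 ! i) (s2 ! i) (w ! i))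
        \<le> 2 powr (\<gamma> * real (l * n0)) * (\<Prod>j<l*n0. R (q ! j) (x1 ! j) (x2 ! j) (y ! j))) \<le> \<rho> ^ l)"
proof -
  define S where "S t = (\<Sum>s1\<in>UNIV. \<Sum>s2\<in>UNIV. \<Sum>w\<in>UNIV. P s1 s2 w * \<kappa> s1 s2 w powr (-t))" for t
  define A where "A t = (\<Sum>q\<in>UNIV. \<Sum>x1\<in>UNIV. \<Sum>x2\<in>UNIV. \<Sum>y\<in>UNIV. J q x1 x2 y * (R q x1 x2 y / V q x1 x2 y) powr t)" for t
  let ?P = "\<lambda>(s1,s2,w). P s1 s2 w" and ?r = "\<lambda>(s1,s2,w). 1 / \<kappa> s1 s2 w"
  let ?J = "\<lambda>(q,x1,x2,y). J q x1 x2 y" and ?r' = "\<lambda>(q,x1,x2,y). R q x1 x2 y / V q x1 x2 y"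
  have ppos: "P s1 s2 w \<noteq> 0 \<Longrightarrow> 0 < \<kappa> s1 s2 w" for s1 s2 w using P0[of s1 s2 w] \<kappa>pos[of s1 s2 w] by simp
  have jpos: "J q x1 x2 y \<noteq> 0 \<Longrightarrow> 0 < V q x1 x2 y \<and> 0 < R q x1 x2 y" for q x1 x2 y
    using J0[of q x1 x2 y] pos[of q x1 x2 y] by simp
  have Se: "S t = (\<Sum>v\<in>UNIV. ?P v * ?r v powr t)" for t
  proof -
    have e: "P s1 s2 w * \<kappa> s1 s2 w powr (-t) = P s1 s2 w * (1 / \<kappa> s1 s2 w) powr t" for s1 s2 w
      using \<kappa>0[of s1 s2 w] by (simp add: powr_minus_divide powr_divide)
    show ?thesis unfolding sum_UNIV_prod S_def prod.case e ..
  qed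
  have Ae: "A t = (\<Sum>v\<in>UNIV. ?J v * ?r' v powr t)" for t
    unfolding sum_UNIV_prod by (simp add: A_def)
  \<comment> \<open>As \<open>0 powr 0 = 0\<close>, the value 1 at \<open>t = 0\<close> relies on
    \<open>\<kappa>\<close> being positive wherever \<open>P\<close> is; the same holds for
    \<open>A0\<close> below.\<close>
  have S0: "S 0 = 1"
  proof -
    have e: "P s1 s2 w * \<kappa> s1 s2 w powr (-0) = P s1 s2 w" for s1 s2 w
      using ppos[of s1 s2 w] by (cases "P s1 s2 w = 0") auto
    show ?thesis unfolding S_def e by (rule P1)
  qed
  have A0: "A 0 = 1"
  proof -
    have e: "J q x1 x2 y * (R q x1 x2 y / V q x1 x2 y) powr 0 = J q x1 x2 y" for q x1 x2 y
      using jpos[of q x1 x2 y] by (cases "J q x1 x2 y = 0") auto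
    show ?thesis unfolding A_def e by (rule J1)
  qed
  have dS: "(S has_real_derivative (\<Sum>v\<in>UNIV. ?P v * ln (?r v))) (at 0)"
    unfolding Se[abs_def] by (rule exponential_moment_derivative) (auto simp: ppos)
  have dA: "(A has_real_derivative (\<Sum>v\<in>UNIV. ?J v * ln (?r' v))) (at 0)"
    unfolding Ae[abs_def] by (rule exponential_moment_derivative) (auto simp: jpos)
  have e1: "(\<Sum>v\<in>UNIV. ?P v * ln (?r v)) = - ln 2 * (\<Sum>s1\<in>UNIV. \<Sum>s2\<in>UNIV. \<Sum>w\<in>UNIV. P s1 s2 w * log 2 (\<kappa> s1 s2 w))"
  proof -
    have e: "P s1 s2 w * ln (1 / \<kappa> s1 s2 w) = - ln 2 * (P s1 s2 w * log 2 (\<kappa> s1 s2 w))" for s1 s2 w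
      using ppos[of s1 s2 w] by (cases "P s1 s2 w = 0") (auto simp: ln_div log_def)
    show ?thesis unfolding sum_UNIV_prod prod.case e sum_distrib_left ..
  qed
  have e2: "(\<Sum>v\<in>UNIV. ?J v * ln (?r' v))
    = - ln 2 * (\<Sum>q\<in>UNIV. \<Sum>x1\<in>UNIV. \<Sum>x2\<in>UNIV. \<Sum>y\<in>UNIV. J q x1 x2 y * log 2 (V q x1 x2 y / R q x1 x2 y))"
  proof -
    have e: "J q x1 x2 y * ln (R q x1 x2 y / V q x1 x2 y) = - ln 2 * (J q x1 x2 y * log 2 (V q x1 x2 y / R q x1 x2 y))" for q x1 x2 y
      using jpos[of q x1 x2 y] by (cases "J q x1 x2 y = 0") (auto simp: ln_div log_def, simp add: algebra_simps)
    show ?thesis unfolding sum_UNIV_prod prod.case e sum_distrib_left ..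
  qed
  \<comment> \<open>Multiplied by \<open>ln 2\<close>, the rate inequality \<open>neg\<close> says
    that the derivative of the Chernoff bound at \<open>t = 0\<close> is negative.\<close>
  have "real n0 * (\<gamma> * ln 2) + real m0 * (\<Sum>v\<in>UNIV. ?P v * ln (?r v)) + real n0 * (\<Sum>v\<in>UNIV. ?J v * ln (?r' v)) < 0"
    using mult_strict_left_mono[OF neg, of "ln 2"] unfolding e1 e2 by (simp add: algebra_simps)
  from negative_exponent[OF S0 dS A0 dA this] obtain t where t: "0 < t"
    "exp (\<gamma> * ln 2 * t) ^ n0 * S t ^ m0 * A t ^ n0 < 1" by blast
  define \<rho> where "\<rho> = exp (\<gamma> * ln 2 * t) ^ n0 * S t ^ m0 * A t ^ n0"
  have nn: "0 \<le> S t" "0 \<le> A t" unfolding S_def A_def by (intro sum_nonneg mult_nonneg_nonneg P0 J0 powr_ge_zero)+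
  have "event_prob P J (l * m0) (l * n0)
     (\<lambda>s1 s2 w q x1 x2 y. (\<Prod>j<l*n0. V (q ! j) (x1 ! j) (x2 ! j) (y ! j)) * (\<Prod>i<l*m0. \<kappa> (s1 ! i) (s2 ! i) (w ! i))
        \<le> 2 powr (\<gamma> * real (l * n0)) * (\<Prod>j<l*n0. R (q ! j) (x1 ! j) (x2 ! j) (y ! j))) \<le> \<rho> ^ l" for l
  proof -
    have "(2 powr (\<gamma> * real (l * n0))) powr t = exp (\<gamma> * ln 2 * t) ^ (n0 * l)"
      by (simp add: powr_def mult_ac flip: exp_of_nat_mult)
    moreover have "event_prob P J (l * m0) (l * n0)
     (\<lambda>s1 s2 w q x1 x2 y. (\<Prod>j<l*n0. V (q ! j) (x1 ! j) (x2 ! j) (y ! j)) * (\<Prod>i<l*m0. \<kappa> (s1 ! i) (s2 ! i) (w ! i))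
        \<le> 2 powr (\<gamma> * real (l * n0)) * (\<Prod>j<l*n0. R (q ! j) (x1 ! j) (x2 ! j) (y ! j)))
      \<le> (2 powr (\<gamma> * real (l * n0))) powr t * S t ^ (l * m0) * A t ^ (l * n0)"
      unfolding S_def A_def by (rule chernoff_seq) (use P0 \<kappa>0 \<kappa>pos J0 R0 V0 pos t in auto)
    ultimately show ?thesis by (simp add: \<rho>_def power_mult_distrib power_mult[symmetric] mult.commute)
  qed
  then show ?thesis using t(2) nn unfolding \<rho>_def[symmetric]
    by (intro exI[of _ \<rho>]) (auto simp: \<rho>_def)
qed

section \<open>Achievability and the main theorem\<close>

text \<open>Carries the decoder out of the locale. It is quantified before \<open>s1\<close> and
  \<open>s2\<close> because one decoder must serve all message pairs.\<close>

lemma random_coding: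
  fixes k1 :: "'s1 \<Rightarrow> real" and k2 :: "'s2 \<Rightarrow> real"
  assumes "one_shot S1 S2 X1 X2 Y p1 p2 V k1 k2 \<tau>"
  shows "\<exists>dec. \<forall>s1\<in>S1. \<forall>s2\<in>S2.
    (\<Sum>f1\<in>PiE S1 (\<lambda>_. X1). \<Sum>f2\<in>PiE S2 (\<lambda>_. X2). (\<Prod>s\<in>S1. p1 (f1 s)) * (\<Prod>s\<in>S2. p2 (f2 s))
       * (\<Sum>y\<in>Y. V (f1 s1) (f2 s2) y * of_bool (dec f1 f2 y \<noteq> (s1, s2))))
    \<le> (\<Sum>x1\<in>X1. \<Sum>x2\<in>X2. \<Sum>y\<in>Y. p1 x1 * p2 x2 * V x1 x2 y * of_bool (
         V x1 x2 y * k1 s1 \<le> \<tau> * (\<Sum>a\<in>X1. p1 a * V a x2 y) \<or>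
         V x1 x2 y * k2 s2 \<le> \<tau> * (\<Sum>c\<in>X2. p2 c * V x1 c y) \<or>
         V x1 x2 y * (k1 s1 * k2 s2) \<le> \<tau> * (\<Sum>a\<in>X1. \<Sum>c\<in>X2. p1 a * p2 c * V a c y))) + 3 / \<tau>"
proof -
  interpret one_shot S1 S2 X1 X2 Y p1 p2 V k1 k2 \<tau> by fact
  have g: "(\<not> good s1 s2 x1 x2 y) \<longleftrightarrow> V x1 x2 y * k1 s1 \<le> \<tau> * (\<Sum>a\<in>X1. p1 a * V a x2 y) \<or>
         V x1 x2 y * k2 s2 \<le> \<tau> * (\<Sum>c\<in>X2. p2 c * V x1 c y) \<or>
         V x1 x2 y * (k1 s1 * k2 s2) \<le> \<tau> * (\<Sum>a\<in>X1. \<Sum>c\<in>X2. p1 a * p2 c * V a c y)" for s1 s2 x1 x2 y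
    unfolding good_def by linarith
  show ?thesis
    by (rule exI[of _ dec], intro ballI) (use average_error in \<open>simp only: g avg_def\<close>)
qed

section \<open>The code ensemble\<close>

definition codebook_avg where
  "codebook_avg m n p1 p2 q \<phi> = (\<Sum>f1\<in>PiE (seqs m) (\<lambda>_. seqs n). \<Sum>f2\<in>PiE (seqs m) (\<lambda>_. seqs n).
     (\<Prod>s\<in>seqs m. seqK n p1 q (f1 s)) * (\<Prod>s\<in>seqs m. seqK n p2 q (f2 s)) * (\<phi> f1 f2 :: real))"

text \<open>The decoder may depend on \<open>q\<close> and on both codebooks, which are fixed before
  transmission and known everywhere.\<close>

definition ensemble_err where
  "ensemble_err P V m n pq p1 p2 g = (\<Sum>q\<in>seqs n. seqP n pq q * codebook_avg m n p1 p2 q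
     (\<lambda>f1 f2. recv_err P V m n f1 f2 (\<lambda>s1 s2 w y. g q f1 f2 y w \<noteq> (s1, s2))))"

lemma codebook_avg_sum:
  "codebook_avg m n p1 p2 q (\<lambda>f1 f2. \<Sum>z\<in>Z. \<phi> z f1 f2) = (\<Sum>z\<in>Z. codebook_avg m n p1 p2 q (\<phi> z))"
  unfolding codebook_avg_def sum_distrib_left by (subst sum.swap[of _ _ Z], subst sum.swap[of _ _ Z]) simp

lemma codebook_avg_cmult:
  "codebook_avg m n p1 p2 q (\<lambda>f1 f2. c * \<phi> f1 f2) = c * codebook_avg m n p1 p2 q \<phi>"
  unfolding codebook_avg_def sum_distrib_left by (intro sum.cong refl) simp

lemma codebook_avg_add:
  "codebook_avg m n p1 p2 q (\<lambda>f1 f2. \<phi> f1 f2 + \<psi> f1 f2) = codebook_avg m n p1 p2 q \<phi> + codebook_avg m n p1 p2 q \<psi>"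
  unfolding codebook_avg_def distrib_left sum.distrib ..

lemma codebook_avg_recv_err:
  "codebook_avg m n p1 p2 q (\<lambda>f1 f2. recv_err P V m n f1 f2 (bad f1 f2))
   = (\<Sum>s1\<in>seqs m. \<Sum>s2\<in>seqs m. \<Sum>w\<in>seqs m. src_prob P m s1 s2 w *
        codebook_avg m n p1 p2 q (\<lambda>f1 f2. \<Sum>y\<in>seqs n. seqV n V (f1 s1) (f2 s2) y * of_bool (bad f1 f2 s1 s2 w y)))"
  unfolding recv_err_def codebook_avg_sum[where Z = "seqs m"] codebook_avg_cmult[symmetric]
  by (simp add: sum_distrib_left mult.assoc)

lemma seq_output:
  fixes p1 :: "'q \<Rightarrow> 'a::finite \<Rightarrow> real" and p2 :: "'q \<Rightarrow> 'b::finite \<Rightarrow> real"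
  shows "(\<Sum>a\<in>seqs n. seqK n p1 q a * seqV n V a x2 y) = (\<Prod>j<n. \<Sum>a\<in>UNIV. p1 (q ! j) a * V a (x2 ! j) (y ! j))"
    and "(\<Sum>c\<in>seqs n. seqK n p2 q c * seqV n V x1 c y) = (\<Prod>j<n. \<Sum>c\<in>UNIV. p2 (q ! j) c * V (x1 ! j) c (y ! j))"
    and "(\<Sum>a\<in>seqs n. \<Sum>c\<in>seqs n. seqK n p1 q a * seqK n p2 q c * seqV n V a c y)
      = (\<Prod>j<n. \<Sum>a\<in>UNIV. \<Sum>c\<in>UNIV. p1 (q ! j) a * p2 (q ! j) c * V a c (y ! j))"
proof -
  show "(\<Sum>a\<in>seqs n. seqK n p1 q a * seqV n V a x2 y) = (\<Prod>j<n. \<Sum>a\<in>UNIV. p1 (q ! j) a * V a (x2 ! j) (y ! j))"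
    unfolding seqK_def seqV_def prod.distrib[symmetric]
    by (rule sum_seqs_prod[of "\<lambda>j a. p1 (q ! j) a * V a (x2 ! j) (y ! j)"])
  show "(\<Sum>c\<in>seqs n. seqK n p2 q c * seqV n V x1 c y) = (\<Prod>j<n. \<Sum>c\<in>UNIV. p2 (q ! j) c * V (x1 ! j) c (y ! j))"
    unfolding seqK_def seqV_def prod.distrib[symmetric]
    by (rule sum_seqs_prod[of "\<lambda>j c. p2 (q ! j) c * V (x1 ! j) c (y ! j)"])
  have "(\<Sum>a\<in>seqs n. \<Sum>c\<in>seqs n. seqK n p1 q a * seqK n p2 q c * seqV n V a c y)
     = (\<Sum>a\<in>seqs n. \<Prod>j<n. \<Sum>c\<in>UNIV. p1 (q ! j) (a ! j) * p2 (q ! j) c * V (a ! j) c (y ! j))"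
    unfolding seqK_def seqV_def prod.distrib[symmetric]
    by (rule sum.cong[OF refl]) (rule sum_seqs_prod[of "\<lambda>j c. p1 (q ! j) (_ ! j) * p2 (q ! j) c * V (_ ! j) c (y ! j)"])
  also have "\<dots> = (\<Prod>j<n. \<Sum>a\<in>UNIV. \<Sum>c\<in>UNIV. p1 (q ! j) a * p2 (q ! j) c * V a c (y ! j))"
    by (rule sum_seqs_prod[of "\<lambda>j a. \<Sum>c\<in>UNIV. p1 (q ! j) a * p2 (q ! j) c * V a c (y ! j)"])
  finally show "(\<Sum>a\<in>seqs n. \<Sum>c\<in>seqs n. seqK n p1 q a * seqK n p2 q c * seqV n V a c y) = \<dots>" .
qed

lemma src_prob_sum:
  fixes P :: "'s1::finite \<Rightarrow> 's2::finite \<Rightarrow> 'w::finite \<Rightarrow> real"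
  assumes "valid_source P"
  shows "(\<Sum>s1\<in>seqs m. \<Sum>s2\<in>seqs m. \<Sum>w\<in>seqs m. src_prob P m s1 s2 w) = 1"
  unfolding src_prob_def sum_seqs_prod3[of P] using assms by (simp add: valid_source_def)

text \<open>The encoders do not see \<open>w\<close>, so the codebooks are drawn given
  \<open>q\<close> alone, while a decoder is chosen for each \<open>q\<close> and \<open>w\<close>.
  The one-shot bound holds for each triple of source blocks and is averaged over the source
  afterwards.\<close>

lemma average_receiver_error:
  fixes P :: "'s1::finite \<Rightarrow> 's2::finite \<Rightarrow> 'w::finite \<Rightarrow> real" and V :: "'x1::finite \<Rightarrow> 'x2::finite \<Rightarrow> 'y::finite \<Rightarrow> real"
    and pq :: "'q::finite \<Rightarrow> real" and p1 :: "'q \<Rightarrow> 'x1 \<Rightarrow> real" and p2 :: "'q \<Rightarrow> 'x2 \<Rightarrow> real"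
  assumes P: "valid_source P" and V: "is_kernel V" and pq: "is_pmf pq" and pmf: "\<And>q. is_pmf (p1 q)" "\<And>q. is_pmf (p2 q)"
    and \<tau>: "0 < \<tau>"
  defines "K1 \<equiv> condK P" and "K2 \<equiv> condK (\<lambda>s2 s1. P s1 s2)"
  defines "J \<equiv> \<lambda>q x1 x2 y. pq q * p1 q x1 * p2 q x2 * V x1 x2 y"
  shows "\<exists>g. ensemble_err P V m n pq p1 p2 g
    \<le> event_prob P J m n (\<lambda>s1 s2 w q x1 x2 y.
         (\<Prod>j<n. V (x1 ! j) (x2 ! j) (y ! j)) * (\<Prod>i<m. K1 (w ! i) (s1 ! i))
           \<le> \<tau> * (\<Prod>j<n. \<Sum>a\<in>UNIV. p1 (q ! j) a * V a (x2 ! j) (y ! j)) \<or>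
         (\<Prod>j<n. V (x1 ! j) (x2 ! j) (y ! j)) * (\<Prod>i<m. K2 (w ! i) (s2 ! i))
           \<le> \<tau> * (\<Prod>j<n. \<Sum>c\<in>UNIV. p2 (q ! j) c * V (x1 ! j) c (y ! j)) \<or>
         (\<Prod>j<n. V (x1 ! j) (x2 ! j) (y ! j)) * (\<Prod>i<m. K1 (w ! i) (s1 ! i) * K2 (w ! i) (s2 ! i))
           \<le> \<tau> * (\<Prod>j<n. \<Sum>a\<in>UNIV. \<Sum>c\<in>UNIV. p1 (q ! j) a * p2 (q ! j) c * V a c (y ! j))) + 3 / \<tau>"
proof -
  have P': "valid_source (\<lambda>s2 s1. P s1 s2)" using P by (rule valid_source_flip)
  have K: "0 \<le> K1 w s1" "0 \<le> K2 w s2" "(\<Sum>s\<in>UNIV. K1 w s) = 1" "(\<Sum>s\<in>UNIV. K2 w s) = 1" for w s1 s2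
    unfolding K1_def K2_def using condK_nonneg[OF P] condK_nonneg[OF P'] condK_sum by auto
  have p: "0 \<le> p1 q a" "0 \<le> p2 q c" "(\<Sum>a\<in>UNIV. p1 q a) = 1" "(\<Sum>c\<in>UNIV. p2 q c) = 1" for q a c
    using pmf[of q] by (auto simp: is_pmf_def)
  have os: "one_shot (seqs m) (seqs m) (seqs n) (seqs n) (seqs n) (seqK n p1 q) (seqK n p2 q) (seqV n V) (seqK m K1 w) (seqK m K2 w) \<tau>"
    for q w
    by unfold_locales (simp_all add: seqK_nonneg seqK_sum seqV_nonneg seqV_sum K p V \<tau>)
  define Bad where "Bad q w s1 s2 x1 x2 y \<longleftrightarrow>
         seqV n V x1 x2 y * seqK m K1 w s1 \<le> \<tau> * (\<Sum>a\<in>seqs n. seqK n p1 q a * seqV n V a x2 y) \<or>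
         seqV n V x1 x2 y * seqK m K2 w s2 \<le> \<tau> * (\<Sum>c\<in>seqs n. seqK n p2 q c * seqV n V x1 c y) \<or>
         seqV n V x1 x2 y * (seqK m K1 w s1 * seqK m K2 w s2) \<le> \<tau> * (\<Sum>a\<in>seqs n. \<Sum>c\<in>seqs n. seqK n p1 q a * seqK n p2 q c * seqV n V a c y)"
    for q w s1 s2 x1 x2 y
  define B where "B q s1 s2 w = (\<Sum>x1\<in>seqs n. \<Sum>x2\<in>seqs n. \<Sum>y\<in>seqs n.
      seqK n p1 q x1 * seqK n p2 q x2 * seqV n V x1 x2 y * of_bool (Bad q w s1 s2 x1 x2 y))" for q s1 s2 w
  let ?D = "\<lambda>q w dec. \<forall>s1\<in>seqs m. \<forall>s2\<in>seqs m.
      codebook_avg m n p1 p2 q (\<lambda>f1 f2. \<Sum>y\<in>seqs n. seqV n V (f1 s1) (f2 s2) y * of_bool (dec f1 f2 y \<noteq> (s1, s2)))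
       \<le> B q s1 s2 w + 3 / \<tau>"
  define dec where "dec q w = (SOME dec. ?D q w dec)" for q w
  have "\<exists>dec. ?D q w dec" for q w
    unfolding codebook_avg_def B_def Bad_def by (rule random_coding[OF os])
  then have "?D q w (dec q w)" for q w unfolding dec_def by (rule someI_ex)
  then have dec: "\<And>q w s1 s2. s1 \<in> seqs m \<Longrightarrow> s2 \<in> seqs m \<Longrightarrow>
      codebook_avg m n p1 p2 q (\<lambda>f1 f2. \<Sum>y\<in>seqs n. seqV n V (f1 s1) (f2 s2) y * of_bool (dec q w f1 f2 y \<noteq> (s1, s2)))
       \<le> B q s1 s2 w + 3 / \<tau>"
    by simp
  have pq': "0 \<le> pq q" "(\<Sum>q\<in>UNIV. pq q) = 1" for q using pq by (auto simp: is_pmf_def)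
  have "(\<Sum>q\<in>seqs n. seqP n pq q * codebook_avg m n p1 p2 q
        (\<lambda>f1 f2. recv_err P V m n f1 f2 (\<lambda>s1 s2 w y. dec q w f1 f2 y \<noteq> (s1, s2))))
     \<le> (\<Sum>q\<in>seqs n. seqP n pq q * (\<Sum>s1\<in>seqs m. \<Sum>s2\<in>seqs m. \<Sum>w\<in>seqs m. src_prob P m s1 s2 w * (B q s1 s2 w + 3 / \<tau>)))"
    unfolding codebook_avg_recv_err
    by (intro sum_mono mult_left_mono dec src_prob_nonneg[OF P] seqP_nonneg pq')
  also have "\<dots> = (\<Sum>q\<in>seqs n. seqP n pq q * (\<Sum>s1\<in>seqs m. \<Sum>s2\<in>seqs m. \<Sum>w\<in>seqs m. src_prob P m s1 s2 w * B q s1 s2 w)) + 3 / \<tau>"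
    unfolding distrib_left sum.distrib sum_distrib_right[symmetric] src_prob_sum[OF P] seqP_sum[OF pq'(2)] by simp
  also have "(\<Sum>q\<in>seqs n. seqP n pq q * (\<Sum>s1\<in>seqs m. \<Sum>s2\<in>seqs m. \<Sum>w\<in>seqs m. src_prob P m s1 s2 w * B q s1 s2 w))
     = (\<Sum>s1\<in>seqs m. \<Sum>s2\<in>seqs m. \<Sum>w\<in>seqs m. \<Sum>q\<in>seqs n. src_prob P m s1 s2 w * (seqP n pq q * B q s1 s2 w))"
  proof -
    have "(\<Sum>q\<in>seqs n. seqP n pq q * (\<Sum>s1\<in>seqs m. \<Sum>s2\<in>seqs m. \<Sum>w\<in>seqs m. src_prob P m s1 s2 w * B q s1 s2 w))
       = (\<Sum>q\<in>seqs n. \<Sum>s1\<in>seqs m. \<Sum>s2\<in>seqs m. \<Sum>w\<in>seqs m. src_prob P m s1 s2 w * (seqP n pq q * B q s1 s2 w))"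
      by (simp add: sum_distrib_left mult_ac)
    also have "\<dots> = (\<Sum>s1\<in>seqs m. \<Sum>q\<in>seqs n. \<Sum>s2\<in>seqs m. \<Sum>w\<in>seqs m. src_prob P m s1 s2 w * (seqP n pq q * B q s1 s2 w))"
      by (rule sum.swap)
    also have "\<dots> = (\<Sum>s1\<in>seqs m. \<Sum>s2\<in>seqs m. \<Sum>q\<in>seqs n. \<Sum>w\<in>seqs m. src_prob P m s1 s2 w * (seqP n pq q * B q s1 s2 w))"
      by (rule sum.cong[OF refl], rule sum.swap)
    also have "\<dots> = (\<Sum>s1\<in>seqs m. \<Sum>s2\<in>seqs m. \<Sum>w\<in>seqs m. \<Sum>q\<in>seqs n. src_prob P m s1 s2 w * (seqP n pq q * B q s1 s2 w))"
      by (rule sum.cong[OF refl], rule sum.cong[OF refl], rule sum.swap)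
    finally show ?thesis .
  qed
  also have "\<dots> = event_prob P J m n (\<lambda>s1 s2 w q x1 x2 y. Bad q w s1 s2 x1 x2 y)"
    unfolding event_prob_def B_def J_def sum_distrib_left src_prob_def seqP_def prod.distrib seqK_def[symmetric] seqV_def[symmetric]
    by (simp only: mult.assoc)
  finally have fin: "(\<Sum>q\<in>seqs n. seqP n pq q * codebook_avg m n p1 p2 q
        (\<lambda>f1 f2. recv_err P V m n f1 f2 (\<lambda>s1 s2 w y. dec q w f1 f2 y \<noteq> (s1, s2))))
     \<le> event_prob P J m n (\<lambda>s1 s2 w q x1 x2 y. Bad q w s1 s2 x1 x2 y) + 3 / \<tau>" .
  note fin' = fin[unfolded Bad_def seq_output, unfolded seqV_def seqK_def prod.distrib[symmetric]]
  show ?thesis unfolding ensemble_err_def by (rule exI[of _ "\<lambda>q f1 f2 y w. dec q w f1 f2 y"]) (rule fin')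
qed

text \<open>The exponent \<open>\<gamma>\<close> has two tasks: being positive, it makes wrong pairs
  rare, and lying below each rate gap, it lets the true pair pass the test.\<close>

lemma receiver_error_vanishes:
  fixes P :: "'s1::finite \<Rightarrow> 's2::finite \<Rightarrow> 'w::finite \<Rightarrow> real" and V :: "'x1::finite \<Rightarrow> 'x2::finite \<Rightarrow> 'y::finite \<Rightarrow> real"
    and pq :: "'q::finite \<Rightarrow> real" and p1 :: "'q \<Rightarrow> 'x1 \<Rightarrow> real" and p2 :: "'q \<Rightarrow> 'x2 \<Rightarrow> real"
  assumes P: "valid_source P" and V: "is_kernel V" and pq: "is_pmf pq" and pmf: "\<And>q. is_pmf (p1 q)" "\<And>q. is_pmf (p2 q)"
    and \<gamma>: "0 < \<gamma>" and n0: "0 < n0"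
    and r1: "n0 * \<gamma> + m0 * H_S1_W P < n0 * (\<Sum>q\<in>UNIV. pq q * mi1 V (p1 q) (p2 q))"
    and r2: "n0 * \<gamma> + m0 * H_S2_W P < n0 * (\<Sum>q\<in>UNIV. pq q * mi1 (flip V) (p2 q) (p1 q))"
    and r12: "n0 * \<gamma> + m0 * (H_S1_W P + H_S2_W P) < n0 * (\<Sum>q\<in>UNIV. pq q * mi12 V (p1 q) (p2 q))"
  shows "\<exists>\<beta>. \<beta> \<longlonglongrightarrow> 0 \<and> (\<forall>l. \<exists>g. ensemble_err P V (l * m0) (l * n0) pq p1 p2 g \<le> \<beta> l)"
proof -
  define K1 where "K1 = condK P"
  define K2 where "K2 = condK (\<lambda>s2 s1. P s1 s2)"
  define J where "J q x1 x2 y = pq q * p1 q x1 * p2 q x2 * V x1 x2 y" for q x1 x2 y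
  define R1 where "R1 q x2 y = (\<Sum>a\<in>UNIV. p1 q a * V a x2 y)" for q x2 y
  define R2 where "R2 q x1 y = (\<Sum>c\<in>UNIV. p2 q c * V x1 c y)" for q x1 y
  define R12 where "R12 q y = (\<Sum>a\<in>UNIV. \<Sum>c\<in>UNIV. p1 q a * p2 q c * V a c y)" for q y
  have P': "valid_source (\<lambda>s2 s1. P s1 s2)" using P by (rule valid_source_flip)
  have P0: "0 \<le> P s1 s2 w" and P1: "(\<Sum>s1\<in>UNIV. \<Sum>s2\<in>UNIV. \<Sum>w\<in>UNIV. P s1 s2 w) = 1" for s1 s2 w
    using P by (auto simp: valid_source_def)
  have K0: "0 \<le> K1 w s1" "0 \<le> K2 w s2" for w s1 s2
    unfolding K1_def K2_def using condK_nonneg[OF P] condK_nonneg[OF P'] by auto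
  have Kpos: "0 < K1 w s1" "0 < K2 w s2" if "0 < P s1 s2 w" for s1 s2 w
    unfolding K1_def K2_def using condK_pos[OF P that] condK_pos[OF P', of s1 s2 w] that by auto
  have p: "0 \<le> p1 q a" "0 \<le> p2 q c" "(\<Sum>a\<in>UNIV. p1 q a) = 1" "(\<Sum>c\<in>UNIV. p2 q c) = 1" for q a c
    using pmf[of q] by (auto simp: is_pmf_def)
  have q: "0 \<le> pq q" "(\<Sum>q\<in>UNIV. pq q) = 1" for q using pq by (auto simp: is_pmf_def)
  have V0: "0 \<le> V a c y" and V1: "(\<Sum>y\<in>UNIV. V a c y) = 1" for a c y using V by (auto simp: is_kernel_def)
  have J0: "0 \<le> J q x1 x2 y" for q x1 x2 y unfolding J_def by (intro mult_nonneg_nonneg p q V0)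
  have J1: "(\<Sum>q\<in>UNIV. \<Sum>x1\<in>UNIV. \<Sum>x2\<in>UNIV. \<Sum>y\<in>UNIV. J q x1 x2 y) = 1"
    unfolding J_def sum_distrib_left[symmetric] V1 by (simp add: p q flip: sum_distrib_left)
  have R0: "0 \<le> R1 q x2 y" "0 \<le> R2 q x1 y" "0 \<le> R12 q y" for q x1 x2 y
    unfolding R1_def R2_def R12_def by (intro sum_nonneg mult_nonneg_nonneg p V0)+
  have pos: "0 < V x1 x2 y \<and> 0 < R1 q x2 y" "0 < V x1 x2 y \<and> 0 < R2 q x1 y" "0 < V x1 x2 y \<and> 0 < R12 q y"
    if "0 < J q x1 x2 y" for q x1 x2 y
  proof -
    have "p1 q x1 \<noteq> 0" "p2 q x2 \<noteq> 0" "V x1 x2 y \<noteq> 0" using that by (auto simp: J_def)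
    then have pv: "0 < p1 q x1" "0 < p2 q x2" "0 < V x1 x2 y" using p V0 by (auto simp: less_le)
    have "p1 q x1 * V x1 x2 y \<le> R1 q x2 y" unfolding R1_def
      by (rule member_le_sum[of x1 UNIV "\<lambda>a. p1 q a * V a x2 y"]) (use p V0 in auto)
    moreover have "p2 q x2 * V x1 x2 y \<le> R2 q x1 y" unfolding R2_def
      by (rule member_le_sum[of x2 UNIV "\<lambda>c. p2 q c * V x1 c y"]) (use p V0 in auto)
    moreover have "p1 q x1 * p2 q x2 * V x1 x2 y \<le> (\<Sum>c\<in>UNIV. p1 q x1 * p2 q c * V x1 c y)"
      by (rule member_le_sum[of x2 UNIV "\<lambda>c. p1 q x1 * p2 q c * V x1 c y"]) (use p V0 in auto)
    moreover have "(\<Sum>c\<in>UNIV. p1 q x1 * p2 q c * V x1 c y) \<le> R12 q y" unfolding R12_def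
      by (rule member_le_sum[of x1 UNIV "\<lambda>a. \<Sum>c\<in>UNIV. p1 q a * p2 q c * V a c y"])
         (use p V0 in \<open>auto intro!: sum_nonneg\<close>)
    moreover have "0 < p1 q x1 * V x1 x2 y" "0 < p2 q x2 * V x1 x2 y" "0 < p1 q x1 * p2 q x2 * V x1 x2 y"
      using pv by auto
    ultimately show "0 < V x1 x2 y \<and> 0 < R1 q x2 y" "0 < V x1 x2 y \<and> 0 < R2 q x1 y" "0 < V x1 x2 y \<and> 0 < R12 q y"
      using pv by linarith+
  qed
  have H1: "(\<Sum>s1\<in>UNIV. \<Sum>s2\<in>UNIV. \<Sum>w\<in>UNIV. P s1 s2 w * log 2 (K1 w s1)) = - H_S1_W P"
    unfolding H_S1_W_eq[OF P] K1_def by simp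
  have H2: "(\<Sum>s1\<in>UNIV. \<Sum>s2\<in>UNIV. \<Sum>w\<in>UNIV. P s1 s2 w * log 2 (K2 w s2)) = - H_S2_W P"
    unfolding H_S2_W_flip H_S1_W_eq[OF P'] K2_def by (subst sum.swap) simp
  have H12: "(\<Sum>s1\<in>UNIV. \<Sum>s2\<in>UNIV. \<Sum>w\<in>UNIV. P s1 s2 w * log 2 (K1 w s1 * K2 w s2)) = - (H_S1_W P + H_S2_W P)"
  proof -
    have e: "P s1 s2 w * log 2 (K1 w s1 * K2 w s2) = P s1 s2 w * log 2 (K1 w s1) + P s1 s2 w * log 2 (K2 w s2)" for s1 s2 w
      using P0[of s1 s2 w] Kpos[of s1 s2 w] by (cases "P s1 s2 w = 0") (auto simp: log_mult_pos distrib_left)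
    show ?thesis unfolding e sum.distrib H1 H2 by simp
  qed
  have I1: "(\<Sum>q\<in>UNIV. \<Sum>x1\<in>UNIV. \<Sum>x2\<in>UNIV. \<Sum>y\<in>UNIV. J q x1 x2 y * log 2 (V x1 x2 y / R1 q x2 y))
      = (\<Sum>q\<in>UNIV. pq q * mi1 V (p1 q) (p2 q))"
    unfolding J_def R1_def mi1_def sum_distrib_left by (simp only: mult.assoc)
  have I2: "(\<Sum>q\<in>UNIV. \<Sum>x1\<in>UNIV. \<Sum>x2\<in>UNIV. \<Sum>y\<in>UNIV. J q x1 x2 y * log 2 (V x1 x2 y / R2 q x1 y))
      = (\<Sum>q\<in>UNIV. pq q * mi1 (flip V) (p2 q) (p1 q))"
    unfolding J_def R2_def mi1_def flip_def sum_distrib_left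
    by (rule sum.cong[OF refl], subst sum.swap) (simp only: mult_ac)
  have I12: "(\<Sum>q\<in>UNIV. \<Sum>x1\<in>UNIV. \<Sum>x2\<in>UNIV. \<Sum>y\<in>UNIV. J q x1 x2 y * log 2 (V x1 x2 y / R12 q y))
      = (\<Sum>q\<in>UNIV. pq q * mi12 V (p1 q) (p2 q))"
    unfolding J_def R12_def mi12_def sum_distrib_left by (simp only: mult.assoc)
  have r12': "n0 * \<gamma> - m0 * (- H_S1_W P - H_S2_W P) < n0 * (\<Sum>q\<in>UNIV. pq q * mi12 V (p1 q) (p2 q))"
    using r12 by (simp add: algebra_simps)
  let ?E1 = "\<lambda>m n \<tau> s1 s2 w q x1 x2 y. (\<Prod>j<n. V (x1 ! j) (x2 ! j) (y ! j)) * (\<Prod>i<m. K1 (w ! i) (s1 ! i))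
           \<le> \<tau> * (\<Prod>j<n. R1 (q ! j) (x2 ! j) (y ! j))"
  let ?E2 = "\<lambda>m n \<tau> s1 s2 w q x1 x2 y. (\<Prod>j<n. V (x1 ! j) (x2 ! j) (y ! j)) * (\<Prod>i<m. K2 (w ! i) (s2 ! i))
           \<le> \<tau> * (\<Prod>j<n. R2 (q ! j) (x1 ! j) (y ! j))"
  let ?E12 = "\<lambda>m n \<tau> s1 s2 w q x1 x2 y. (\<Prod>j<n. V (x1 ! j) (x2 ! j) (y ! j)) * (\<Prod>i<m. K1 (w ! i) (s1 ! i) * K2 (w ! i) (s2 ! i))
           \<le> \<tau> * (\<Prod>j<n. R12 (q ! j) (y ! j))"
  let ?\<tau> = "\<lambda>l. 2 powr (\<gamma> * real (l * n0))"
  have "\<exists>\<rho>. 0 \<le> \<rho> \<and> \<rho> < 1 \<and> (\<forall>l. event_prob P J (l * m0) (l * n0) (?E1 (l * m0) (l * n0) (?\<tau> l)) \<le> \<rho> ^ l)"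
    by (rule bad_event_vanishes[where \<kappa> = "\<lambda>s1 s2 w. K1 w s1" and V = "\<lambda>q. V" and R = "\<lambda>q x1. R1 q"])
       (use P0 P1 K0 Kpos J0 J1 R0 V0 pos r1 in \<open>auto simp: H1 I1\<close>)
  then obtain \<rho>1 where \<rho>1: "0 \<le> \<rho>1" "\<rho>1 < 1" "\<And>l. event_prob P J (l * m0) (l * n0) (?E1 (l * m0) (l * n0) (?\<tau> l)) \<le> \<rho>1 ^ l" by blast
  have "\<exists>\<rho>. 0 \<le> \<rho> \<and> \<rho> < 1 \<and> (\<forall>l. event_prob P J (l * m0) (l * n0) (?E2 (l * m0) (l * n0) (?\<tau> l)) \<le> \<rho> ^ l)"
    by (rule bad_event_vanishes[where \<kappa> = "\<lambda>s1 s2 w. K2 w s2" and V = "\<lambda>q. V" and R = "\<lambda>q x1 x2. R2 q x1"])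
       (use P0 P1 K0 Kpos J0 J1 R0 V0 pos r2 in \<open>auto simp: H2 I2\<close>)
  then obtain \<rho>2 where \<rho>2: "0 \<le> \<rho>2" "\<rho>2 < 1" "\<And>l. event_prob P J (l * m0) (l * n0) (?E2 (l * m0) (l * n0) (?\<tau> l)) \<le> \<rho>2 ^ l" by blast
  have "\<exists>\<rho>. 0 \<le> \<rho> \<and> \<rho> < 1 \<and> (\<forall>l. event_prob P J (l * m0) (l * n0) (?E12 (l * m0) (l * n0) (?\<tau> l)) \<le> \<rho> ^ l)"
    by (rule bad_event_vanishes[where \<kappa> = "\<lambda>s1 s2 w. K1 w s1 * K2 w s2" and V = "\<lambda>q. V" and R = "\<lambda>q x1 x2. R12 q"])
       (use P0 P1 K0 Kpos J0 J1 R0 V0 pos r12' in \<open>auto simp: H12 I12\<close>)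
  then obtain \<rho>3 where \<rho>3: "0 \<le> \<rho>3" "\<rho>3 < 1" "\<And>l. event_prob P J (l * m0) (l * n0) (?E12 (l * m0) (l * n0) (?\<tau> l)) \<le> \<rho>3 ^ l" by blast
  \<comment> \<open>The decay of the false alarm term \<open>3 / \<tau>\<close> for each step of
    \<open>l\<close>.\<close>
  define \<sigma> where "\<sigma> = 2 powr (- \<gamma> * real n0)"
  have \<sigma>: "0 \<le> \<sigma>" "\<sigma> < 1" using \<gamma> n0 by (auto simp: \<sigma>_def powr_less_one)
  have \<sigma>l: "3 / ?\<tau> l = 3 * \<sigma> ^ l" for l
    by (simp add: \<sigma>_def powr_minus_divide powr_power[symmetric] powr_realpow[symmetric] powr_powr mult_ac power_one_over flip: powr_numeral)
  define \<beta> where "\<beta> l = \<rho>1 ^ l + \<rho>2 ^ l + \<rho>3 ^ l + 3 * \<sigma> ^ l" for l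
  have "\<beta> \<longlonglongrightarrow> 0 + 0 + 0 + 3 * 0" unfolding \<beta>_def
    by (intro tendsto_intros LIMSEQ_power_zero) (use \<rho>1 \<rho>2 \<rho>3 \<sigma> in auto)
  moreover have "\<exists>g. ensemble_err P V (l * m0) (l * n0) pq p1 p2 g \<le> \<beta> l" for l
  proof -
    let ?m = "l * m0" and ?n = "l * n0"
    let ?E = "\<lambda>s1 s2 w q x1 x2 y. ?E1 ?m ?n (?\<tau> l) s1 s2 w q x1 x2 y \<or> ?E2 ?m ?n (?\<tau> l) s1 s2 w q x1 x2 y \<or> ?E12 ?m ?n (?\<tau> l) s1 s2 w q x1 x2 y"
    have "\<exists>g. ensemble_err P V ?m ?n pq p1 p2 g \<le> event_prob P J ?m ?n ?E + 3 / ?\<tau> l"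
      unfolding K1_def K2_def R1_def R2_def R12_def J_def[abs_def]
      by (rule average_receiver_error[OF P V pq pmf]) simp
    moreover have "event_prob P J ?m ?n ?E \<le> event_prob P J ?m ?n (?E1 ?m ?n (?\<tau> l)) + event_prob P J ?m ?n (?E2 ?m ?n (?\<tau> l))
        + event_prob P J ?m ?n (?E12 ?m ?n (?\<tau> l))"
      by (rule event_prob_union3) (use P0 J0 in auto)
    ultimately show ?thesis using \<rho>1(3)[of l] \<rho>2(3)[of l] \<rho>3(3)[of l] \<sigma>l[of l] unfolding \<beta>_def
      by (smt (verit, best))
  qed
  ultimately show ?thesis by (intro exI[of _ \<beta>]) auto
qed

text \<open>A divergence from the law in which, given the second input, the output is independent of
  the first. The sign is needed in \<open>achievability\<close> to see that \<open>b\<close> is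
  positive.\<close>

lemma mi1_nonneg:
  assumes V: "is_kernel V" and p: "is_pmf p1" "is_pmf p2"
  shows "0 \<le> mi1 V p1 p2"
proof -
  have V0: "0 \<le> V a c y" and V1: "(\<Sum>y\<in>UNIV. V a c y) = 1" for a c y using V by (auto simp: is_kernel_def)
  have p0: "0 \<le> p1 a" "0 \<le> p2 c" "(\<Sum>a\<in>UNIV. p1 a) = 1" "(\<Sum>c\<in>UNIV. p2 c) = 1" for a c
    using p by (auto simp: is_pmf_def)
  define r where "r c y = (\<Sum>a\<in>UNIV. p1 a * V a c y)" for c y
  have r0: "0 \<le> r c y" for c y unfolding r_def by (intro sum_nonneg mult_nonneg_nonneg p0 V0)
  have r1: "(\<Sum>y\<in>UNIV. r c y) = 1" for c
    unfolding r_def by (subst sum.swap) (simp add: V1 p0 flip: sum_distrib_left)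
  have "0 \<le> (\<Sum>a\<in>UNIV. \<Sum>c\<in>UNIV. \<Sum>y\<in>UNIV. p1 a * p2 c * V a c y
      * log 2 (p1 a * p2 c * V a c y / (p1 a * p2 c * r c y)))"
  proof (rule gibbs3)
    fix a c y assume "0 < p1 a * p2 c * V a c y"
    then have "p1 a \<noteq> 0" "p2 c \<noteq> 0" "V a c y \<noteq> 0" by auto
    then have pos: "0 < p1 a" "0 < p2 c" "0 < p1 a * V a c y" using p0 V0[of a c y] by (auto simp: less_le)
    note pos(3)
    also have "p1 a * V a c y \<le> r c y" unfolding r_def
      by (rule member_le_sum[of a UNIV "\<lambda>a. p1 a * V a c y"]) (use p0 V0 in auto)
    finally show "0 < p1 a * p2 c * r c y" using pos by simp
  next
    show "(\<Sum>a\<in>UNIV. \<Sum>c\<in>UNIV. \<Sum>y\<in>UNIV. p1 a * p2 c * r c y) \<le> (\<Sum>a\<in>UNIV. \<Sum>c\<in>UNIV. \<Sum>y\<in>UNIV. p1 a * p2 c * V a c y)"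
      unfolding sum_distrib_left[symmetric] r1 V1 ..
  qed (auto simp: p0 V0 r0)
  also have "\<dots> = mi1 V p1 p2" unfolding mi1_def r_def[symmetric]
  proof (intro sum.cong refl)
    fix a c y
    show "p1 a * p2 c * V a c y * log 2 (p1 a * p2 c * V a c y / (p1 a * p2 c * r c y))
      = p1 a * p2 c * V a c y * log 2 (V a c y / r c y)"
      by (cases "p1 a = 0 \<or> p2 c = 0") auto
  qed
  finally show ?thesis .
qed

lemma H_S1_W_nonneg:
  assumes "valid_source P"
  shows "0 \<le> H_S1_W P"
proof -
  have "condK P w s \<le> 1" for w s
    using member_le_sum[of s UNIV "condK P w"] condK_nonneg[OF assms] condK_sum[of P w] by simp
  then have "log 2 (condK P w s) \<le> 0" for w s
    using condK_nonneg[OF assms, of w s] by (cases "condK P w s = 0") (simp add: log_def, simp add: less_le)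
  then have "P s1 s2 w * log 2 (condK P w s1) \<le> 0" for s1 s2 w
    using assms by (intro mult_nonneg_nonpos) (auto simp: valid_source_def)
  then show ?thesis unfolding H_S1_W_eq[OF assms] by (simp add: sum_nonpos)
qed

text \<open>One code has to serve both receivers, so their errors are added before \<open>q\<close>
  and then the codebooks are fixed at values no worse than the mean.\<close>

lemma good_code_exists:
  fixes P :: "'s1::finite \<Rightarrow> 's2::finite \<Rightarrow> 'w::finite \<Rightarrow> real"
    and Ch :: "'x1::finite \<Rightarrow> 'x2::finite \<Rightarrow> 'y1::finite \<Rightarrow> 'y2::finite \<Rightarrow> real"
    and pq :: "'q::finite \<Rightarrow> real"
  assumes P: "valid_source P" and Ch: "valid_channel Ch" and pq: "is_pmf pq"
    and pmf: "\<And>q. is_pmf (p1 q)" "\<And>q. is_pmf (p2 q)"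
    and B1: "ensemble_err P (chan1 Ch) m n pq p1 p2 g1 \<le> B1"
    and B2: "ensemble_err P (chan2 Ch) m n pq p1 p2 g2 \<le> B2"
  shows "\<exists>f1 f2 d1 d2. (\<forall>s\<in>seqs m. length (f1 s) = n) \<and> (\<forall>s\<in>seqs m. length (f2 s) = n)
     \<and> err_prob P Ch m n f1 f2 d1 d2 \<le> B1 + B2"
proof -
  have p: "0 \<le> p1 q a" "0 \<le> p2 q c" "(\<Sum>a\<in>UNIV. p1 q a) = 1" "(\<Sum>c\<in>UNIV. p2 q c) = 1" for q a c
    using pmf[of q] by (auto simp: is_pmf_def)
  have pq': "0 \<le> pq q" "(\<Sum>q\<in>UNIV. pq q) = 1" for q using pq by (auto simp: is_pmf_def)
  let ?F1 = "PiE (seqs m :: 's1 list set) (\<lambda>_. seqs n :: 'x1 list set)"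
  let ?F2 = "PiE (seqs m :: 's2 list set) (\<lambda>_. seqs n :: 'x2 list set)"
  let ?e = "\<lambda>q f1 f2. recv_err P (chan1 Ch) m n f1 f2 (\<lambda>s1 s2 w y. g1 q f1 f2 y w \<noteq> (s1, s2))
      + recv_err P (chan2 Ch) m n f1 f2 (\<lambda>s1 s2 w y. g2 q f1 f2 y w \<noteq> (s1, s2))"
  have "(\<Sum>q\<in>seqs n. seqP n pq q * codebook_avg m n p1 p2 q (?e q)) \<le> B1 + B2"
    using add_mono[OF B1 B2] by (simp add: ensemble_err_def codebook_avg_add distrib_left sum.distrib)
  then have "\<exists>q\<in>seqs n. codebook_avg m n p1 p2 q (?e q) \<le> B1 + B2"
    by (intro ex_le_weighted_average[where w = "seqP n pq"]) (simp_all add: seqP_nonneg seqP_sum pq')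
  then obtain q where q: "codebook_avg m n p1 p2 q (?e q) \<le> B1 + B2" by blast
  let ?W = "\<lambda>f. (\<Prod>s\<in>seqs m. seqK n p1 q (fst f s)) * (\<Prod>s\<in>seqs m. seqK n p2 q (snd f s))"
  have "\<exists>f\<in>?F1 \<times> ?F2. ?e q (fst f) (snd f) \<le> B1 + B2"
  proof (rule ex_le_weighted_average[where w = ?W])
    show "finite (?F1 \<times> ?F2)" by (intro finite_cartesian_product finite_PiE finite_seqs)
    show "0 \<le> ?W f" for f by (intro mult_nonneg_nonneg prod_nonneg ballI seqK_nonneg p)
    have "(\<Sum>f\<in>?F1 \<times> ?F2. ?W f) = (\<Sum>f1\<in>?F1. \<Prod>s\<in>seqs m. seqK n p1 q (f1 s)) * (\<Sum>f2\<in>?F2. \<Prod>s\<in>seqs m. seqK n p2 q (f2 s))"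
      unfolding sum.cartesian_product' fst_conv snd_conv by (simp add: sum_product)
    also have "\<dots> = 1" by (simp add: sum_PiE_prod seqK_sum p)
    finally show "(\<Sum>f\<in>?F1 \<times> ?F2. ?W f) = 1" .
    show "(\<Sum>f\<in>?F1 \<times> ?F2. ?W f * ?e q (fst f) (snd f)) \<le> B1 + B2"
      using q unfolding codebook_avg_def sum.cartesian_product' fst_conv snd_conv .
  qed
  then obtain f1 f2 where f: "f1 \<in> ?F1" "f2 \<in> ?F2" "?e q f1 f2 \<le> B1 + B2" by auto
  \<comment> \<open>Each receiver keeps only its own component of the decoded pair, which can only
    lower its error.\<close>
  let ?d1 = "\<lambda>y w. fst (g1 q f1 f2 y w)" and ?d2 = "\<lambda>y w. snd (g2 q f1 f2 y w)"
  have mono: "recv_err P V m n f1 f2 bad \<le> recv_err P V m n f1 f2 bad'"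
    if "is_kernel V" "\<And>s1 s2 w y. bad s1 s2 w y \<Longrightarrow> bad' s1 s2 w y" for V :: "'x1 \<Rightarrow> 'x2 \<Rightarrow> 'y::finite \<Rightarrow> real" and bad bad'
    unfolding recv_err_def
    by (intro sum_mono mult_left_mono mult_nonneg_nonneg src_prob_nonneg[OF P] seqV_nonneg that(1)) (use that(2) in auto)
  have "err_prob P Ch m n f1 f2 ?d1 ?d2 \<le> recv_err P (chan1 Ch) m n f1 f2 (\<lambda>s1 s2 w y. ?d1 y w \<noteq> s1)
      + recv_err P (chan2 Ch) m n f1 f2 (\<lambda>s1 s2 w y. ?d2 y w \<noteq> s2)"
    by (rule err_prob_le_recv_err[OF P Ch])
  also have "\<dots> \<le> ?e q f1 f2"
    by (intro add_mono mono is_kernel_marg[OF Ch]) auto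
  also have "\<dots> \<le> B1 + B2" by (rule f(3))
  finally have "err_prob P Ch m n f1 f2 ?d1 ?d2 \<le> B1 + B2" .
  moreover have "\<forall>s\<in>seqs m. length (f1 s) = n" "\<forall>s\<in>seqs m. length (f2 s) = n"
    using f(1,2) by (auto simp: length_seqs dest: PiE_mem)
  ultimately show ?thesis by blast
qed

text \<open>\<open>achievable\<close> demands \<open>n / m = b\<close> exactly, so \<open>b\<close>
  has to be a quotient of naturals; the codes use the multiples of one such pair of lengths.\<close>

lemma achievability:
  fixes P :: "'s1::finite \<Rightarrow> 's2::finite \<Rightarrow> 'w::finite \<Rightarrow> real"
    and Ch :: "'x1::finite \<Rightarrow> 'x2::finite \<Rightarrow> 'y1::finite \<Rightarrow> 'y2::finite \<Rightarrow> real"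
  assumes P: "valid_source P" and Ch: "valid_channel Ch" and "b \<in> \<rat>"
    and Q: "Q_dist pq p1 p2" and region: "region_conds (<) P Ch b pq p1 p2"
  shows "achievable P Ch b"
proof -
  have k: "is_kernel (chan1 Ch)" "is_kernel (chan2 Ch)" using Ch by (simp_all add: is_kernel_marg)
  note cm1 = cond_mi_Q_joint[OF Ch Q, where \<pi> = "\<lambda>y1 y2. y1" and out = "out_Y 1"]
  note cm2 = cond_mi_Q_joint[OF Ch Q, where \<pi> = "\<lambda>y1 y2. y2" and out = "out_Y 2"]
  have o1: "out_Y 1 (q', x1', x2', y1', y2') = out_Y 1 (q, x1, x2, y1, y2) \<longleftrightarrow> y1' = y1"
    and o2: "out_Y 2 (q', x1', x2', y1', y2') = out_Y 2 (q, x1, x2, y1, y2) \<longleftrightarrow> y2' = y2"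
    for q q' :: nat and x1 x1' :: 'x1 and x2 x2' :: 'x2 and y1 y1' :: 'y1 and y2 y2' :: 'y2
    by (simp_all add: out_Y_def)
  \<comment> \<open>The ensemble indexes time sharing by a finite type.
    \<open>bool \<times> bool\<close> has the four elements that replace the index set
    \<open>{..<4}\<close>.\<close>
  obtain e :: "bool \<times> bool \<Rightarrow> nat" where e: "bij_betw e UNIV {..<4}"
    using finite_same_card_bij[of "UNIV :: (bool \<times> bool) set" "{..<4::nat}"] by auto
  have e4: "e q < 4" for q using e by (auto simp: bij_betw_def)
  have re: "(\<Sum>q\<in>UNIV. h (e q)) = (\<Sum>q<4. h q)" for h :: "nat \<Rightarrow> real" by (rule sum.reindex_bij_betw[OF e])
  let ?V1 = "chan1 Ch" and ?V2 = "chan2 Ch"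
  let ?I1 = "\<Sum>q\<in>UNIV. pq (e q) * mi1 ?V1 (p1 (e q)) (p2 (e q))"
  let ?I2 = "\<Sum>q\<in>UNIV. pq (e q) * mi1 (flip ?V1) (p2 (e q)) (p1 (e q))"
  let ?I3 = "\<Sum>q\<in>UNIV. pq (e q) * mi12 ?V1 (p1 (e q)) (p2 (e q))"
  let ?I4 = "\<Sum>q\<in>UNIV. pq (e q) * mi1 ?V2 (p1 (e q)) (p2 (e q))"
  let ?I5 = "\<Sum>q\<in>UNIV. pq (e q) * mi1 (flip ?V2) (p2 (e q)) (p1 (e q))"
  let ?I6 = "\<Sum>q\<in>UNIV. pq (e q) * mi12 ?V2 (p1 (e q)) (p2 (e q))"
  have r: "H_S1_W P < b * ?I1" "H_S2_W P < b * ?I2" "H_S1_W P + H_S2_W P < b * ?I3"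
      "H_S1_W P < b * ?I4" "H_S2_W P < b * ?I5" "H_S1_W P + H_S2_W P < b * ?I6"
    using region unfolding region_conds_def re[of "\<lambda>q. pq q * mi1 ?V1 (p1 q) (p2 q)"]
      re[of "\<lambda>q. pq q * mi1 (flip ?V1) (p2 q) (p1 q)"] re[of "\<lambda>q. pq q * mi12 ?V1 (p1 q) (p2 q)"]
      re[of "\<lambda>q. pq q * mi1 ?V2 (p1 q) (p2 q)"]
      re[of "\<lambda>q. pq q * mi1 (flip ?V2) (p2 q) (p1 q)"] re[of "\<lambda>q. pq q * mi12 ?V2 (p1 q) (p2 q)"]
    by (simp_all add: cm1[OF o1] cm2[OF o2] del: One_nat_def)
  have pmf: "is_pmf (\<lambda>q. pq (e q))" "\<And>q. is_pmf (p1 (e q))" "\<And>q. is_pmf (p2 (e q))"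
    using Q e4 re[of pq] by (auto simp: Q_dist_def is_pmf_def)
  have "0 < b"
  proof (rule ccontr)
    assume "\<not> 0 < b"
    moreover have "0 \<le> ?I1"
      using pmf(1) by (intro sum_nonneg mult_nonneg_nonneg mi1_nonneg k pmf) (auto simp: is_pmf_def)
    ultimately have "b * ?I1 \<le> 0" by (intro mult_nonpos_nonneg) auto
    then show False using r(1) H_S1_W_nonneg[OF P] by linarith
  qed
  obtain n0 m0 :: nat where "m0 \<noteq> 0" "\<bar>b\<bar> = real n0 / real m0"
    using Rats_abs_nat_div_natE[OF \<open>b \<in> \<rat>\<close>] by blast
  then have b: "b = n0 / m0" "0 < m0" "0 < n0" using \<open>0 < b\<close> by (auto intro: gr0I)
  define D where "D = {n0 * ?I1 - m0 * H_S1_W P, n0 * ?I2 - m0 * H_S2_W P, n0 * ?I3 - m0 * (H_S1_W P + H_S2_W P),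
      n0 * ?I4 - m0 * H_S1_W P, n0 * ?I5 - m0 * H_S2_W P, n0 * ?I6 - m0 * (H_S1_W P + H_S2_W P)}"
  have gap: "0 < n0 * I - m0 * h" if "h < b * I" for h I :: real
  proof -
    have "m0 * h < m0 * (b * I)" using that b by (intro mult_strict_left_mono) auto
    also have "m0 * (b * I) = n0 * I" using b by simp
    finally show ?thesis by simp
  qed
  have D: "finite D" "D \<noteq> {}" "\<And>d. d \<in> D \<Longrightarrow> 0 < d" unfolding D_def using r[THEN gap] by auto
  \<comment> \<open>Half of the smallest of the six gaps, per channel use. The halving makes
    \<open>n0 * \<gamma>\<close> strictly smaller than every gap.\<close>
  define \<gamma> where "\<gamma> = Min D / (2 * n0)"
  have "Min D \<in> D" using D by (intro Min_in)
  then have M: "0 < Min D" by (rule D(3))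
  then have "0 < \<gamma>" using b by (simp add: \<gamma>_def)
  have "n0 * \<gamma> < d" if "d \<in> D" for d
  proof -
    have "n0 * \<gamma> = Min D / 2" using b by (simp add: \<gamma>_def)
    also have "\<dots> < Min D" using M by simp
    also have "\<dots> \<le> d" using D that by simp
    finally show ?thesis .
  qed
  then have g: "n0 * \<gamma> + m0 * H_S1_W P < n0 * ?I1" "n0 * \<gamma> + m0 * H_S2_W P < n0 * ?I2"
      "n0 * \<gamma> + m0 * (H_S1_W P + H_S2_W P) < n0 * ?I3"
      "n0 * \<gamma> + m0 * H_S1_W P < n0 * ?I4" "n0 * \<gamma> + m0 * H_S2_W P < n0 * ?I5"
      "n0 * \<gamma> + m0 * (H_S1_W P + H_S2_W P) < n0 * ?I6"
    unfolding D_def less_diff_eq[symmetric] by blast+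
  obtain \<beta>1 where \<beta>1: "\<beta>1 \<longlonglongrightarrow> 0" "\<And>l. \<exists>g. ensemble_err P ?V1 (l * m0) (l * n0) (\<lambda>q. pq (e q)) (\<lambda>q. p1 (e q)) (\<lambda>q. p2 (e q)) g \<le> \<beta>1 l"
    using receiver_error_vanishes[where ?p1.0 = "\<lambda>q. p1 (e q)" and ?p2.0 = "\<lambda>q. p2 (e q)", OF P k(1) pmf \<open>0 < \<gamma>\<close> b(3) g(1-3)] by blast
  obtain \<beta>2 where \<beta>2: "\<beta>2 \<longlonglongrightarrow> 0" "\<And>l. \<exists>g. ensemble_err P ?V2 (l * m0) (l * n0) (\<lambda>q. pq (e q)) (\<lambda>q. p1 (e q)) (\<lambda>q. p2 (e q)) g \<le> \<beta>2 l"
    using receiver_error_vanishes[where ?p1.0 = "\<lambda>q. p1 (e q)" and ?p2.0 = "\<lambda>q. p2 (e q)", OF P k(2) pmf \<open>0 < \<gamma>\<close> b(3) g(4-6)] by blast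
  have lim: "(\<lambda>l. \<beta>1 l + \<beta>2 l) \<longlonglongrightarrow> 0" using tendsto_add[OF \<beta>1(1) \<beta>2(1)] by simp
  show ?thesis unfolding achievable_def
  proof (intro allI impI)
    fix \<epsilon> :: real assume "0 < \<epsilon>"
    have "\<forall>\<^sub>F l in sequentially. \<beta>1 l + \<beta>2 l < \<epsilon> \<and> 0 < l"
      using order_tendstoD(2)[OF lim \<open>0 < \<epsilon>\<close>] eventually_gt_at_top[of 0] by (rule eventually_conj)
    then obtain l where l: "\<beta>1 l + \<beta>2 l < \<epsilon>" "0 < l" using eventually_happens[of _ sequentially] by auto
    obtain g1 where g1: "ensemble_err P ?V1 (l * m0) (l * n0) (\<lambda>q. pq (e q)) (\<lambda>q. p1 (e q)) (\<lambda>q. p2 (e q)) g1 \<le> \<beta>1 l"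
      using \<beta>1(2)[of l] by blast
    obtain g2 where g2: "ensemble_err P ?V2 (l * m0) (l * n0) (\<lambda>q. pq (e q)) (\<lambda>q. p1 (e q)) (\<lambda>q. p2 (e q)) g2 \<le> \<beta>2 l"
      using \<beta>2(2)[of l] by blast
    obtain f1 f2 d1 d2 where c: "\<forall>s\<in>seqs (l * m0). length (f1 s) = l * n0" "\<forall>s\<in>seqs (l * m0). length (f2 s) = l * n0"
        "err_prob P Ch (l * m0) (l * n0) f1 f2 d1 d2 \<le> \<beta>1 l + \<beta>2 l"
      using good_code_exists[where ?p1.0 = "\<lambda>q. p1 (e q)" and ?p2.0 = "\<lambda>q. p2 (e q)", OF P Ch pmf g1 g2] by blast
    have "0 < l * m0" "0 < l * n0" "real (l * n0) / real (l * m0) = b" using l b by auto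
    moreover have "err_prob P Ch (l * m0) (l * n0) f1 f2 d1 d2 < \<epsilon>" using c(3) l(1) by simp
    ultimately show "\<exists>m n. 0 < m \<and> 0 < n \<and> real n / real m = b \<and>
       (\<exists>f1 f2 g1 g2. (\<forall>s\<in>seqs m. length (f1 s) = n) \<and> (\<forall>s\<in>seqs m. length (f2 s) = n) \<and>
          err_prob P Ch m n f1 f2 g1 g2 < \<epsilon>)"
      using c(1,2) by blast
  qed
qed

theorem theorem10:
  fixes P :: "'s1::finite \<Rightarrow> 's2::finite \<Rightarrow> 'w::finite \<Rightarrow> real"
    and Ch :: "'x1::finite \<Rightarrow> 'x2::finite \<Rightarrow> 'y1::finite \<Rightarrow> 'y2::finite \<Rightarrow> real"
    and b :: real
  assumes "valid_source P" and "valid_channel Ch"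
    and "markov_S1_W_S2 P" and "strong_interference Ch"
    and "b \<in> \<rat>"
  shows "((\<exists>pq p1 p2. Q_dist pq p1 p2 \<and> region_conds (<) P Ch b pq p1 p2) \<longrightarrow> achievable P Ch b) \<and>
         (achievable P Ch b \<longrightarrow> (\<exists>pq p1 p2. Q_dist pq p1 p2 \<and> region_conds (\<le>) P Ch b pq p1 p2))"
  using achievability[OF assms(1,2,5)] converse[OF assms(1,3,2,4)] by blast

end
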